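(* Let $A$ and $B$ be finite-dimensional $\Bbbk$-algebras and $G: A\text{-mod}\to B\text{-mod}$ a $\Bbbk$-linear functor (no exactness assumed). Consider the functor $\widetilde G: A\text{-mod}\times A\text{-mod}^{\rm opp}\to B\text{-bimod-}A$, $(m,\overline n)\mapsto G(m)\otimes_{\Bbbk} n^*$. (1) The end of $\widetilde G$ is, as a $B$-$A$-bimodule, $$\int_{m\in A\text{-mod}}G(m)\otimes_{\Bbbk} m^* = G(A),$$ with the natural $B$-$A$-bimodule structure on $G(A)$ and with dinatural family $$i^A_m:=G(\hat\rho_m): G(A)\to G(m)\otimes_{\Bbbk} m^*,\qquad \hat\rho_m:=(\rho_m\otimes_{\Bbbk}\mathrm{id}_{m^*})\circ(\mathrm{id}_A\otimes\beta_m): A\to m\otimes_{\Bbbk}m^*,$$ for $(m,\rho_m:A\otimes m\to m)\in A\text{-mod}$. (2) The coend of $\widetilde G$ is $$\int^{m\in A\text{-mod}}G(m)\otimes_{\Bbbk} m^* = G(A^* ),$$ with dinatural family $i^{A^*}_m:=G(\widetilde\rho_m):G(m)\otimes_{\Bbbk}m^*\to G(A^* )$, where $$\widetilde\rho_m:=\big(\mathrm{id}_{A^*}\otimes_{\Bbbk}[\delta_m\circ(\rho_m\otimes_{\Bbbk}\mathrm{id}_{m^*})]\big)\circ(\beta_{A^*}\otimes_{\Bbbk}\mathrm{id}_m\otimes_{\Bbbk}\mathrm{id}_{m^*}): m\otimes_{\Bbbk}m^*\to A^*.$$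
   Context: $\Bbbk$ is an algebraically closed field; all modules and bimodules are finite-dimensional. $A\text{-mod}$ is the category of finite-dimensional left $A$-modules and $B\text{-bimod-}A$ that of finite-dimensional $B$-$A$-bimodules. $n^*$ is the dual vector space of $n$, a right $A$-module via the dual of the left action on $n$. $\beta_m:\Bbbk\to m\otimes_{\Bbbk}m^*$ and $\delta_m: m\otimes_{\Bbbk}m^*\to\Bbbk$ are the coevaluation and evaluation of finite-dimensional vector spaces (and $\beta_{A^*}:\Bbbk\to A^*\otimes_{\Bbbk}A$, using $A^{**}=A$). The object $m\otimes_{\Bbbk}m^*$ is regarded as a left $A$-module via the action on the left tensor factor, and by linearity of $G$ one identifies $G(m\otimes_{\Bbbk}m^* )\cong G(m)\otimes_{\Bbbk}m^*$. $A$ carries the regular bimodule structure and $A^*$ the co-regular bimodule structure (dual of the regular actions). If $X$ is an $A$-bimodule (such as $A$ or $A^*$), the $B$-$A$-bimodule structure on $G(X)$ has as right action of $\alpha\in A$ the morphism $G(r_\alpha)$, where $r_\alpha: X\to X$ is the right action of $\alpha$ (a morphism of left $A$-modules). *)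

theory Defs
  imports
    "HOL-Algebra.Algebraic_Closure"
    "HOL-Library.Equipollence"
    "Jordan_Normal_Form.Missing_VectorSpace"
begin

hide_const (open) Multiset.mult

section \<open>Categories, functors, ends and coends\<close>

text \<open>
  Morphisms carry no source and target of their own, so hom-sets, composition and the morphism
  part of a functor take the objects as arguments: \<open>ccomp C x y z g f\<close> is the composite
  \<open>g \<circ> f\<close> of \<open>f : x \<rightarrow> y\<close> and \<open>g : y \<rightarrow> z\<close>.
\<close>

record ('o, 'm) cat =
  Ob :: "'o set"
  Hom :: "'o \<Rightarrow> 'o \<Rightarrow> 'm set"
  ident :: "'o \<Rightarrow> 'm"
  ccomp :: "'o \<Rightarrow> 'o \<Rightarrow> 'o \<Rightarrow> 'm \<Rightarrow> 'm \<Rightarrow> 'm"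

definition is_category :: "('o, 'm) cat \<Rightarrow> bool" where
  "is_category C \<longleftrightarrow>
     (\<forall>x\<in>Ob C. ident C x \<in> Hom C x x) \<and>
     (\<forall>x\<in>Ob C. \<forall>y\<in>Ob C. \<forall>z\<in>Ob C. \<forall>f\<in>Hom C x y. \<forall>g\<in>Hom C y z. ccomp C x y z g f \<in> Hom C x z) \<and>
     (\<forall>x\<in>Ob C. \<forall>y\<in>Ob C. \<forall>f\<in>Hom C x y.
        ccomp C x x y f (ident C x) = f \<and> ccomp C x y y (ident C y) f = f) \<and>
     (\<forall>w\<in>Ob C. \<forall>x\<in>Ob C. \<forall>y\<in>Ob C. \<forall>z\<in>Ob C.
        \<forall>f\<in>Hom C w x. \<forall>g\<in>Hom C x y. \<forall>h\<in>Hom C y z.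
        ccomp C w x z (ccomp C x y z h g) f = ccomp C w y z h (ccomp C w x y g f))"

definition opp_cat :: "('o, 'm) cat \<Rightarrow> ('o, 'm) cat" where
  "opp_cat C = \<lparr>Ob = Ob C, Hom = (\<lambda>x y. Hom C y x), ident = ident C,
     ccomp = (\<lambda>x y z g f. ccomp C z y x f g)\<rparr>"

definition prod_cat :: "('o, 'm) cat \<Rightarrow> ('p, 'n) cat \<Rightarrow> ('o \<times> 'p, 'm \<times> 'n) cat" where
  "prod_cat C D = \<lparr>Ob = Ob C \<times> Ob D,
     Hom = (\<lambda>x y. Hom C (fst x) (fst y) \<times> Hom D (snd x) (snd y)),
     ident = (\<lambda>x. (ident C (fst x), ident D (snd x))),
     ccomp = (\<lambda>x y z g f. (ccomp C (fst x) (fst y) (fst z) (fst g) (fst f),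
                           ccomp D (snd x) (snd y) (snd z) (snd g) (snd f)))\<rparr>"

record ('o, 'm, 'p, 'n) fctr =
  fob :: "'o \<Rightarrow> 'p"
  farr :: "'o \<Rightarrow> 'o \<Rightarrow> 'm \<Rightarrow> 'n"

definition is_functor :: "('o, 'm) cat \<Rightarrow> ('p, 'n) cat \<Rightarrow> ('o, 'm, 'p, 'n) fctr \<Rightarrow> bool" where
  "is_functor C D F \<longleftrightarrow> is_category C \<and> is_category D \<and>
     (\<forall>x\<in>Ob C. fob F x \<in> Ob D) \<and>
     (\<forall>x\<in>Ob C. \<forall>y\<in>Ob C. \<forall>f\<in>Hom C x y. farr F x y f \<in> Hom D (fob F x) (fob F y)) \<and>
     (\<forall>x\<in>Ob C. farr F x x (ident C x) = ident D (fob F x)) \<and>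
     (\<forall>x\<in>Ob C. \<forall>y\<in>Ob C. \<forall>z\<in>Ob C. \<forall>f\<in>Hom C x y. \<forall>g\<in>Hom C y z.
        farr F x z (ccomp C x y z g f) =
          ccomp D (fob F x) (fob F y) (fob F z) (farr F y z g) (farr F x y f))"

text \<open>
  In the next four definitions \<open>F\<close> is a functor from \<open>C \<times> C\<^sup>o\<^sup>p\<close> to \<open>D\<close>, that is, the
  second argument is the contravariant one. A morphism \<open>f : c \<rightarrow> d\<close> of \<open>C\<close> is at the same
  time a morphism from \<open>d\<close> to \<open>c\<close> of the opposite category.
\<close>

definition is_wedge ::
  "('o, 'm) cat \<Rightarrow> ('p, 'n) cat \<Rightarrow> ('o \<times> 'o, 'm \<times> 'm, 'p, 'n) fctr \<Rightarrow> 'p \<Rightarrow> ('o \<Rightarrow> 'n) \<Rightarrow> bool" where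
  "is_wedge C D F P i \<longleftrightarrow> P \<in> Ob D \<and>
     (\<forall>c\<in>Ob C. i c \<in> Hom D P (fob F (c, c))) \<and>
     (\<forall>c\<in>Ob C. \<forall>d\<in>Ob C. \<forall>f\<in>Hom C c d.
        ccomp D P (fob F (c, c)) (fob F (d, c)) (farr F (c, c) (d, c) (f, ident C c)) (i c) =
        ccomp D P (fob F (d, d)) (fob F (d, c)) (farr F (d, d) (d, c) (ident C d, f)) (i d))"

definition is_cowedge ::
  "('o, 'm) cat \<Rightarrow> ('p, 'n) cat \<Rightarrow> ('o \<times> 'o, 'm \<times> 'm, 'p, 'n) fctr \<Rightarrow> 'p \<Rightarrow> ('o \<Rightarrow> 'n) \<Rightarrow> bool" where
  "is_cowedge C D F P i \<longleftrightarrow> P \<in> Ob D \<and>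
     (\<forall>c\<in>Ob C. i c \<in> Hom D (fob F (c, c)) P) \<and>
     (\<forall>c\<in>Ob C. \<forall>d\<in>Ob C. \<forall>f\<in>Hom C c d.
        ccomp D (fob F (c, d)) (fob F (c, c)) P (i c) (farr F (c, d) (c, c) (ident C c, f)) =
        ccomp D (fob F (c, d)) (fob F (d, d)) P (i d) (farr F (c, d) (d, d) (f, ident C d)))"

definition is_end ::
  "('o, 'm) cat \<Rightarrow> ('p, 'n) cat \<Rightarrow> ('o \<times> 'o, 'm \<times> 'm, 'p, 'n) fctr \<Rightarrow> 'p \<Rightarrow> ('o \<Rightarrow> 'n) \<Rightarrow> bool" where
  "is_end C D F E i \<longleftrightarrow> is_functor (prod_cat C (opp_cat C)) D F \<and> is_wedge C D F E i \<and>
     (\<forall>P j. is_wedge C D F P j \<longrightarrow>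
        (\<exists>!h. h \<in> Hom D P E \<and> (\<forall>c\<in>Ob C. ccomp D P E (fob F (c, c)) (i c) h = j c)))"

definition is_coend ::
  "('o, 'm) cat \<Rightarrow> ('p, 'n) cat \<Rightarrow> ('o \<times> 'o, 'm \<times> 'm, 'p, 'n) fctr \<Rightarrow> 'p \<Rightarrow> ('o \<Rightarrow> 'n) \<Rightarrow> bool" where
  "is_coend C D F E i \<longleftrightarrow> is_functor (prod_cat C (opp_cat C)) D F \<and> is_cowedge C D F E i \<and>
     (\<forall>P j. is_cowedge C D F P j \<longrightarrow>
        (\<exists>!h. h \<in> Hom D E P \<and> (\<forall>c\<in>Ob C. ccomp D (fob F (c, c)) E P h (i c) = j c)))"


section \<open>Vector spaces\<close>

text \<open>
  Vector spaces are records of type \<open>module\<close>; their \<open>mult\<close> and \<open>one\<close> components play no role.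
  Linear maps are taken to be extensional, so that equality of morphisms is equality of functions.
\<close>

definition fd_space :: "'k ring \<Rightarrow> ('k, 'v, 'z) module_scheme \<Rightarrow> bool" where
  "fd_space K V \<longleftrightarrow> vectorspace K V \<and> vectorspace.fin_dim K V"

definition lin ::
  "'k ring \<Rightarrow> ('k, 'v, 'y) module_scheme \<Rightarrow> ('k, 'w, 'z) module_scheme \<Rightarrow> ('v \<Rightarrow> 'w) set" where
  "lin K V W = module_hom K V W \<inter> extensional (carrier V)"

definition hom_space ::
  "'k ring \<Rightarrow> ('k, 'v, 'y) module_scheme \<Rightarrow> ('k, 'w, 'z) module_scheme \<Rightarrow> ('k, 'v \<Rightarrow> 'w) module" where
  "hom_space K V W = \<lparr>carrier = lin K V W, mult = undefined, one = undefined,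
     zero = (\<lambda>x\<in>carrier V. \<zero>\<^bsub>W\<^esub>),
     add = (\<lambda>f g. \<lambda>x\<in>carrier V. f x \<oplus>\<^bsub>W\<^esub> g x),
     smult = (\<lambda>c f. \<lambda>x\<in>carrier V. c \<odot>\<^bsub>W\<^esub> f x)\<rparr>"

definition base_space :: "'k ring \<Rightarrow> ('k, 'k) module" where
  "base_space K = \<lparr>carrier = carrier K, mult = undefined, one = undefined,
     zero = \<zero>\<^bsub>K\<^esub>, add = add K, smult = mult K\<rparr>"

definition dual :: "'k ring \<Rightarrow> ('k, 'v, 'z) module_scheme \<Rightarrow> ('k, 'v \<Rightarrow> 'k) module" where
  "dual K V = hom_space K V (base_space K)"

definition dual_map :: "('k, 'v, 'z) module_scheme \<Rightarrow> ('v \<Rightarrow> 'w) \<Rightarrow> ('w \<Rightarrow> 'k) \<Rightarrow> 'v \<Rightarrow> 'k" where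
  "dual_map V h \<phi> = (\<lambda>x\<in>carrier V. \<phi> (h x))"

definition idmap :: "('k, 'v, 'z) module_scheme \<Rightarrow> 'v \<Rightarrow> 'v" where
  "idmap V = (\<lambda>x\<in>carrier V. x)"

subsection \<open>Tensor products\<close>

text \<open>
  The tensor product is the quotient of the free vector space on \<open>carrier V \<times> carrier W\<close> (the
  finitely supported functions) by the subspace spanned by the bilinearity relations.
\<close>

definition free_space ::
  "'k ring \<Rightarrow> ('k, 'v, 'y) module_scheme \<Rightarrow> ('k, 'w, 'z) module_scheme \<Rightarrow> ('k, 'v \<times> 'w \<Rightarrow> 'k) module" where
  "free_space K V W = (ring.func_space K (carrier V \<times> carrier W))
     \<lparr>carrier := {\<phi> \<in> carrier V \<times> carrier W \<rightarrow>\<^sub>E carrier K.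
                   finite {p \<in> carrier V \<times> carrier W. \<phi> p \<noteq> \<zero>\<^bsub>K\<^esub>}}\<rparr>"

definition gen ::
  "'k ring \<Rightarrow> ('k, 'v, 'y) module_scheme \<Rightarrow> ('k, 'w, 'z) module_scheme \<Rightarrow> 'v \<Rightarrow> 'w \<Rightarrow> 'v \<times> 'w \<Rightarrow> 'k" where
  "gen K V W v w = (\<lambda>p\<in>carrier V \<times> carrier W. if p = (v, w) then \<one>\<^bsub>K\<^esub> else \<zero>\<^bsub>K\<^esub>)"

definition tensor_rel ::
  "'k ring \<Rightarrow> ('k, 'v, 'y) module_scheme \<Rightarrow> ('k, 'w, 'z) module_scheme \<Rightarrow> ('v \<times> 'w \<Rightarrow> 'k) set" where
  "tensor_rel K V W = (let F = free_space K V W; \<delta> = gen K V W in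
     LinearCombinations.module.span K F
       ({\<delta> (v \<oplus>\<^bsub>V\<^esub> v') w \<ominus>\<^bsub>F\<^esub> (\<delta> v w \<oplus>\<^bsub>F\<^esub> \<delta> v' w) | v v' w.
            v \<in> carrier V \<and> v' \<in> carrier V \<and> w \<in> carrier W} \<union>
        {\<delta> v (w \<oplus>\<^bsub>W\<^esub> w') \<ominus>\<^bsub>F\<^esub> (\<delta> v w \<oplus>\<^bsub>F\<^esub> \<delta> v w') | v w w'.
            v \<in> carrier V \<and> w \<in> carrier W \<and> w' \<in> carrier W} \<union>
        {\<delta> (c \<odot>\<^bsub>V\<^esub> v) w \<ominus>\<^bsub>F\<^esub> (c \<odot>\<^bsub>F\<^esub> \<delta> v w) | c v w.
            c \<in> carrier K \<and> v \<in> carrier V \<and> w \<in> carrier W} \<union>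
        {\<delta> v (c \<odot>\<^bsub>W\<^esub> w) \<ominus>\<^bsub>F\<^esub> (c \<odot>\<^bsub>F\<^esub> \<delta> v w) | c v w.
            c \<in> carrier K \<and> v \<in> carrier V \<and> w \<in> carrier W}))"

definition tensor ::
  "'k ring \<Rightarrow> ('k, 'v, 'y) module_scheme \<Rightarrow> ('k, 'w, 'z) module_scheme \<Rightarrow>
   ('k, ('v \<times> 'w \<Rightarrow> 'k) set) module" where
  "tensor K V W = (let F = free_space K V W; N = tensor_rel K V W in
     \<lparr>carrier = a_rcosets\<^bsub>F\<^esub> N, mult = undefined, one = undefined, zero = N,
      add = set_add F, smult = (\<lambda>c S. \<Union>\<phi>\<in>S. N +>\<^bsub>F\<^esub> (c \<odot>\<^bsub>F\<^esub> \<phi>))\<rparr>)"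

definition tens ::
  "'k ring \<Rightarrow> ('k, 'v, 'y) module_scheme \<Rightarrow> ('k, 'w, 'z) module_scheme \<Rightarrow>
   'v \<Rightarrow> 'w \<Rightarrow> ('v \<times> 'w \<Rightarrow> 'k) set" where
  "tens K V W v w = tensor_rel K V W +>\<^bsub>free_space K V W\<^esub> gen K V W v w"

text \<open>The linear map \<open>V \<otimes> W \<rightarrow> Z\<close> induced by a bilinear map \<open>\<beta>\<close>.\<close>

definition tlift ::
  "'k ring \<Rightarrow> ('k, 'v, 'x) module_scheme \<Rightarrow> ('k, 'w, 'y) module_scheme \<Rightarrow> ('k, 't, 'z) module_scheme \<Rightarrow>
   ('v \<Rightarrow> 'w \<Rightarrow> 't) \<Rightarrow> ('v \<times> 'w \<Rightarrow> 'k) set \<Rightarrow> 't" where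
  "tlift K V W Z \<beta> = (THE h. h \<in> lin K (tensor K V W) Z \<and>
     (\<forall>v\<in>carrier V. \<forall>w\<in>carrier W. h (tens K V W v w) = \<beta> v w))"

definition tmap ::
  "'k ring \<Rightarrow> ('k, 'v, 'x) module_scheme \<Rightarrow> ('k, 'w, 'y) module_scheme \<Rightarrow>
   ('k, 'v', 'x') module_scheme \<Rightarrow> ('k, 'w', 'y') module_scheme \<Rightarrow>
   ('v \<Rightarrow> 'v') \<Rightarrow> ('w \<Rightarrow> 'w') \<Rightarrow> ('v \<times> 'w \<Rightarrow> 'k) set \<Rightarrow> ('v' \<times> 'w' \<Rightarrow> 'k) set" where
  "tmap K V W V' W' f g = tlift K V W (tensor K V' W') (\<lambda>v w. tens K V' W' (f v) (g w))"

text \<open>The coherence isomorphisms \<open>(U \<otimes> V) \<otimes> W \<cong> U \<otimes> (V \<otimes> W)\<close> and \<open>V \<otimes> K \<cong> V\<close>.\<close>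

definition assoc ::
  "'k ring \<Rightarrow> ('k, 'u, 'x) module_scheme \<Rightarrow> ('k, 'v, 'y) module_scheme \<Rightarrow> ('k, 'w, 'z) module_scheme \<Rightarrow>
   (('u \<times> 'v \<Rightarrow> 'k) set \<times> 'w \<Rightarrow> 'k) set \<Rightarrow> ('u \<times> ('v \<times> 'w \<Rightarrow> 'k) set \<Rightarrow> 'k) set" where
  "assoc K U V W = (let T = tensor K U (tensor K V W) in
     tlift K (tensor K U V) W T
       (\<lambda>p w. tlift K U V T (\<lambda>u v. tens K U (tensor K V W) u (tens K V W v w)) p))"

definition assoc_inv ::
  "'k ring \<Rightarrow> ('k, 'u, 'x) module_scheme \<Rightarrow> ('k, 'v, 'y) module_scheme \<Rightarrow> ('k, 'w, 'z) module_scheme \<Rightarrow>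
   ('u \<times> ('v \<times> 'w \<Rightarrow> 'k) set \<Rightarrow> 'k) set \<Rightarrow> (('u \<times> 'v \<Rightarrow> 'k) set \<times> 'w \<Rightarrow> 'k) set" where
  "assoc_inv K U V W = (let T = tensor K (tensor K U V) W in
     tlift K U (tensor K V W) T
       (\<lambda>u. tlift K V W T (\<lambda>v w. tens K (tensor K U V) W (tens K U V u v) w)))"

definition runit ::
  "'k ring \<Rightarrow> ('k, 'v, 'z) module_scheme \<Rightarrow> ('v \<times> 'k \<Rightarrow> 'k) set \<Rightarrow> 'v" where
  "runit K V = tlift K V (base_space K) V (\<lambda>v c. c \<odot>\<^bsub>V\<^esub> v)"

subsection \<open>Evaluation and coevaluation\<close>

definition ev :: "'k ring \<Rightarrow> ('k, 'v, 'z) module_scheme \<Rightarrow> ('v \<times> ('v \<Rightarrow> 'k) \<Rightarrow> 'k) set \<Rightarrow> 'k" where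
  "ev K V = tlift K V (dual K V) (base_space K) (\<lambda>v \<phi>. \<phi> v)"

definition coord :: "'k ring \<Rightarrow> ('k, 'v, 'z) module_scheme \<Rightarrow> 'v set \<Rightarrow> 'v \<Rightarrow> 'v \<Rightarrow> 'k" where
  "coord K V S b = (THE \<phi>. \<phi> \<in> carrier (dual K V) \<and>
     (\<forall>b'\<in>S. \<phi> b' = (if b' = b then \<one>\<^bsub>K\<^esub> else \<zero>\<^bsub>K\<^esub>)))"

text \<open>
  A linear map out of \<open>K\<close> is given by the image of \<open>1\<close>: \<open>coev K V\<close> is the element
  \<open>\<beta>\<^sub>V(1) = \<Sum>\<^sub>b b \<otimes> b\<^sup>*\<close> of \<open>V \<otimes> V\<^sup>*\<close>, which does not depend on the chosen basis. Likewise
  \<open>coev_dual K V\<close> is the image of \<open>1\<close> under the coevaluation of \<open>V\<^sup>*\<close>, moved from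
  \<open>V\<^sup>* \<otimes> V\<^sup>*\<^sup>*\<close> to \<open>V\<^sup>* \<otimes> V\<close> by means of the canonical isomorphism \<open>V \<cong> V\<^sup>*\<^sup>*\<close>.
\<close>

definition coev :: "'k ring \<Rightarrow> ('k, 'v, 'z) module_scheme \<Rightarrow> ('v \<times> ('v \<Rightarrow> 'k) \<Rightarrow> 'k) set" where
  "coev K V = (let S = (SOME S. vectorspace.basis K V S) in
     finsum (tensor K V (dual K V)) (\<lambda>b. tens K V (dual K V) b (coord K V S b)) S)"

definition bidual_map :: "'k ring \<Rightarrow> ('k, 'v, 'z) module_scheme \<Rightarrow> 'v \<Rightarrow> ('v \<Rightarrow> 'k) \<Rightarrow> 'k" where
  "bidual_map K V = (\<lambda>v\<in>carrier V. \<lambda>\<phi>\<in>carrier (dual K V). \<phi> v)"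

definition coev_dual :: "'k ring \<Rightarrow> ('k, 'v, 'z) module_scheme \<Rightarrow> (('v \<Rightarrow> 'k) \<times> 'v \<Rightarrow> 'k) set" where
  "coev_dual K V =
     tmap K (dual K V) (dual K (dual K V)) (dual K V) V
       (idmap (dual K V)) (inv_into (carrier V) (bidual_map K V)) (coev K (dual K V))"


section \<open>Algebras, modules and bimodules\<close>

text \<open>
  The locale \<open>algebra\<close> of HOL-Algebra is restricted to commutative algebras, hence the following.
  The zero algebra is allowed.
\<close>

definition fd_algebra :: "'k ring \<Rightarrow> ('k, 'a) module \<Rightarrow> bool" where
  "fd_algebra K A \<longleftrightarrow> fd_space K A \<and> ring A \<and>
     (\<forall>c\<in>carrier K. \<forall>x\<in>carrier A. \<forall>y\<in>carrier A.
        (c \<odot>\<^bsub>A\<^esub> x) \<otimes>\<^bsub>A\<^esub> y = c \<odot>\<^bsub>A\<^esub> (x \<otimes>\<^bsub>A\<^esub> y) \<and>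
        x \<otimes>\<^bsub>A\<^esub> (c \<odot>\<^bsub>A\<^esub> y) = c \<odot>\<^bsub>A\<^esub> (x \<otimes>\<^bsub>A\<^esub> y))"

text \<open>For a left action, \<open>l a x\<close> is \<open>a x\<close>; for a right action, \<open>r a x\<close> is \<open>x a\<close>.\<close>

definition left_action ::
  "'k ring \<Rightarrow> ('k, 'a) module \<Rightarrow> ('k, 'v, 'z) module_scheme \<Rightarrow> ('a \<Rightarrow> 'v \<Rightarrow> 'v) \<Rightarrow> bool" where
  "left_action K A V l \<longleftrightarrow>
     (\<forall>a\<in>carrier A. l a \<in> module_hom K V V) \<and>
     (\<forall>x\<in>carrier V. l \<one>\<^bsub>A\<^esub> x = x) \<and>
     (\<forall>a\<in>carrier A. \<forall>x\<in>carrier V. \<forall>c\<in>carrier K. l (c \<odot>\<^bsub>A\<^esub> a) x = c \<odot>\<^bsub>V\<^esub> l a x) \<and>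
     (\<forall>a\<in>carrier A. \<forall>a'\<in>carrier A. \<forall>x\<in>carrier V.
        l (a \<oplus>\<^bsub>A\<^esub> a') x = l a x \<oplus>\<^bsub>V\<^esub> l a' x \<and>
        l (a \<otimes>\<^bsub>A\<^esub> a') x = l a (l a' x))"

definition right_action ::
  "'k ring \<Rightarrow> ('k, 'a) module \<Rightarrow> ('k, 'v, 'z) module_scheme \<Rightarrow> ('a \<Rightarrow> 'v \<Rightarrow> 'v) \<Rightarrow> bool" where
  "right_action K A V r \<longleftrightarrow>
     (\<forall>a\<in>carrier A. r a \<in> module_hom K V V) \<and>
     (\<forall>x\<in>carrier V. r \<one>\<^bsub>A\<^esub> x = x) \<and>
     (\<forall>a\<in>carrier A. \<forall>x\<in>carrier V. \<forall>c\<in>carrier K. r (c \<odot>\<^bsub>A\<^esub> a) x = c \<odot>\<^bsub>V\<^esub> r a x) \<and>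
     (\<forall>a\<in>carrier A. \<forall>a'\<in>carrier A. \<forall>x\<in>carrier V.
        r (a \<oplus>\<^bsub>A\<^esub> a') x = r a x \<oplus>\<^bsub>V\<^esub> r a' x \<and>
        r (a \<otimes>\<^bsub>A\<^esub> a') x = r a' (r a x))"

record ('k, 'u, 'b) lmod = "('k, 'u) module" +
  lact :: "'b \<Rightarrow> 'u \<Rightarrow> 'u"

record ('k, 'u, 'b, 'a) bimod = "('k, 'u, 'b) lmod" +
  ract :: "'a \<Rightarrow> 'u \<Rightarrow> 'u"

definition left_module :: "'k ring \<Rightarrow> ('k, 'b) module \<Rightarrow> ('k, 'u, 'b, 'z) lmod_scheme \<Rightarrow> bool" where
  "left_module K B M \<longleftrightarrow> fd_space K M \<and> left_action K B M (lact M)"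

definition bimodule ::
  "'k ring \<Rightarrow> ('k, 'b) module \<Rightarrow> ('k, 'a) module \<Rightarrow> ('k, 'u, 'b, 'a) bimod \<Rightarrow> bool" where
  "bimodule K B A P \<longleftrightarrow> left_module K B P \<and> right_action K A P (ract P) \<and>
     (\<forall>b\<in>carrier B. \<forall>a\<in>carrier A. \<forall>x\<in>carrier P.
        lact P b (ract P a x) = ract P a (lact P b x))"

definition lmod_hom ::
  "'k ring \<Rightarrow> ('k, 'b) module \<Rightarrow> ('k, 'u, 'b, 'y) lmod_scheme \<Rightarrow> ('k, 'v, 'b, 'z) lmod_scheme \<Rightarrow>
   ('u \<Rightarrow> 'v) set" where
  "lmod_hom K B M N = {f \<in> lin K M N.
     \<forall>b\<in>carrier B. \<forall>x\<in>carrier M. f (lact M b x) = lact N b (f x)}"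

definition bimod_hom ::
  "'k ring \<Rightarrow> ('k, 'b) module \<Rightarrow> ('k, 'a) module \<Rightarrow> ('k, 'u, 'b, 'a) bimod \<Rightarrow> ('k, 'v, 'b, 'a) bimod \<Rightarrow>
   ('u \<Rightarrow> 'v) set" where
  "bimod_hom K B A P Q = {f \<in> lmod_hom K B P Q.
     \<forall>a\<in>carrier A. \<forall>x\<in>carrier P. f (ract P a x) = ract Q a (f x)}"

text \<open>
  The categories of finite-dimensional modules and bimodules whose underlying sets are subsets of
  the type \<open>'u\<close>, which serves as the universe.
\<close>

definition lmod_cat ::
  "'k ring \<Rightarrow> ('k, 'b) module \<Rightarrow> (('k, 'u, 'b) lmod, 'u \<Rightarrow> 'u) cat" where
  "lmod_cat K B = \<lparr>Ob = {M. left_module K B M}, Hom = lmod_hom K B, ident = idmap,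
     ccomp = (\<lambda>L M N g f. compose (carrier L) g f)\<rparr>"

definition bimod_cat ::
  "'k ring \<Rightarrow> ('k, 'b) module \<Rightarrow> ('k, 'a) module \<Rightarrow> (('k, 'u, 'b, 'a) bimod, 'u \<Rightarrow> 'u) cat" where
  "bimod_cat K B A = \<lparr>Ob = {P. bimodule K B A P}, Hom = bimod_hom K B A, ident = idmap,
     ccomp = (\<lambda>P Q R g f. compose (carrier P) g f)\<rparr>"

definition linear_functor ::
  "'k ring \<Rightarrow> ('k, 'a) module \<Rightarrow> ('k, 'b) module \<Rightarrow>
   (('k, 'u, 'a) lmod, 'u \<Rightarrow> 'u, ('k, 'u, 'b) lmod, 'u \<Rightarrow> 'u) fctr \<Rightarrow> bool" where
  "linear_functor K A B G \<longleftrightarrow> is_functor (lmod_cat K A) (lmod_cat K B) G \<and>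
     (\<forall>M N. left_module K A M \<longrightarrow> left_module K A N \<longrightarrow>
       (\<forall>f\<in>lmod_hom K A M N. \<forall>g\<in>lmod_hom K A M N.
          farr G M N (f \<oplus>\<^bsub>hom_space K M N\<^esub> g) =
            farr G M N f \<oplus>\<^bsub>hom_space K (fob G M) (fob G N)\<^esub> farr G M N g) \<and>
       (\<forall>c\<in>carrier K. \<forall>f\<in>lmod_hom K A M N.
          farr G M N (c \<odot>\<^bsub>hom_space K M N\<^esub> f) =
            c \<odot>\<^bsub>hom_space K (fob G M) (fob G N)\<^esub> farr G M N f))"

subsection \<open>Copies in the universe\<close>

text \<open>
  The constructions \<open>A\<close>, \<open>A\<^sup>*\<close> and \<open>V \<otimes> W\<close> live on types other than \<open>'u\<close>. They become objects of
  the categories above by transport of structure along an arbitrarily chosen injection \<open>enc S\<close>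
  of the underlying set \<open>S\<close> into \<open>'u\<close>, which exists as soon as \<open>'u\<close> is at least as large as the
  (infinite) ground field. \<open>tr S T h\<close> is the map \<open>h : S \<rightarrow> T\<close> read on the copies.
\<close>

definition enc :: "'v set \<Rightarrow> 'v \<Rightarrow> 'u" where
  "enc S = (SOME f. inj_on f S)"

definition dec :: "'v set \<Rightarrow> 'u \<Rightarrow> 'v" where
  "dec S = inv_into S (enc S)"

definition tr :: "'v set \<Rightarrow> 'w set \<Rightarrow> ('v \<Rightarrow> 'w) \<Rightarrow> 'u \<Rightarrow> 'u" where
  "tr S T h = (\<lambda>x\<in>enc S ` S. enc T (h (dec S x)))"

definition copy_lmod ::
  "('k, 'v, 'z) module_scheme \<Rightarrow> ('b \<Rightarrow> 'v \<Rightarrow> 'v) \<Rightarrow> ('k, 'u, 'b) lmod" where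
  "copy_lmod V l = (let S = carrier V in
     \<lparr>carrier = enc S ` S, mult = undefined, one = undefined, zero = enc S \<zero>\<^bsub>V\<^esub>,
      add = (\<lambda>x y. enc S (dec S x \<oplus>\<^bsub>V\<^esub> dec S y)),
      smult = (\<lambda>c x. enc S (c \<odot>\<^bsub>V\<^esub> dec S x)),
      lact = (\<lambda>b. tr S S (l b))\<rparr>)"

definition add_ract :: "('k, 'u, 'b) lmod \<Rightarrow> ('a \<Rightarrow> 'u \<Rightarrow> 'u) \<Rightarrow> ('k, 'u, 'b, 'a) bimod" where
  "add_ract M r = lmod.extend M (bimod.fields r)"

definition copy_bimod ::
  "('k, 'v, 'z) module_scheme \<Rightarrow> ('b \<Rightarrow> 'v \<Rightarrow> 'v) \<Rightarrow> ('a \<Rightarrow> 'v \<Rightarrow> 'v) \<Rightarrow> ('k, 'u, 'b, 'a) bimod" where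
  "copy_bimod V l r = add_ract (copy_lmod V l) (\<lambda>a. tr (carrier V) (carrier V) (r a))"

subsection \<open>Regular, coregular and tensor modules\<close>

definition reg_lact :: "('k, 'a) module \<Rightarrow> 'a \<Rightarrow> 'a \<Rightarrow> 'a" where
  "reg_lact A a x = a \<otimes>\<^bsub>A\<^esub> x"

definition reg_ract :: "('k, 'a) module \<Rightarrow> 'a \<Rightarrow> 'a \<Rightarrow> 'a" where
  "reg_ract A a x = x \<otimes>\<^bsub>A\<^esub> a"

definition coreg_lact :: "('k, 'a) module \<Rightarrow> 'a \<Rightarrow> ('a \<Rightarrow> 'k) \<Rightarrow> 'a \<Rightarrow> 'k" where
  "coreg_lact A a = dual_map A (reg_ract A a)"

definition coreg_ract :: "('k, 'a) module \<Rightarrow> 'a \<Rightarrow> ('a \<Rightarrow> 'k) \<Rightarrow> 'a \<Rightarrow> 'k" where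
  "coreg_ract A a = dual_map A (reg_lact A a)"

definition reg_mod :: "('k, 'a) module \<Rightarrow> ('k, 'u, 'a) lmod" where
  "reg_mod A = copy_lmod A (reg_lact A)"

definition coreg_mod :: "'k ring \<Rightarrow> ('k, 'a) module \<Rightarrow> ('k, 'u, 'a) lmod" where
  "coreg_mod K A = copy_lmod (dual K A) (coreg_lact A)"

text \<open>\<open>M \<otimes> V\<close> with the action on the left tensor factor.\<close>

definition tensor_mod ::
  "'k ring \<Rightarrow> ('k, 'u, 'a) lmod \<Rightarrow> ('k, 'v, 'z) module_scheme \<Rightarrow> ('k, 'u, 'a) lmod" where
  "tensor_mod K M V = copy_lmod (tensor K M V) (\<lambda>a. tmap K M V M V (lact M a) (idmap V))"

section \<open>The functor \<open>(m, n) \<mapsto> G(m) \<otimes> n\<^sup>*\<close>\<close>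

type_synonym ('k, 'u, 'a, 'b) mod_fctr =
  "(('k, 'u, 'a) lmod, 'u \<Rightarrow> 'u, ('k, 'u, 'b) lmod, 'u \<Rightarrow> 'u) fctr"

abbreviation Gt_space ::
  "'k ring \<Rightarrow> ('k, 'u, 'a, 'b) mod_fctr \<Rightarrow> ('k, 'u, 'a) lmod \<Rightarrow> ('k, 'u, 'a) lmod \<Rightarrow>
   ('k, ('u \<times> ('u \<Rightarrow> 'k) \<Rightarrow> 'k) set) module" where
  "Gt_space K G m n \<equiv> tensor K (fob G m) (dual K n)"

definition Gtilde ::
  "'k ring \<Rightarrow> ('k, 'u, 'a, 'b) mod_fctr \<Rightarrow>
   (('k, 'u, 'a) lmod \<times> ('k, 'u, 'a) lmod, ('u \<Rightarrow> 'u) \<times> ('u \<Rightarrow> 'u),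
    ('k, 'u, 'b, 'a) bimod, 'u \<Rightarrow> 'u) fctr" where
  "Gtilde K G = \<lparr>
     fob = (\<lambda>(m, n). copy_bimod (Gt_space K G m n)
       (\<lambda>b. tmap K (fob G m) (dual K n) (fob G m) (dual K n) (lact (fob G m) b) (idmap (dual K n)))
       (\<lambda>a. tmap K (fob G m) (dual K n) (fob G m) (dual K n) (idmap (fob G m)) (dual_map n (lact n a)))),
     farr = (\<lambda>(m, n) (m', n') (f, g).
       tr (carrier (Gt_space K G m n)) (carrier (Gt_space K G m' n'))
         (tmap K (fob G m) (dual K n) (fob G m') (dual K n') (farr G m m' f) (dual_map n' g)))\<rparr>"

text \<open>
  \<open>G_bimod G V l r\<close> is \<open>G(P)\<close> for the left module \<open>P\<close> given by \<open>V\<close> and the left action \<open>l\<close>, with the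
  right action of \<open>a\<close> being \<open>G(r a)\<close>.
\<close>

definition G_bimod ::
  "('k, 'u, 'a, 'b) mod_fctr \<Rightarrow> ('k, 'v, 'z) module_scheme \<Rightarrow>
   ('a \<Rightarrow> 'v \<Rightarrow> 'v) \<Rightarrow> ('a \<Rightarrow> 'v \<Rightarrow> 'v) \<Rightarrow> ('k, 'u, 'b, 'a) bimod" where
  "G_bimod G V l r = (let P = copy_lmod V l in
     add_ract (fob G P) (\<lambda>a. farr G P P (tr (carrier V) (carrier V) (r a))))"

definition G_reg :: "('k, 'a) module \<Rightarrow> ('k, 'u, 'a, 'b) mod_fctr \<Rightarrow> ('k, 'u, 'b, 'a) bimod" where
  "G_reg A G = G_bimod G A (reg_lact A) (reg_ract A)"

definition G_coreg ::
  "'k ring \<Rightarrow> ('k, 'a) module \<Rightarrow> ('k, 'u, 'a, 'b) mod_fctr \<Rightarrow> ('k, 'u, 'b, 'a) bimod" where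
  "G_coreg K A G = G_bimod G (dual K A) (coreg_lact A) (coreg_ract A)"

text \<open>
  The identification \<open>G(m) \<otimes> m\<^sup>* \<cong> G(m \<otimes> m\<^sup>*)\<close>: it maps \<open>y \<otimes> \<phi>\<close> to the image of \<open>y\<close> under
  \<open>G\<close> applied to the module morphism \<open>m \<rightarrow> m \<otimes> m\<^sup>*\<close>, \<open>x \<mapsto> x \<otimes> \<phi>\<close>.
\<close>

definition G_tensor ::
  "'k ring \<Rightarrow> ('k, 'u, 'a, 'b) mod_fctr \<Rightarrow> ('k, 'u, 'a) lmod \<Rightarrow> ('u \<times> ('u \<Rightarrow> 'k) \<Rightarrow> 'k) set \<Rightarrow> 'u" where
  "G_tensor K G m = (let P = tensor_mod K m (dual K m) in
     tlift K (fob G m) (dual K m) (fob G P)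
       (\<lambda>y \<phi>. farr G m P
          (\<lambda>x\<in>carrier m. enc (carrier (tensor K m (dual K m))) (tens K m (dual K m) x \<phi>)) y))"

section \<open>The dinatural families\<close>

definition rho :: "'k ring \<Rightarrow> ('k, 'a) module \<Rightarrow> ('k, 'u, 'a) lmod \<Rightarrow> ('a \<times> 'u \<Rightarrow> 'k) set \<Rightarrow> 'u" where
  "rho K A m = tlift K A m m (lact m)"

definition rho_id ::
  "'k ring \<Rightarrow> ('k, 'a) module \<Rightarrow> ('k, 'u, 'a) lmod \<Rightarrow>
   ('a \<times> ('u \<times> ('u \<Rightarrow> 'k) \<Rightarrow> 'k) set \<Rightarrow> 'k) set \<Rightarrow> ('u \<times> ('u \<Rightarrow> 'k) \<Rightarrow> 'k) set" where
  "rho_id K A m p = tmap K (tensor K A m) (dual K m) m (dual K m) (rho K A m) (idmap (dual K m))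
     (assoc_inv K A m (dual K m) p)"

definition rho_hat ::
  "'k ring \<Rightarrow> ('k, 'a) module \<Rightarrow> ('k, 'u, 'a) lmod \<Rightarrow> 'a \<Rightarrow> ('u \<times> ('u \<Rightarrow> 'k) \<Rightarrow> 'k) set" where
  "rho_hat K A m a = rho_id K A m (tens K A (tensor K m (dual K m)) a (coev K m))"

definition rho_tilde ::
  "'k ring \<Rightarrow> ('k, 'a) module \<Rightarrow> ('k, 'u, 'a) lmod \<Rightarrow> ('u \<times> ('u \<Rightarrow> 'k) \<Rightarrow> 'k) set \<Rightarrow> 'a \<Rightarrow> 'k" where
  "rho_tilde K A m t = (let D = dual K A; W = tensor K m (dual K m) in
     runit K D
       (tmap K D (tensor K A W) D (base_space K) (idmap D) (\<lambda>p. ev K m (rho_id K A m p))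
         (assoc K D A W (tens K (tensor K D A) W (coev_dual K A) t))))"

definition end_family ::
  "'k ring \<Rightarrow> ('k, 'a) module \<Rightarrow> ('k, 'u, 'a, 'b) mod_fctr \<Rightarrow> ('k, 'u, 'a) lmod \<Rightarrow> 'u \<Rightarrow> 'u" where
  "end_family K A G m = (\<lambda>y\<in>carrier (fob G (reg_mod A)).
     enc (carrier (Gt_space K G m m))
       (inv_into (carrier (Gt_space K G m m)) (G_tensor K G m)
         (farr G (reg_mod A) (tensor_mod K m (dual K m))
           (tr (carrier A) (carrier (tensor K m (dual K m))) (rho_hat K A m)) y)))"

definition coend_family ::
  "'k ring \<Rightarrow> ('k, 'a) module \<Rightarrow> ('k, 'u, 'a, 'b) mod_fctr \<Rightarrow> ('k, 'u, 'a) lmod \<Rightarrow> 'u \<Rightarrow> 'u" where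
  "coend_family K A G m = (\<lambda>y\<in>carrier (fob (Gtilde K G) (m, m)).
     farr G (tensor_mod K m (dual K m)) (coreg_mod K A)
       (tr (carrier (tensor K m (dual K m))) (carrier (dual K A)) (rho_tilde K A m))
       (G_tensor K G m (dec (carrier (Gt_space K G m m)) y)))"

end

theory Submission
  imports Defs
begin

text \<open>
  A tensor in \<open>V \<otimes> W\<^sup>*\<close> with \<open>W\<close> finite-dimensional is determined by its evaluations at the points
  of \<open>W\<close>, which turns statements about \<open>G(m) \<otimes> m\<^sup>*\<close> into statements about \<open>G(m)\<close>.
  For \<open>x \<in> m\<close> let \<open>f\<^sub>x : A \<rightarrow> m\<close> be \<open>a \<mapsto> a x\<close> (called \<open>orb\<close> below). Evaluating the right factor at
  \<open>x\<close> takes \<open>i\<^sup>A\<^sub>m(y)\<close> to \<open>G(f\<^sub>x)(y)\<close>. As \<open>f\<^sub>1\<close> is the identity of \<open>A\<close>, a wedge \<open>j\<close> with vertex \<open>P\<close> can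
  only factor through the \<open>h : P \<rightarrow> G(A)\<close> that sends \<open>p\<close> to the evaluation of \<open>j\<^sub>A(p)\<close> at \<open>1\<close>, and
  dinaturality of \<open>j\<close> along \<open>f\<^sub>x\<close> says that \<open>i\<^sup>A\<^sub>m(h(p))\<close> and \<open>j\<^sub>m(p)\<close> have the same evaluation at \<open>x\<close>.

  Dually, for \<open>\<phi> \<in> m\<^sup>*\<close> let \<open>g\<^sub>\<phi> : m \<rightarrow> A\<^sup>*\<close> be \<open>x \<mapsto> (a \<mapsto> \<phi>(a x))\<close> (called \<open>cg\<close>). The coend family sends
  \<open>y \<otimes> \<phi>\<close> to \<open>G(g\<^sub>\<phi>)(y)\<close>, and for \<open>\<epsilon> : A\<^sup>* \<rightarrow> K\<close> the evaluation at \<open>1\<close> one has \<open>\<epsilon> \<circ> g\<^sub>\<phi> = \<phi>\<close> and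
  \<open>g\<^sub>\<epsilon> = id\<close>. So a cowedge \<open>j\<close> factors exactly through \<open>y \<mapsto> j\<^bsub>A*\<^esub>(y \<otimes> \<epsilon>)\<close>.
\<close>

section \<open>Linear algebra\<close>

text \<open>They are replaced by closed forms: \<open>rho_hat\<close> is itself an orbit map, that
  of m \<otimes> m* at the coevaluation, and \<open>rho_tilde\<close> sends x \<otimes> \<phi> to
  the functional a \<mapsto> \<phi>(a x). As G need not be exact, only composites and linear
  combinations of module maps are pushed through it. Additivity of G(f_x) in x places the values of
  G(\<open>rho_hat\<close>) in the range of the identification, so that its inverse is meaningful
  there, and G applied to evaluation at x undoes the identification up to evaluation. The two halves
  use dual tests: maps into G(m) \<otimes> n* are compared by evaluating at points of n, maps out of
  it on pure tensors. Right linearity of the factorizing map is a further use of dinaturality: along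
  right multiplication on A for the end, and along right translation on A* together with
  \<epsilon>(a s) = \<epsilon>(s a) for the coend.\<close>

locale ground_field = K: field K for K :: "'k ring"
begin

lemma field_K: "field K"
  by (rule K.field_axioms)

section \<open>Arithmetic in vector spaces\<close>

lemma vs_module: "vectorspace K V \<Longrightarrow> module K V"
  by (simp add: vectorspace_def)

lemma vs_abelian_group: "vectorspace K V \<Longrightarrow> abelian_group V"
  by (simp add: vectorspace_def module_def)

lemma vs_abelian_monoid: "vectorspace K V \<Longrightarrow> abelian_monoid V"
  by (simp add: vs_abelian_group abelian_group.axioms)

lemma fd_space_vs [simp]: "fd_space K V \<Longrightarrow> vectorspace K V"
  by (simp add: fd_space_def)

lemma vs_closed [simp]:
  assumes "vectorspace K V"
  shows "\<zero>\<^bsub>V\<^esub> \<in> carrier V"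
    and "x \<in> carrier V \<Longrightarrow> y \<in> carrier V \<Longrightarrow> x \<oplus>\<^bsub>V\<^esub> y \<in> carrier V"
    and "c \<in> carrier K \<Longrightarrow> x \<in> carrier V \<Longrightarrow> c \<odot>\<^bsub>V\<^esub> x \<in> carrier V"
    and "x \<in> carrier V \<Longrightarrow> \<ominus>\<^bsub>V\<^esub> x \<in> carrier V"
    and "x \<in> carrier V \<Longrightarrow> y \<in> carrier V \<Longrightarrow> x \<ominus>\<^bsub>V\<^esub> y \<in> carrier V"
  using abelian_monoid.zero_closed[OF vs_abelian_monoid[OF assms]]
    abelian_monoid.a_closed[OF vs_abelian_monoid[OF assms]]
    module.smult_closed[OF vs_module[OF assms]]
    abelian_group.a_inv_closed[OF vs_abelian_group[OF assms]]
    abelian_group.minus_closed[OF vs_abelian_group[OF assms]]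
  by auto

lemma vs_simps [simp]:
  assumes "vectorspace K V" "x \<in> carrier V"
  shows "\<zero>\<^bsub>V\<^esub> \<oplus>\<^bsub>V\<^esub> x = x" "x \<oplus>\<^bsub>V\<^esub> \<zero>\<^bsub>V\<^esub> = x" "\<one>\<^bsub>K\<^esub> \<odot>\<^bsub>V\<^esub> x = x" "\<zero>\<^bsub>K\<^esub> \<odot>\<^bsub>V\<^esub> x = \<zero>\<^bsub>V\<^esub>"
    "x \<ominus>\<^bsub>V\<^esub> x = \<zero>\<^bsub>V\<^esub>"
proof -
  interpret module K V by (rule vs_module[OF assms(1)])
  show "\<zero>\<^bsub>V\<^esub> \<oplus>\<^bsub>V\<^esub> x = x" "x \<oplus>\<^bsub>V\<^esub> \<zero>\<^bsub>V\<^esub> = x" "\<one>\<^bsub>K\<^esub> \<odot>\<^bsub>V\<^esub> x = x" "\<zero>\<^bsub>K\<^esub> \<odot>\<^bsub>V\<^esub> x = \<zero>\<^bsub>V\<^esub>"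
    "x \<ominus>\<^bsub>V\<^esub> x = \<zero>\<^bsub>V\<^esub>"
    using assms by (simp_all add: M.minus_eq M.r_neg)
qed

lemma vs_smult_zero [simp]: "vectorspace K V \<Longrightarrow> c \<in> carrier K \<Longrightarrow> c \<odot>\<^bsub>V\<^esub> \<zero>\<^bsub>V\<^esub> = \<zero>\<^bsub>V\<^esub>"
  by (rule module.smult_r_null[OF vs_module])

lemma vs_add_comm:
  "vectorspace K V \<Longrightarrow> x \<in> carrier V \<Longrightarrow> y \<in> carrier V \<Longrightarrow> x \<oplus>\<^bsub>V\<^esub> y = y \<oplus>\<^bsub>V\<^esub> x"
  by (rule abelian_monoid.a_comm[OF vs_abelian_monoid])

lemma vs_add_assoc:
  "vectorspace K V \<Longrightarrow> x \<in> carrier V \<Longrightarrow> y \<in> carrier V \<Longrightarrow> z \<in> carrier V \<Longrightarrow>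
    (x \<oplus>\<^bsub>V\<^esub> y) \<oplus>\<^bsub>V\<^esub> z = x \<oplus>\<^bsub>V\<^esub> (y \<oplus>\<^bsub>V\<^esub> z)"
  by (rule abelian_monoid.a_assoc[OF vs_abelian_monoid])

lemma vs_add_lcomm:
  "vectorspace K V \<Longrightarrow> x \<in> carrier V \<Longrightarrow> y \<in> carrier V \<Longrightarrow> z \<in> carrier V \<Longrightarrow>
    x \<oplus>\<^bsub>V\<^esub> (y \<oplus>\<^bsub>V\<^esub> z) = y \<oplus>\<^bsub>V\<^esub> (x \<oplus>\<^bsub>V\<^esub> z)"
  by (rule abelian_monoid.a_lcomm[OF vs_abelian_monoid])

lemmas vs_add_ac = vs_add_comm vs_add_assoc vs_add_lcomm

lemma vs_neg: "vectorspace K V \<Longrightarrow> x \<in> carrier V \<Longrightarrow> x \<oplus>\<^bsub>V\<^esub> (\<ominus>\<^bsub>V\<^esub> x) = \<zero>\<^bsub>V\<^esub>"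
  by (rule abelian_group.r_neg[OF vs_abelian_group])

lemma vs_smult_assoc:
  "vectorspace K V \<Longrightarrow> c \<in> carrier K \<Longrightarrow> d \<in> carrier K \<Longrightarrow> x \<in> carrier V \<Longrightarrow>
    (c \<otimes>\<^bsub>K\<^esub> d) \<odot>\<^bsub>V\<^esub> x = c \<odot>\<^bsub>V\<^esub> (d \<odot>\<^bsub>V\<^esub> x)"
  by (rule module.smult_assoc1[OF vs_module])

lemma vs_smult_lcomm:
  "vectorspace K V \<Longrightarrow> c \<in> carrier K \<Longrightarrow> d \<in> carrier K \<Longrightarrow> x \<in> carrier V \<Longrightarrow>
    c \<odot>\<^bsub>V\<^esub> (d \<odot>\<^bsub>V\<^esub> x) = d \<odot>\<^bsub>V\<^esub> (c \<odot>\<^bsub>V\<^esub> x)"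
  using vs_smult_assoc K.m_comm by metis

lemma vs_smult_add:
  "vectorspace K V \<Longrightarrow> c \<in> carrier K \<Longrightarrow> d \<in> carrier K \<Longrightarrow> x \<in> carrier V \<Longrightarrow>
    (c \<oplus>\<^bsub>K\<^esub> d) \<odot>\<^bsub>V\<^esub> x = c \<odot>\<^bsub>V\<^esub> x \<oplus>\<^bsub>V\<^esub> d \<odot>\<^bsub>V\<^esub> x"
  by (rule module.smult_l_distr[OF vs_module])

lemma vs_add_smult:
  "vectorspace K V \<Longrightarrow> c \<in> carrier K \<Longrightarrow> x \<in> carrier V \<Longrightarrow> y \<in> carrier V \<Longrightarrow>
    c \<odot>\<^bsub>V\<^esub> (x \<oplus>\<^bsub>V\<^esub> y) = c \<odot>\<^bsub>V\<^esub> x \<oplus>\<^bsub>V\<^esub> c \<odot>\<^bsub>V\<^esub> y"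
  by (rule module.smult_r_distr[OF vs_module])

lemmas vs_distrib = vs_smult_add vs_add_smult

lemma vsI:
  assumes "\<zero>\<^bsub>V\<^esub> \<in> carrier V"
    and "\<And>x y. x \<in> carrier V \<Longrightarrow> y \<in> carrier V \<Longrightarrow> x \<oplus>\<^bsub>V\<^esub> y \<in> carrier V"
    and "\<And>x. x \<in> carrier V \<Longrightarrow> \<exists>y\<in>carrier V. x \<oplus>\<^bsub>V\<^esub> y = \<zero>\<^bsub>V\<^esub>"
    and "\<And>c x. c \<in> carrier K \<Longrightarrow> x \<in> carrier V \<Longrightarrow> c \<odot>\<^bsub>V\<^esub> x \<in> carrier V"
    and "\<And>x y. x \<in> carrier V \<Longrightarrow> y \<in> carrier V \<Longrightarrow> x \<oplus>\<^bsub>V\<^esub> y = y \<oplus>\<^bsub>V\<^esub> x"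
    and "\<And>x y z. x \<in> carrier V \<Longrightarrow> y \<in> carrier V \<Longrightarrow> z \<in> carrier V \<Longrightarrow>
      (x \<oplus>\<^bsub>V\<^esub> y) \<oplus>\<^bsub>V\<^esub> z = x \<oplus>\<^bsub>V\<^esub> (y \<oplus>\<^bsub>V\<^esub> z)"
    and "\<And>x. x \<in> carrier V \<Longrightarrow> x \<oplus>\<^bsub>V\<^esub> \<zero>\<^bsub>V\<^esub> = x"
    and "\<And>c d x. c \<in> carrier K \<Longrightarrow> d \<in> carrier K \<Longrightarrow> x \<in> carrier V \<Longrightarrow>
      (c \<otimes>\<^bsub>K\<^esub> d) \<odot>\<^bsub>V\<^esub> x = c \<odot>\<^bsub>V\<^esub> (d \<odot>\<^bsub>V\<^esub> x)"
    and "\<And>x. x \<in> carrier V \<Longrightarrow> \<one>\<^bsub>K\<^esub> \<odot>\<^bsub>V\<^esub> x = x"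
    and "\<And>c d x. c \<in> carrier K \<Longrightarrow> d \<in> carrier K \<Longrightarrow> x \<in> carrier V \<Longrightarrow>
      (c \<oplus>\<^bsub>K\<^esub> d) \<odot>\<^bsub>V\<^esub> x = c \<odot>\<^bsub>V\<^esub> x \<oplus>\<^bsub>V\<^esub> d \<odot>\<^bsub>V\<^esub> x"
    and "\<And>c x y. c \<in> carrier K \<Longrightarrow> x \<in> carrier V \<Longrightarrow> y \<in> carrier V \<Longrightarrow>
      c \<odot>\<^bsub>V\<^esub> (x \<oplus>\<^bsub>V\<^esub> y) = c \<odot>\<^bsub>V\<^esub> x \<oplus>\<^bsub>V\<^esub> c \<odot>\<^bsub>V\<^esub> y"
  shows "vectorspace K V"
proof (rule vs_criteria)
  show "field K" by (rule field_K)
qed (use assms in auto)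

section \<open>Linear maps, plain and extensional\<close>

lemma module_homI:
  assumes "\<And>x. x \<in> carrier V \<Longrightarrow> f x \<in> carrier W"
    and "\<And>x y. x \<in> carrier V \<Longrightarrow> y \<in> carrier V \<Longrightarrow> f (x \<oplus>\<^bsub>V\<^esub> y) = f x \<oplus>\<^bsub>W\<^esub> f y"
    and "\<And>c x. c \<in> carrier K \<Longrightarrow> x \<in> carrier V \<Longrightarrow> f (c \<odot>\<^bsub>V\<^esub> x) = c \<odot>\<^bsub>W\<^esub> f x"
  shows "f \<in> module_hom K V W"
  using assms by (auto simp: module_hom_def)

lemma module_homD:
  assumes "f \<in> module_hom K V W"
  shows "x \<in> carrier V \<Longrightarrow> f x \<in> carrier W"
    and "x \<in> carrier V \<Longrightarrow> y \<in> carrier V \<Longrightarrow> f (x \<oplus>\<^bsub>V\<^esub> y) = f x \<oplus>\<^bsub>W\<^esub> f y"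
    and "c \<in> carrier K \<Longrightarrow> x \<in> carrier V \<Longrightarrow> f (c \<odot>\<^bsub>V\<^esub> x) = c \<odot>\<^bsub>W\<^esub> f x"
  using assms by (auto simp: module_hom_def)

lemma module_hom_zero:
  assumes "f \<in> module_hom K V W" "vectorspace K V" "vectorspace K W"
  shows "f \<zero>\<^bsub>V\<^esub> = \<zero>\<^bsub>W\<^esub>"
  using module_homD(3)[OF assms(1), of "\<zero>\<^bsub>K\<^esub>" "\<zero>\<^bsub>V\<^esub>"] module_homD(1)[OF assms(1), of "\<zero>\<^bsub>V\<^esub>"] assms
  by simp

lemma module_hom_cong:
  assumes "vectorspace K V" "f \<in> module_hom K V W" "\<And>x. x \<in> carrier V \<Longrightarrow> g x = f x"
  shows "g \<in> module_hom K V W"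
  using assms by (intro module_homI) (simp_all add: module_homD)

lemma module_hom_comp:
  "f \<in> module_hom K U V \<Longrightarrow> g \<in> module_hom K V W \<Longrightarrow> (\<lambda>x. g (f x)) \<in> module_hom K U W"
  by (auto simp: module_hom_def Pi_def)

lemma linI:
  "f \<in> module_hom K V W \<Longrightarrow> f \<in> extensional (carrier V) \<Longrightarrow> f \<in> lin K V W"
  by (simp add: lin_def)

lemma lin_restrict:
  assumes "vectorspace K V" "f \<in> module_hom K V W"
  shows "(\<lambda>x\<in>carrier V. f x) \<in> lin K V W"
  using module_hom_cong[OF assms, of "\<lambda>x\<in>carrier V. f x"] by (simp add: lin_def)

lemma linD:
  assumes "f \<in> lin K V W"
  shows "f \<in> module_hom K V W" "f \<in> extensional (carrier V)"
    and "x \<in> carrier V \<Longrightarrow> f x \<in> carrier W"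
    and "x \<in> carrier V \<Longrightarrow> y \<in> carrier V \<Longrightarrow> f (x \<oplus>\<^bsub>V\<^esub> y) = f x \<oplus>\<^bsub>W\<^esub> f y"
    and "c \<in> carrier K \<Longrightarrow> x \<in> carrier V \<Longrightarrow> f (c \<odot>\<^bsub>V\<^esub> x) = c \<odot>\<^bsub>W\<^esub> f x"
  using assms by (auto simp: lin_def module_hom_def)

lemma lin_eqI:
  assumes "f \<in> lin K V W" "g \<in> lin K V W" "\<And>x. x \<in> carrier V \<Longrightarrow> f x = g x"
  shows "f = g"
  using extensionalityI[OF linD(2)[OF assms(1)] linD(2)[OF assms(2)]] assms(3) by simp

lemma idmap_apply [simp]: "x \<in> carrier V \<Longrightarrow> idmap V x = x"
  by (simp add: idmap_def)

lemma idmap_hom: "vectorspace K V \<Longrightarrow> idmap V \<in> module_hom K V V"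
  by (rule module_homI) simp_all

lemma idmap_lin: "vectorspace K V \<Longrightarrow> idmap V \<in> lin K V V"
  by (rule linI[OF idmap_hom]) (auto simp: idmap_def)

subsection \<open>Finite sums and finite dimension\<close>

lemma finsum_closed:
  assumes "vectorspace K V" "\<And>i. i \<in> S \<Longrightarrow> g i \<in> carrier V"
  shows "finsum V g S \<in> carrier V"
  using abelian_monoid.finsum_closed[OF vs_abelian_monoid[OF assms(1)], of g S] assms(2) by auto

lemma finsum_insert:
  assumes "vectorspace K V" "finite S" "i \<notin> S" "g i \<in> carrier V" "\<And>j. j \<in> S \<Longrightarrow> g j \<in> carrier V"
  shows "finsum V g (insert i S) = g i \<oplus>\<^bsub>V\<^esub> finsum V g S"
  using abelian_monoid.finsum_insert[OF vs_abelian_monoid[OF assms(1)], of S i g] assms by auto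

lemma finsum_cong:
  assumes "vectorspace K V" "\<And>i. i \<in> S \<Longrightarrow> f i = g i" "\<And>i. i \<in> S \<Longrightarrow> g i \<in> carrier V"
  shows "finsum V f S = finsum V g S"
  using abelian_monoid.finsum_cong'[OF vs_abelian_monoid[OF assms(1)], of S S g f] assms by auto

lemma finsum_empty: "vectorspace K V \<Longrightarrow> finsum V f {} = \<zero>\<^bsub>V\<^esub>"
  by (rule abelian_monoid.finsum_empty[OF vs_abelian_monoid])

lemma finsum_mono_neutral:
  assumes "vectorspace K V" "finite T" "S \<subseteq> T" "\<And>i. i \<in> T - S \<Longrightarrow> g i = \<zero>\<^bsub>V\<^esub>"
    "\<And>i. i \<in> S \<Longrightarrow> g i \<in> carrier V"
  shows "finsum V g S = finsum V g T"
  using comm_monoid.finprod_mono_neutral_cong_left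
      [OF abelian_monoid.a_comm_monoid[OF vs_abelian_monoid[OF assms(1)]], of T S g g] assms
  by (fastforce simp: finsum_def)

lemma finsum_addf:
  assumes "vectorspace K V" "\<And>i. i \<in> S \<Longrightarrow> f i \<in> carrier V" "\<And>i. i \<in> S \<Longrightarrow> g i \<in> carrier V"
  shows "finsum V (\<lambda>i. f i \<oplus>\<^bsub>V\<^esub> g i) S = finsum V f S \<oplus>\<^bsub>V\<^esub> finsum V g S"
  using abelian_monoid.finsum_addf[OF vs_abelian_monoid[OF assms(1)], of f S g] assms by auto

lemma finsum_smult:
  assumes "vectorspace K V" "c \<in> carrier K" "\<And>i. i \<in> S \<Longrightarrow> g i \<in> carrier V"
  shows "finsum V (\<lambda>i. c \<odot>\<^bsub>V\<^esub> g i) S = c \<odot>\<^bsub>V\<^esub> finsum V g S"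
  using module.finsum_smult[OF vs_module[OF assms(1)], of c g S] assms by auto

lemma finsum_single:
  assumes "vectorspace K V" "finite S" "i \<in> S" "\<And>j. j \<in> S \<Longrightarrow> j \<noteq> i \<Longrightarrow> g j = \<zero>\<^bsub>V\<^esub>"
    "g i \<in> carrier V"
  shows "finsum V g S = g i"
proof -
  have "finsum V g S = finsum V g {i}"
    by (rule finsum_mono_neutral[symmetric]) (use assms in auto)
  also have "\<dots> = g i"
    using finsum_insert[of V "{}" i g] assms by (simp add: finsum_empty)
  finally show ?thesis .
qed

lemma module_hom_finsum:
  assumes "f \<in> module_hom K V W" "vectorspace K V" "vectorspace K W" "\<And>i. i \<in> S \<Longrightarrow> g i \<in> carrier V"
  shows "f (finsum V g S) = finsum W (\<lambda>i. f (g i)) S"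
  using assms(4)
proof (induction S rule: infinite_finite_induct)
  \<comment> \<open>Over an infinite index set \<open>finsum\<close> has the default value zero,
    which linear maps preserve.\<close>
  case (infinite S)
  then show ?case
    by (simp add: finsum_def finprod_def module_hom_zero[OF assms(1-3)])
next
  case empty
  then show ?case
    by (simp add: finsum_empty assms module_hom_zero[OF assms(1-3)])
next
  case (insert i S)
  then show ?case
    by (simp add: finsum_insert assms finsum_closed module_homD[OF assms(1)])
qed

lemma submodule_finsum:
  assumes "LinearCombinations.submodule K N V" "\<And>i. i \<in> S \<Longrightarrow> g i \<in> N"
  shows "finsum V g S \<in> N"
proof -
  interpret submodule: LinearCombinations.submodule K N V by (rule assms(1))
  have vs: "vectorspace K V"
    using submodule.module field_K by (simp add: vectorspace_def)
  have sub: "x \<in> N \<Longrightarrow> x \<in> carrier V" for x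
    using submodule.subset by auto
  from assms(2) show ?thesis
  proof (induction S rule: infinite_finite_induct)
    case (infinite S)
    then show ?case by (simp add: finsum_def finprod_def)
  qed (simp_all add: finsum_empty finsum_insert vs sub)
qed

lemma submoduleI:
  assumes "vectorspace K V" "N \<subseteq> carrier V" "\<zero>\<^bsub>V\<^esub> \<in> N"
    "\<And>x y. x \<in> N \<Longrightarrow> y \<in> N \<Longrightarrow> x \<oplus>\<^bsub>V\<^esub> y \<in> N"
    "\<And>c x. c \<in> carrier K \<Longrightarrow> x \<in> N \<Longrightarrow> c \<odot>\<^bsub>V\<^esub> x \<in> N"
  shows "LinearCombinations.submodule K N V"
  by (rule submodule.intro) (use assms vs_module in auto)

text \<open>Generation by \<open>S\<close> is phrased as "every submodule containing
  \<open>S\<close> is everything". To verify it one only uses closure properties of a submodule and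
  never writes down a linear combination; \<open>fd_spaceE\<close> hands out generators in the same
  form.\<close>

lemma fd_spaceI:
  assumes "vectorspace K V" "finite S" "S \<subseteq> carrier V"
    and "\<And>N. LinearCombinations.submodule K N V \<Longrightarrow> S \<subseteq> N \<Longrightarrow> carrier V \<subseteq> N"
  shows "fd_space K V"
proof -
  interpret vectorspace K V by (rule assms(1))
  have "carrier V \<subseteq> span S"
    by (rule assms(4)[OF span_is_submodule[OF assms(3)] in_own_span[OF assms(3)]])
  then have "fin_dim"
    unfolding fin_dim_def using assms(2,3) span_is_subset2[OF assms(3)] by blast
  then show ?thesis
    by (simp add: fd_space_def assms(1))
qed

lemma fd_spaceE:
  assumes "fd_space K V"
  obtains S where "finite S" "S \<subseteq> carrier V"
    "\<And>N. LinearCombinations.submodule K N V \<Longrightarrow> S \<subseteq> N \<Longrightarrow> carrier V \<subseteq> N"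
proof -
  interpret vectorspace K V using assms by simp
  from assms obtain S where S: "finite S" "S \<subseteq> carrier V" "span S = carrier V"
    unfolding fd_space_def fin_dim_def by blast
  show thesis
    by (rule that[OF S(1,2)]) (use S span_is_subset in blast)
qed

text \<open>Rank-nullity bounds the image of a finite-dimensional space. This is how finite
  dimension is carried over to copies of a space.\<close>

lemma fd_space_image:
  assumes "fd_space K V" "vectorspace K W" "f \<in> module_hom K V W" "f ` carrier V = carrier W"
  shows "fd_space K W"
proof -
  interpret linear_map K V W f
    using assms by (simp add: linear_map_def mod_hom_def mod_hom_axioms_def vs_module)
  show ?thesis
    using rank_nullity_main(2) assms by (simp add: fd_space_def)
qed

subsection \<open>Dual spaces\<close>

lemma base_space_simps [simp]:
  "carrier (base_space K) = carrier K" "\<zero>\<^bsub>base_space K\<^esub> = \<zero>\<^bsub>K\<^esub>"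
  "x \<oplus>\<^bsub>base_space K\<^esub> y = x \<oplus>\<^bsub>K\<^esub> y" "c \<odot>\<^bsub>base_space K\<^esub> x = c \<otimes>\<^bsub>K\<^esub> x"
  by (simp_all add: base_space_def)

lemma base_space_vs [simp]: "vectorspace K (base_space K)"
proof (rule vsI)
  fix x assume "x \<in> carrier (base_space K)"
  then show "\<exists>y\<in>carrier (base_space K). x \<oplus>\<^bsub>base_space K\<^esub> y = \<zero>\<^bsub>base_space K\<^esub>"
    using K.r_neg K.a_inv_closed by auto
qed (auto simp: K.a_ac K.m_assoc K.l_distr K.r_distr)

lemma hom_space_simps:
  "carrier (hom_space K V W) = lin K V W"
  "\<zero>\<^bsub>hom_space K V W\<^esub> = (\<lambda>x\<in>carrier V. \<zero>\<^bsub>W\<^esub>)"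
  "f \<oplus>\<^bsub>hom_space K V W\<^esub> g = (\<lambda>x\<in>carrier V. f x \<oplus>\<^bsub>W\<^esub> g x)"
  "c \<odot>\<^bsub>hom_space K V W\<^esub> f = (\<lambda>x\<in>carrier V. c \<odot>\<^bsub>W\<^esub> f x)"
  by (simp_all add: hom_space_def)

lemma hom_space_vs:
  assumes "vectorspace K V" "vectorspace K W"
  shows "vectorspace K (hom_space K V W)"
proof (rule vsI)
  note * [simp] = hom_space_simps assms
  have hom: "f \<in> lin K V W" if "f \<in> carrier (hom_space K V W)" for f
    using that by simp
  show "\<zero>\<^bsub>hom_space K V W\<^esub> \<in> carrier (hom_space K V W)"
    by (auto intro!: lin_restrict module_homI)
  show "f \<oplus>\<^bsub>hom_space K V W\<^esub> g \<in> carrier (hom_space K V W)"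
    if "f \<in> carrier (hom_space K V W)" "g \<in> carrier (hom_space K V W)" for f g
    using hom[OF that(1)] hom[OF that(2)]
    by (auto intro!: lin_restrict module_homI simp: linD vs_distrib vs_add_ac)
  show "\<exists>g\<in>carrier (hom_space K V W). f \<oplus>\<^bsub>hom_space K V W\<^esub> g = \<zero>\<^bsub>hom_space K V W\<^esub>"
    if "f \<in> carrier (hom_space K V W)" for f
  proof
    interpret W: module K W by (simp add: vs_module)
    note f = hom[OF that]
    show "f \<oplus>\<^bsub>hom_space K V W\<^esub> (\<lambda>x\<in>carrier V. \<ominus>\<^bsub>W\<^esub> f x) = \<zero>\<^bsub>hom_space K V W\<^esub>"
      by (auto intro!: restrict_ext simp: vs_neg linD[OF f])
    show "(\<lambda>x\<in>carrier V. \<ominus>\<^bsub>W\<^esub> f x) \<in> carrier (hom_space K V W)"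
      using W.M.minus_add
      by (auto intro!: lin_restrict module_homI simp: linD[OF f] W.smult_r_minus)
  qed
  show "c \<odot>\<^bsub>hom_space K V W\<^esub> f \<in> carrier (hom_space K V W)"
    if "c \<in> carrier K" "f \<in> carrier (hom_space K V W)" for c f
    using hom[OF that(2)] that(1)
    by (auto intro!: lin_restrict module_homI simp: linD vs_distrib vs_smult_lcomm[of W c])
  show "f \<oplus>\<^bsub>hom_space K V W\<^esub> \<zero>\<^bsub>hom_space K V W\<^esub> = f" if "f \<in> carrier (hom_space K V W)" for f
    using linD[OF hom[OF that]] by (auto simp: fun_eq_iff extensional_def)
  show "\<one>\<^bsub>K\<^esub> \<odot>\<^bsub>hom_space K V W\<^esub> f = f" if "f \<in> carrier (hom_space K V W)" for f
    using linD[OF hom[OF that]] by (auto simp: fun_eq_iff extensional_def)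
qed (auto simp: hom_space_simps linD assms vs_distrib vs_add_ac vs_smult_assoc intro!: restrict_ext)

lemma dual_simps [simp]:
  "carrier (dual K V) = lin K V (base_space K)"
  "\<zero>\<^bsub>dual K V\<^esub> = (\<lambda>x\<in>carrier V. \<zero>\<^bsub>K\<^esub>)"
  "x \<in> carrier V \<Longrightarrow> (f \<oplus>\<^bsub>dual K V\<^esub> g) x = f x \<oplus>\<^bsub>K\<^esub> g x"
  "x \<in> carrier V \<Longrightarrow> (c \<odot>\<^bsub>dual K V\<^esub> f) x = c \<otimes>\<^bsub>K\<^esub> f x"
  by (simp_all add: dual_def hom_space_simps)

lemma dual_vs [simp]: "vectorspace K V \<Longrightarrow> vectorspace K (dual K V)"
  by (simp add: dual_def hom_space_vs)

lemma dual_closed: "\<phi> \<in> lin K V (base_space K) \<Longrightarrow> x \<in> carrier V \<Longrightarrow> \<phi> x \<in> carrier K"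
  using linD(3) by fastforce

lemma dual_eval_hom:
  "vectorspace K V \<Longrightarrow> x \<in> carrier V \<Longrightarrow> (\<lambda>\<phi>. \<phi> x) \<in> module_hom K (dual K V) (base_space K)"
  by (rule module_homI) (auto intro: dual_closed)

lemma dual_map_closed [simp]:
  assumes "vectorspace K V" "h \<in> module_hom K V W" "\<phi> \<in> lin K W (base_space K)"
  shows "dual_map V h \<phi> \<in> lin K V (base_space K)"
  unfolding dual_map_def
  by (rule lin_restrict[OF assms(1) module_hom_comp[OF assms(2) linD(1)[OF assms(3)]]])

lemma dual_map_apply [simp]: "x \<in> carrier V \<Longrightarrow> dual_map V h \<phi> x = \<phi> (h x)"
  by (simp add: dual_map_def)

text \<open>Since \<open>dual_simps\<close> rewrites membership in a dual space to membership in
  \<open>lin\<close>, closure under the operations has to be available in that form.\<close>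

lemma dual_add_closed [simp]:
  "vectorspace K V \<Longrightarrow> \<phi> \<in> lin K V (base_space K) \<Longrightarrow> \<psi> \<in> lin K V (base_space K) \<Longrightarrow>
    \<phi> \<oplus>\<^bsub>dual K V\<^esub> \<psi> \<in> lin K V (base_space K)"
  using vs_closed(2)[OF dual_vs, of V \<phi> \<psi>] by simp

lemma dual_smult_closed [simp]:
  "vectorspace K V \<Longrightarrow> c \<in> carrier K \<Longrightarrow> \<phi> \<in> lin K V (base_space K) \<Longrightarrow>
    c \<odot>\<^bsub>dual K V\<^esub> \<phi> \<in> lin K V (base_space K)"
  using vs_closed(3)[OF dual_vs, of V c \<phi>] by simp

lemma dual_map_hom:
  assumes "vectorspace K V" "vectorspace K W" "h \<in> module_hom K V W"
  shows "dual_map V h \<in> module_hom K (dual K W) (dual K V)"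
proof (rule module_homI)
  note [simp] = assms module_homD(1)[OF assms(3)] dual_map_closed[OF assms(1,3)]
  show "dual_map V h (\<phi> \<oplus>\<^bsub>dual K W\<^esub> \<psi>) = dual_map V h \<phi> \<oplus>\<^bsub>dual K V\<^esub> dual_map V h \<psi>"
    if "\<phi> \<in> carrier (dual K W)" "\<psi> \<in> carrier (dual K W)" for \<phi> \<psi>
    by (rule lin_eqI[of _ V "base_space K"]) (use that in simp_all)
  show "dual_map V h (c \<odot>\<^bsub>dual K W\<^esub> \<phi>) = c \<odot>\<^bsub>dual K V\<^esub> dual_map V h \<phi>"
    if "c \<in> carrier K" "\<phi> \<in> carrier (dual K W)" for c \<phi>
    by (rule lin_eqI[of _ V "base_space K"]) (use that in simp_all)
qed (use dual_map_closed[OF assms(1,3)] in simp)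

subsection \<open>Dual bases\<close>

text \<open>Literally the choice made inside \<open>coev\<close>, so that \<open>coev\<close>
  unfolds to a sum over this basis.\<close>

definition some_basis :: "('k, 'v, 'z) module_scheme \<Rightarrow> 'v set" where
  "some_basis V = (SOME S. vectorspace.basis K V S)"

lemma some_basis:
  assumes "fd_space K V"
  shows "vectorspace.basis K V (some_basis V)" "finite (some_basis V)" "some_basis V \<subseteq> carrier V"
proof -
  interpret vectorspace K V using assms by simp
  have fin: fin_dim
    using assms by (simp add: fd_space_def)
  then show b: "basis (some_basis V)"
    unfolding some_basis_def using finite_basis_exists someI_ex by metis
  then show "some_basis V \<subseteq> carrier V"
    by (simp add: basis_def)
  show "finite (some_basis V)"
    using b fin fin_dim_li_fin by (auto simp: basis_def)
qed

text \<open>The dual basis vector of \<open>b\<close>, read off from the unique expansion of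
  \<open>v\<close>. Existence is immediate in this form, whereas for \<open>coord\<close>, a
  description among functionals, it has to be shown; \<open>coord_eq\<close> identifies the
  two.\<close>

definition bcoord :: "('k, 'v, 'z) module_scheme \<Rightarrow> 'v \<Rightarrow> 'v \<Rightarrow> 'k" where
  "bcoord V b = (\<lambda>v\<in>carrier V.
     (THE a. a \<in> some_basis V \<rightarrow>\<^sub>E carrier K \<and> finsum V (\<lambda>b. a b \<odot>\<^bsub>V\<^esub> b) (some_basis V) = v) b)"

lemma bcoord_expand:
  assumes "fd_space K V" "v \<in> carrier V"
  shows "finsum V (\<lambda>b. bcoord V b v \<odot>\<^bsub>V\<^esub> b) (some_basis V) = v"
    and "b \<in> some_basis V \<Longrightarrow> bcoord V b v \<in> carrier K"
    and "a \<in> some_basis V \<rightarrow> carrier K \<Longrightarrow>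
      finsum V (\<lambda>b. a b \<odot>\<^bsub>V\<^esub> b) (some_basis V) = v \<Longrightarrow> b \<in> some_basis V \<Longrightarrow> bcoord V b v = a b"
proof -
  let ?S = "some_basis V"
  let ?P = "\<lambda>a. a \<in> ?S \<rightarrow>\<^sub>E carrier K \<and> finsum V (\<lambda>b. a b \<odot>\<^bsub>V\<^esub> b) ?S = v"
  interpret vectorspace K V using assms by simp
  note b = some_basis[OF assms(1)]
  have ex1: "\<exists>!a. ?P a"
    using b assms(2) by (simp add: basis_criterion lincomb_def)
  from theI'[OF ex1] have *: "?P (THE a. ?P a)" .
  with assms(2) show "finsum V (\<lambda>b. bcoord V b v \<odot>\<^bsub>V\<^esub> b) ?S = v"
    by (simp add: bcoord_def)
  from * assms(2) show "b \<in> ?S \<Longrightarrow> bcoord V b v \<in> carrier K"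
    by (auto simp: bcoord_def)
  assume a: "a \<in> ?S \<rightarrow> carrier K" "finsum V (\<lambda>b. a b \<odot>\<^bsub>V\<^esub> b) ?S = v" and bS: "b \<in> ?S"
  \<comment> \<open>Coefficient functions are unique only among the extensional ones, hence the
    restriction to the basis.\<close>
  have "finsum V (\<lambda>b. restrict a ?S b \<odot>\<^bsub>V\<^esub> b) ?S = finsum V (\<lambda>b. a b \<odot>\<^bsub>V\<^esub> b) ?S"
    by (rule finsum_cong) (use a b in \<open>auto simp: Pi_iff subset_eq\<close>)
  then have "?P (restrict a ?S)"
    using a by auto
  then have "(THE a. ?P a) = restrict a ?S"
    using ex1 by (rule the1_equality[rotated])
  then show "bcoord V b v = a b"
    using assms(2) bS by (simp add: bcoord_def)
qed

lemma bcoord_basis: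
  assumes "fd_space K V" "b \<in> some_basis V" "b' \<in> some_basis V"
  shows "bcoord V b b' = (if b' = b then \<one>\<^bsub>K\<^esub> else \<zero>\<^bsub>K\<^esub>)"
proof -
  note b = some_basis[OF assms(1)]
  have "finsum V (\<lambda>c. (if b' = c then \<one>\<^bsub>K\<^esub> else \<zero>\<^bsub>K\<^esub>) \<odot>\<^bsub>V\<^esub> c) (some_basis V) = b'"
    using assms b by (subst finsum_single[of _ _ b']) auto
  then show ?thesis
    using bcoord_expand(3)[OF assms(1), of b' "\<lambda>c. if b' = c then \<one>\<^bsub>K\<^esub> else \<zero>\<^bsub>K\<^esub>" b] assms b by auto
qed

text \<open>Adding or scaling coefficients yields an expansion of the sum or multiple, and
  expansions are unique.\<close>

lemma bcoord_lin [simp]: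
  assumes "fd_space K V" "b \<in> some_basis V"
  shows "bcoord V b \<in> lin K V (base_space K)"
proof (rule linI[OF module_homI])
  note [simp] = assms bcoord_expand(1,2)[OF assms(1)] set_mp[OF some_basis(3)[OF assms(1)]]
  show "bcoord V b (x \<oplus>\<^bsub>V\<^esub> y) = bcoord V b x \<oplus>\<^bsub>base_space K\<^esub> bcoord V b y"
    if "x \<in> carrier V" "y \<in> carrier V" for x y
  proof -
    have "finsum V (\<lambda>b. (bcoord V b x \<oplus>\<^bsub>K\<^esub> bcoord V b y) \<odot>\<^bsub>V\<^esub> b) (some_basis V) =
        finsum V (\<lambda>b. bcoord V b x \<odot>\<^bsub>V\<^esub> b \<oplus>\<^bsub>V\<^esub> bcoord V b y \<odot>\<^bsub>V\<^esub> b) (some_basis V)"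
      by (rule finsum_cong) (use that in \<open>auto simp: vs_distrib\<close>)
    also have "\<dots> = x \<oplus>\<^bsub>V\<^esub> y"
      by (subst finsum_addf) (use that in auto)
    finally show ?thesis
      using that
      by (auto intro!: bcoord_expand(3)[OF assms(1), of _ "\<lambda>b. bcoord V b x \<oplus>\<^bsub>K\<^esub> bcoord V b y"])
  qed
  show "bcoord V b (c \<odot>\<^bsub>V\<^esub> x) = c \<odot>\<^bsub>base_space K\<^esub> bcoord V b x"
    if "c \<in> carrier K" "x \<in> carrier V" for c x
  proof -
    have "finsum V (\<lambda>b. (c \<otimes>\<^bsub>K\<^esub> bcoord V b x) \<odot>\<^bsub>V\<^esub> b) (some_basis V) =
        finsum V (\<lambda>b. c \<odot>\<^bsub>V\<^esub> (bcoord V b x \<odot>\<^bsub>V\<^esub> b)) (some_basis V)"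
      by (rule finsum_cong) (use that in \<open>auto simp: vs_smult_assoc\<close>)
    also have "\<dots> = c \<odot>\<^bsub>V\<^esub> x"
      by (subst finsum_smult) (use that in auto)
    finally show ?thesis
      using that
      by (auto intro!: bcoord_expand(3)[OF assms(1), of _ "\<lambda>b. c \<otimes>\<^bsub>K\<^esub> bcoord V b x"])
  qed
qed (simp_all add: bcoord_expand(2) assms, simp add: bcoord_def)

lemma bcoord_closed [simp]:
  "fd_space K V \<Longrightarrow> b \<in> some_basis V \<Longrightarrow> v \<in> carrier V \<Longrightarrow> bcoord V b v \<in> carrier K"
  by (rule bcoord_expand(2))

lemma finsum_base_space: "finsum (base_space K) f S = finsum K f S"
  by (simp add: finsum_def finprod_def base_space_def)

lemma dual_expand_apply:
  assumes "fd_space K V" "\<phi> \<in> lin K V (base_space K)" "v \<in> carrier V"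
  shows "finsum K (\<lambda>b. bcoord V b v \<otimes>\<^bsub>K\<^esub> \<phi> b) (some_basis V) = \<phi> v"
proof -
  note [simp] = assms dual_closed[OF assms(2)] set_mp[OF some_basis(3)[OF assms(1)]]
  have "\<phi> v = \<phi> (finsum V (\<lambda>b. bcoord V b v \<odot>\<^bsub>V\<^esub> b) (some_basis V))"
    by (simp add: bcoord_expand(1))
  also have "\<dots> = finsum (base_space K) (\<lambda>b. \<phi> (bcoord V b v \<odot>\<^bsub>V\<^esub> b)) (some_basis V)"
    by (rule module_hom_finsum[OF linD(1)[OF assms(2)]]) simp_all
  also have "\<dots> = finsum (base_space K) (\<lambda>b. bcoord V b v \<otimes>\<^bsub>K\<^esub> \<phi> b) (some_basis V)"
    by (rule finsum_cong) (simp_all add: linD(5)[OF assms(2)])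
  finally show ?thesis
    by (simp add: finsum_base_space)
qed

text \<open>A functional is determined by its values on a basis, so the description in
  \<open>coord\<close> has exactly one solution.\<close>

lemma coord_eq:
  assumes "fd_space K V" "b \<in> some_basis V"
  shows "coord K V (some_basis V) b = bcoord V b"
  unfolding coord_def
proof (rule the_equality)
  note [simp] = assms set_mp[OF some_basis(3)[OF assms(1)]]
  show "bcoord V b \<in> carrier (dual K V) \<and>
      (\<forall>b'\<in>some_basis V. bcoord V b b' = (if b' = b then \<one>\<^bsub>K\<^esub> else \<zero>\<^bsub>K\<^esub>))"
    by (simp add: bcoord_basis)
  fix \<phi> assume \<phi>: "\<phi> \<in> carrier (dual K V) \<and>
      (\<forall>b'\<in>some_basis V. \<phi> b' = (if b' = b then \<one>\<^bsub>K\<^esub> else \<zero>\<^bsub>K\<^esub>))"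
  show "\<phi> = bcoord V b"
  proof (rule lin_eqI[of _ V "base_space K"])
    fix v assume v: "v \<in> carrier V"
    have "finsum (base_space K) (\<lambda>c. bcoord V c v \<otimes>\<^bsub>K\<^esub> \<phi> c) (some_basis V) =
        finsum (base_space K) (\<lambda>c. bcoord V c v \<otimes>\<^bsub>K\<^esub> bcoord V b c) (some_basis V)"
      by (rule finsum_cong) (use v \<phi> in \<open>auto simp: bcoord_basis bcoord_expand(2)\<close>)
    then show "\<phi> v = bcoord V b v"
      using dual_expand_apply[OF assms(1) _ v] \<phi> by (simp add: finsum_base_space)
  qed (use \<phi> assms in auto)
qed

text \<open>Evaluation at a point is linear on the dual, so the sum is evaluated term by term and
  \<open>dual_expand_apply\<close> finishes.\<close>

lemma dual_expand:
  assumes "fd_space K V" "\<phi> \<in> lin K V (base_space K)"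
  shows "finsum (dual K V) (\<lambda>b. \<phi> b \<odot>\<^bsub>dual K V\<^esub> bcoord V b) (some_basis V) = \<phi>" (is "?s = _")
proof (rule lin_eqI[of _ V "base_space K"])
  note [simp] = assms dual_closed[OF assms(2)] set_mp[OF some_basis(3)[OF assms(1)]]
  show "?s \<in> lin K V (base_space K)"
    using finsum_closed[of "dual K V" "some_basis V" "\<lambda>b. \<phi> b \<odot>\<^bsub>dual K V\<^esub> bcoord V b"] by simp
  fix v assume v: "v \<in> carrier V"
  have "?s v = finsum (base_space K) (\<lambda>b. (\<phi> b \<odot>\<^bsub>dual K V\<^esub> bcoord V b) v) (some_basis V)"
    by (rule module_hom_finsum[OF dual_eval_hom]) (use v in simp_all)
  also have "\<dots> = finsum (base_space K) (\<lambda>b. bcoord V b v \<otimes>\<^bsub>K\<^esub> \<phi> b) (some_basis V)"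
    by (rule finsum_cong) (use v in \<open>simp_all add: K.m_comm\<close>)
  also have "\<dots> = \<phi> v"
    using dual_expand_apply[OF assms v] by (simp add: finsum_base_space)
  finally show "?s v = \<phi> v" .
qed (use assms in simp)

lemma dual_fd [simp]:
  assumes "fd_space K V"
  shows "fd_space K (dual K V)"
proof (rule fd_spaceI)
  note b = some_basis[OF assms]
  show "finite (bcoord V ` some_basis V)" "bcoord V ` some_basis V \<subseteq> carrier (dual K V)"
    using b assms by auto
  fix N assume N: "LinearCombinations.submodule K N (dual K V)" "bcoord V ` some_basis V \<subseteq> N"
  show "carrier (dual K V) \<subseteq> N"
  proof
    fix \<phi> assume "\<phi> \<in> carrier (dual K V)"
    then have \<phi>: "\<phi> \<in> lin K V (base_space K)" by simp
    have "finsum (dual K V) (\<lambda>b. \<phi> b \<odot>\<^bsub>dual K V\<^esub> bcoord V b) (some_basis V) = \<phi>"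
      and "\<And>b. b \<in> some_basis V \<Longrightarrow> \<phi> b \<in> carrier K"
      using dual_expand[OF assms \<phi>] b dual_closed[OF \<phi>] by auto
    then show "\<phi> \<in> N"
      using submodule_finsum[OF N(1), of "some_basis V" "\<lambda>b. \<phi> b \<odot>\<^bsub>dual K V\<^esub> bcoord V b"]
        submodule.smult_closed[OF N(1)] N(2) by (simp add: image_subset_iff)
  qed
qed (use assms in simp)

text \<open>Surjectivity is what makes the \<open>inv_into\<close> inside \<open>coev_dual\<close> a
  genuine preimage.\<close>

lemma bidual_surj:
  assumes "fd_space K V" "\<Lambda> \<in> lin K (dual K V) (base_space K)"
  shows "\<Lambda> \<in> bidual_map K V ` carrier V"
proof
  note [simp] = assms set_mp[OF some_basis(3)[OF assms(1)]]
  \<comment> \<open>The witness is forced: its coordinate at \<open>b\<close> is its value under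
    \<open>bcoord V b\<close>, which must be \<open>\<Lambda> (bcoord V b)\<close>.\<close>
  let ?v = "finsum V (\<lambda>b. \<Lambda> (bcoord V b) \<odot>\<^bsub>V\<^esub> b) (some_basis V)"
  have cl: "\<Lambda> (bcoord V b) \<in> carrier K" if "b \<in> some_basis V" for b
    using that linD(3)[OF assms(2)] by simp
  show v: "?v \<in> carrier V"
    by (rule finsum_closed) (use cl in auto)
  show "\<Lambda> = bidual_map K V ?v"
  proof (rule extensionalityI)
    show "\<Lambda> \<in> extensional (carrier (dual K V))"
      by (rule linD(2)[OF assms(2)])
    show "bidual_map K V ?v \<in> extensional (carrier (dual K V))"
      using v by (simp add: bidual_map_def)
    fix \<phi> assume \<phi>: "\<phi> \<in> carrier (dual K V)"
    then have \<phi>'[simp]: "\<phi> \<in> lin K V (base_space K)" by simp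
    note [simp] = dual_closed[OF \<phi>']
    have "\<Lambda> \<phi> = \<Lambda> (finsum (dual K V) (\<lambda>b. \<phi> b \<odot>\<^bsub>dual K V\<^esub> bcoord V b) (some_basis V))"
      by (simp add: dual_expand)
    also have "\<dots> = finsum (base_space K) (\<lambda>b. \<Lambda> (\<phi> b \<odot>\<^bsub>dual K V\<^esub> bcoord V b)) (some_basis V)"
      by (rule module_hom_finsum[OF linD(1)[OF assms(2)]]) simp_all
    also have "\<dots> = finsum (base_space K) (\<lambda>b. \<phi> (\<Lambda> (bcoord V b) \<odot>\<^bsub>V\<^esub> b)) (some_basis V)"
      by (rule finsum_cong)
        (use cl in \<open>simp_all add: K.m_comm linD(5)[OF assms(2)] linD(5)[OF \<phi>']\<close>)
    also have "\<dots> = \<phi> ?v"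
      using module_hom_finsum[OF linD(1)[OF \<phi>'] fd_space_vs[OF assms(1)] base_space_vs,
          of "some_basis V" "\<lambda>b. \<Lambda> (bcoord V b) \<odot>\<^bsub>V\<^esub> b"] cl
      by simp
    finally show "\<Lambda> \<phi> = bidual_map K V ?v \<phi>"
      using v by (simp add: bidual_map_def)
  qed
qed

end

context ground_field begin

section \<open>Tensor products\<close>

text \<open>Negation is multiplication by minus one, so a submodule is closed under it. This gives
  access to the coset theory of abelian groups, in which the quotient defining \<open>tensor\<close>
  is written.\<close>

lemma submodule_abelian_subgroup:
  assumes "vectorspace K F" "LinearCombinations.submodule K N F"
  shows "abelian_subgroup N F"
proof (rule abelian_subgroupI3)
  interpret F: module K F by (rule vs_module[OF assms(1)])
  interpret N: LinearCombinations.submodule K N F by (rule assms(2))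
  show "abelian_group F" by (rule vs_abelian_group[OF assms(1)])
  show "additive_subgroup N F"
  proof (rule additive_subgroupI, rule subgroup.intro)
    fix x assume "x \<in> N"
    then have "(\<ominus>\<^bsub>K\<^esub> \<one>\<^bsub>K\<^esub>) \<odot>\<^bsub>F\<^esub> x \<in> N" "x \<in> carrier F"
      using N.smult_closed[of "\<ominus>\<^bsub>K\<^esub> \<one>\<^bsub>K\<^esub>" x] N.subset by auto
    then show "inv\<^bsub>add_monoid F\<^esub> x \<in> N"
      by (simp add: F.smult_l_minus flip: a_inv_def)
  qed (use N.subset in auto)
qed

lemma coset_facts:
  assumes "vectorspace K F" "LinearCombinations.submodule K N F" "x \<in> carrier F" "y \<in> carrier F"
  shows "x \<in> N +>\<^bsub>F\<^esub> x"
    and "N +>\<^bsub>F\<^esub> x = N +>\<^bsub>F\<^esub> y \<longleftrightarrow> x \<ominus>\<^bsub>F\<^esub> y \<in> N"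
    and "set_add F (N +>\<^bsub>F\<^esub> x) (N +>\<^bsub>F\<^esub> y) = N +>\<^bsub>F\<^esub> (x \<oplus>\<^bsub>F\<^esub> y)"
    and "N +>\<^bsub>F\<^esub> \<zero>\<^bsub>F\<^esub> = N"
    and "z \<in> N +>\<^bsub>F\<^esub> x \<longleftrightarrow> z \<in> carrier F \<and> z \<ominus>\<^bsub>F\<^esub> x \<in> N"
proof -
  interpret abelian_subgroup N F by (rule submodule_abelian_subgroup[OF assms(1,2)])
  show self: "x \<in> N +>\<^bsub>F\<^esub> x" by (rule a_rcos_self[OF assms(3)])
  show "N +>\<^bsub>F\<^esub> x = N +>\<^bsub>F\<^esub> y \<longleftrightarrow> x \<ominus>\<^bsub>F\<^esub> y \<in> N"
    using a_rcos_module[OF assms(4,3)] a_repr_independence'[OF _ assms(4), of x] self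
    by (metis a_minus_def)
  show "set_add F (N +>\<^bsub>F\<^esub> x) (N +>\<^bsub>F\<^esub> y) = N +>\<^bsub>F\<^esub> (x \<oplus>\<^bsub>F\<^esub> y)"
    by (rule a_rcos_sum[OF assms(3,4)])
  show "N +>\<^bsub>F\<^esub> \<zero>\<^bsub>F\<^esub> = N"
    using a_rcos_const submodule.zero_closed[OF assms(2)] by blast
  show "z \<in> N +>\<^bsub>F\<^esub> x \<longleftrightarrow> z \<in> carrier F \<and> z \<ominus>\<^bsub>F\<^esub> x \<in> N"
    using a_rcos_module[OF assms(3), of z] a_elemrcos_carrier[OF assms(3), of z] by (metis a_minus_def)
qed

lemma vs_minus_zero:
  assumes "vectorspace K V" "x \<in> carrier V" "y \<in> carrier V" "x \<ominus>\<^bsub>V\<^esub> y = \<zero>\<^bsub>V\<^esub>"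
  shows "x = y"
proof -
  have "x = x \<oplus>\<^bsub>V\<^esub> (y \<oplus>\<^bsub>V\<^esub> \<ominus>\<^bsub>V\<^esub> y)"
    using assms by (simp add: vs_neg)
  also have "\<dots> = (x \<ominus>\<^bsub>V\<^esub> y) \<oplus>\<^bsub>V\<^esub> y"
    using assms(1-3) by (simp add: a_minus_def vs_add_ac)
  finally show ?thesis
    using assms by simp
qed

section \<open>The free vector space on pairs\<close>

lemma free_space_simps:
  "carrier (free_space K V W) = {\<phi> \<in> carrier V \<times> carrier W \<rightarrow>\<^sub>E carrier K.
     finite {p \<in> carrier V \<times> carrier W. \<phi> p \<noteq> \<zero>\<^bsub>K\<^esub>}}"
  "\<zero>\<^bsub>free_space K V W\<^esub> = (\<lambda>p\<in>carrier V \<times> carrier W. \<zero>\<^bsub>K\<^esub>)"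
  "f \<oplus>\<^bsub>free_space K V W\<^esub> g = (\<lambda>p\<in>carrier V \<times> carrier W. f p \<oplus>\<^bsub>K\<^esub> g p)"
  "c \<odot>\<^bsub>free_space K V W\<^esub> f = (\<lambda>p\<in>carrier V \<times> carrier W. c \<otimes>\<^bsub>K\<^esub> f p)"
  by (simp_all add: free_space_def K.func_space_def)

definition supp :: "('k, 'v, 'y) module_scheme \<Rightarrow> ('k, 'w, 'z) module_scheme \<Rightarrow> ('v \<times> 'w \<Rightarrow> 'k) \<Rightarrow> ('v \<times> 'w) set" where
  "supp V W \<phi> = {p \<in> carrier V \<times> carrier W. \<phi> p \<noteq> \<zero>\<^bsub>K\<^esub>}"

lemma free_carrierD:
  assumes "\<phi> \<in> carrier (free_space K V W)"
  shows "p \<in> carrier V \<times> carrier W \<Longrightarrow> \<phi> p \<in> carrier K" "finite (supp V W \<phi>)"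
    "supp V W \<phi> \<subseteq> carrier V \<times> carrier W" "\<phi> \<in> extensional (carrier V \<times> carrier W)"
    "p \<in> supp V W \<phi> \<Longrightarrow> \<phi> p \<in> carrier K"
  using assms by (auto simp: free_space_simps supp_def PiE_iff)

lemma free_carrierI:
  assumes "\<And>p. p \<in> carrier V \<times> carrier W \<Longrightarrow> f p \<in> carrier K"
    "finite T" "\<And>p. p \<in> carrier V \<times> carrier W - T \<Longrightarrow> f p = \<zero>\<^bsub>K\<^esub>"
  shows "(\<lambda>p\<in>carrier V \<times> carrier W. f p) \<in> carrier (free_space K V W)"
proof -
  have "{p \<in> carrier V \<times> carrier W. (\<lambda>p\<in>carrier V \<times> carrier W. f p) p \<noteq> \<zero>\<^bsub>K\<^esub>} \<subseteq> T"
    using assms(3) by auto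
  then show ?thesis
    unfolding free_space_simps using assms(1) finite_subset[OF _ assms(2)] by (simp add: PiE_iff)
qed

lemma free_space_vs: "vectorspace K (free_space K V W)"
proof (rule vsI)
  let ?F = "free_space K V W"
  note D = free_carrierD
  show "\<zero>\<^bsub>?F\<^esub> \<in> carrier ?F"
    unfolding free_space_simps(2) by (rule free_carrierI[of _ _ _ "{}"]) auto
  show "f \<oplus>\<^bsub>?F\<^esub> g \<in> carrier ?F" if "f \<in> carrier ?F" "g \<in> carrier ?F" for f g
    unfolding free_space_simps(3)
    by (rule free_carrierI[of _ _ _ "supp V W f \<union> supp V W g"])
      (use D[OF that(1)] D[OF that(2)] in \<open>auto simp: supp_def\<close>)
  show "c \<odot>\<^bsub>?F\<^esub> f \<in> carrier ?F" if "c \<in> carrier K" "f \<in> carrier ?F" for c f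
    unfolding free_space_simps(4)
    by (rule free_carrierI[of _ _ _ "supp V W f"]) (use D[OF that(2)] that(1) in \<open>auto simp: supp_def\<close>)
  show "\<exists>g\<in>carrier ?F. f \<oplus>\<^bsub>?F\<^esub> g = \<zero>\<^bsub>?F\<^esub>" if "f \<in> carrier ?F" for f
  proof
    show "(\<lambda>p\<in>carrier V \<times> carrier W. \<ominus>\<^bsub>K\<^esub> f p) \<in> carrier ?F"
      by (rule free_carrierI[of _ _ _ "supp V W f"]) (use D[OF that] in \<open>auto simp: supp_def\<close>)
    show "f \<oplus>\<^bsub>?F\<^esub> (\<lambda>p\<in>carrier V \<times> carrier W. \<ominus>\<^bsub>K\<^esub> f p) = \<zero>\<^bsub>?F\<^esub>"
      unfolding free_space_simps by (rule restrict_ext) (use D(1)[OF that] K.r_neg in auto)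
  qed
  show "f \<oplus>\<^bsub>?F\<^esub> \<zero>\<^bsub>?F\<^esub> = f" if "f \<in> carrier ?F" for f
    unfolding free_space_simps
    by (rule extensionalityI[OF _ D(4)[OF that]]) (use D(1)[OF that] in auto)
  show "\<one>\<^bsub>K\<^esub> \<odot>\<^bsub>?F\<^esub> f = f" if "f \<in> carrier ?F" for f
    unfolding free_space_simps
    by (rule extensionalityI[OF _ D(4)[OF that]]) (use D(1)[OF that] in auto)
qed (auto simp: free_space_simps PiE_iff K.a_ac K.m_assoc K.l_distr K.r_distr intro!: restrict_ext)

lemma gen_closed [simp]: "gen K V W v w \<in> carrier (free_space K V W)"
  unfolding gen_def by (rule free_carrierI[of _ _ _ "{(v, w)}"]) auto

text \<open>Linear extension from generators of an arbitrary map on pairs. Bilinearity only enters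
  later, when \<open>lext\<close> has to vanish on the relations.\<close>

definition lext :: "('k, 'v, 'x) module_scheme \<Rightarrow> ('k, 'w, 'y) module_scheme \<Rightarrow> ('k, 't, 'z) module_scheme \<Rightarrow>
    ('v \<Rightarrow> 'w \<Rightarrow> 't) \<Rightarrow> ('v \<times> 'w \<Rightarrow> 'k) \<Rightarrow> 't" where
  "lext V W Z \<beta> \<phi> = finsum Z (\<lambda>p. \<phi> p \<odot>\<^bsub>Z\<^esub> \<beta> (fst p) (snd p)) (supp V W \<phi>)"

context
  fixes V :: "('k, 'v, 'x) module_scheme" and W :: "('k, 'w, 'y) module_scheme"
    and Z :: "('k, 't, 'z) module_scheme" and \<beta> :: "'v \<Rightarrow> 'w \<Rightarrow> 't"
  assumes Z [simp]: "vectorspace K Z"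
    and \<beta> [simp]: "\<And>v w. v \<in> carrier V \<Longrightarrow> w \<in> carrier W \<Longrightarrow> \<beta> v w \<in> carrier Z"
begin

text \<open>The support changes under addition and scaling, so linearity is proved by summing over a
  common finite superset, where the extra terms vanish.\<close>

lemma lext_superset:
  assumes "\<phi> \<in> carrier (free_space K V W)" "finite T" "supp V W \<phi> \<subseteq> T" "T \<subseteq> carrier V \<times> carrier W"
  shows "lext V W Z \<beta> \<phi> = finsum Z (\<lambda>p. \<phi> p \<odot>\<^bsub>Z\<^esub> \<beta> (fst p) (snd p)) T"
  unfolding lext_def
proof (rule finsum_mono_neutral)
  show "\<phi> p \<odot>\<^bsub>Z\<^esub> \<beta> (fst p) (snd p) = \<zero>\<^bsub>Z\<^esub>" if "p \<in> T - supp V W \<phi>" for p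
  proof -
    have "p \<in> carrier V \<times> carrier W" "\<phi> p = \<zero>\<^bsub>K\<^esub>"
      using that assms(4) by (auto simp: supp_def)
    then show ?thesis by auto
  qed
  show "\<phi> p \<odot>\<^bsub>Z\<^esub> \<beta> (fst p) (snd p) \<in> carrier Z" if "p \<in> supp V W \<phi>" for p
    using free_carrierD(1)[OF assms(1)] that by (auto simp: supp_def)
qed (use assms in auto)

lemma lext_hom: "lext V W Z \<beta> \<in> module_hom K (free_space K V W) Z"
proof (rule module_homI)
  let ?F = "free_space K V W"
  have vs: "vectorspace K ?F" by (rule free_space_vs)
  show cl: "lext V W Z \<beta> \<phi> \<in> carrier Z" if "\<phi> \<in> carrier ?F" for \<phi>
    unfolding lext_def
    by (rule finsum_closed) (use free_carrierD(1)[OF that] in \<open>auto simp: supp_def\<close>)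
  have term_closed: "\<phi> p \<odot>\<^bsub>Z\<^esub> \<beta> (fst p) (snd p) \<in> carrier Z"
    if "\<phi> \<in> carrier ?F" "p \<in> carrier V \<times> carrier W" for \<phi> p
    using free_carrierD(1)[OF that] that(2) by auto
  show "lext V W Z \<beta> (\<phi> \<oplus>\<^bsub>?F\<^esub> \<psi>) = lext V W Z \<beta> \<phi> \<oplus>\<^bsub>Z\<^esub> lext V W Z \<beta> \<psi>"
    if "\<phi> \<in> carrier ?F" "\<psi> \<in> carrier ?F" for \<phi> \<psi>
  proof -
    note D = free_carrierD[OF that(1)] free_carrierD[OF that(2)]
    let ?T = "supp V W \<phi> \<union> supp V W \<psi>"
    have T: "finite ?T" "?T \<subseteq> carrier V \<times> carrier W"
      using D by auto
    have "lext V W Z \<beta> (\<phi> \<oplus>\<^bsub>?F\<^esub> \<psi>) = finsum Z (\<lambda>p. (\<phi> \<oplus>\<^bsub>?F\<^esub> \<psi>) p \<odot>\<^bsub>Z\<^esub> \<beta> (fst p) (snd p)) ?T"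
      by (rule lext_superset[OF _ T(1) _ T(2)])
        (use vs_closed(2)[OF vs that] in \<open>auto simp: supp_def free_space_simps(3)\<close>)
    also have "\<dots> = finsum Z (\<lambda>p. \<phi> p \<odot>\<^bsub>Z\<^esub> \<beta> (fst p) (snd p) \<oplus>\<^bsub>Z\<^esub> \<psi> p \<odot>\<^bsub>Z\<^esub> \<beta> (fst p) (snd p)) ?T"
    proof (rule finsum_cong)
      fix p assume "p \<in> ?T"
      then have p: "p \<in> carrier V \<times> carrier W" using T by blast
      then show "(\<phi> \<oplus>\<^bsub>?F\<^esub> \<psi>) p \<odot>\<^bsub>Z\<^esub> \<beta> (fst p) (snd p) =
          \<phi> p \<odot>\<^bsub>Z\<^esub> \<beta> (fst p) (snd p) \<oplus>\<^bsub>Z\<^esub> \<psi> p \<odot>\<^bsub>Z\<^esub> \<beta> (fst p) (snd p)"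
        using D(1,6)[OF p] by (auto simp: free_space_simps(3) vs_distrib)
    qed (use T term_closed that in \<open>auto simp: subset_eq\<close>)
    also have "\<dots> = lext V W Z \<beta> \<phi> \<oplus>\<^bsub>Z\<^esub> lext V W Z \<beta> \<psi>"
      using lext_superset[OF that(1) T(1) _ T(2)] lext_superset[OF that(2) T(1) _ T(2)] T that
      by (subst finsum_addf) (auto intro!: term_closed)
    finally show ?thesis .
  qed
  show "lext V W Z \<beta> (c \<odot>\<^bsub>?F\<^esub> \<phi>) = c \<odot>\<^bsub>Z\<^esub> lext V W Z \<beta> \<phi>"
    if "c \<in> carrier K" "\<phi> \<in> carrier ?F" for c \<phi>
  proof -
    note D = free_carrierD[OF that(2)]
    let ?T = "supp V W \<phi>"
    have "lext V W Z \<beta> (c \<odot>\<^bsub>?F\<^esub> \<phi>) = finsum Z (\<lambda>p. (c \<odot>\<^bsub>?F\<^esub> \<phi>) p \<odot>\<^bsub>Z\<^esub> \<beta> (fst p) (snd p)) ?T"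
      by (rule lext_superset)
        (use D vs_closed(3)[OF vs that] that(1) in \<open>auto simp: supp_def free_space_simps(4)\<close>)
    also have "\<dots> = finsum Z (\<lambda>p. c \<odot>\<^bsub>Z\<^esub> (\<phi> p \<odot>\<^bsub>Z\<^esub> \<beta> (fst p) (snd p))) ?T"
    proof (rule finsum_cong)
      fix p assume "p \<in> ?T"
      then have p: "p \<in> carrier V \<times> carrier W" using D by blast
      then show "(c \<odot>\<^bsub>?F\<^esub> \<phi>) p \<odot>\<^bsub>Z\<^esub> \<beta> (fst p) (snd p) = c \<odot>\<^bsub>Z\<^esub> (\<phi> p \<odot>\<^bsub>Z\<^esub> \<beta> (fst p) (snd p))"
        using D(1)[OF p] that by (auto simp: free_space_simps(4) vs_smult_assoc)
    qed (use D term_closed that in \<open>auto simp: subset_eq\<close>)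
    also have "\<dots> = c \<odot>\<^bsub>Z\<^esub> lext V W Z \<beta> \<phi>"
      unfolding lext_def using D that by (subst finsum_smult) (auto intro!: term_closed)
    finally show ?thesis .
  qed
qed

lemma lext_gen:
  assumes "v \<in> carrier V" "w \<in> carrier W"
  shows "lext V W Z \<beta> (gen K V W v w) = \<beta> v w"
proof -
  have "lext V W Z \<beta> (gen K V W v w) =
      finsum Z (\<lambda>p. gen K V W v w p \<odot>\<^bsub>Z\<^esub> \<beta> (fst p) (snd p)) {(v, w)}"
    by (rule lext_superset[OF gen_closed]) (use assms in \<open>auto simp: supp_def gen_def\<close>)
  also have "\<dots> = \<beta> v w"
    using assms finsum_insert[of Z "{}" "(v, w)" "\<lambda>p. gen K V W v w p \<odot>\<^bsub>Z\<^esub> \<beta> (fst p) (snd p)"]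
    by (simp add: gen_def finsum_empty)
  finally show ?thesis .
qed

end

text \<open>Induction on the size of the support, splitting off the contribution of one pair at a
  time.\<close>

lemma free_induct [consumes 1, case_names add zero]:
  assumes "\<phi> \<in> carrier (free_space K V W)"
    and "\<And>c v w \<phi>. c \<in> carrier K \<Longrightarrow> v \<in> carrier V \<Longrightarrow> w \<in> carrier W \<Longrightarrow>
      \<phi> \<in> carrier (free_space K V W) \<Longrightarrow> P \<phi> \<Longrightarrow>
      P ((c \<odot>\<^bsub>free_space K V W\<^esub> gen K V W v w) \<oplus>\<^bsub>free_space K V W\<^esub> \<phi>)"
    and "P \<zero>\<^bsub>free_space K V W\<^esub>"
  shows "P \<phi>"
proof -
  let ?F = "free_space K V W"
  have "finite (supp V W \<phi>)" by (rule free_carrierD(2)[OF assms(1)])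
  then show ?thesis
    using assms(1)
  proof (induction "supp V W \<phi>" arbitrary: \<phi> rule: finite_induct)
    case empty
    then have "\<phi> = \<zero>\<^bsub>?F\<^esub>"
      using free_carrierD(4)[OF empty(2)]
      by (auto intro!: extensionalityI[of _ "carrier V \<times> carrier W"] simp: free_space_simps(2) supp_def)
    then show ?case using assms(3) by simp
  next
    case (insert p S)
    note D = free_carrierD[OF insert(5)]
    \<comment> \<open>Erasing the value at \<open>p\<close> removes exactly \<open>p\<close> from
      the support, and \<open>\<phi>\<close> is recovered by adding the multiple of the generator at
      \<open>p\<close>.\<close>
    define \<psi> where "\<psi> = (\<lambda>q\<in>carrier V \<times> carrier W. if q = p then \<zero>\<^bsub>K\<^esub> else \<phi> q)"
    have p: "p \<in> carrier V \<times> carrier W" using insert(4) D(3) by blast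
    have \<psi>: "\<psi> \<in> carrier ?F"
      unfolding \<psi>_def by (rule free_carrierI[of _ _ _ "supp V W \<phi>"]) (use D in \<open>auto simp: supp_def\<close>)
    have S: "S = supp V W \<psi>"
      using insert(2,4) by (auto simp: supp_def \<psi>_def)
    have "\<phi> = (\<phi> p \<odot>\<^bsub>?F\<^esub> gen K V W (fst p) (snd p)) \<oplus>\<^bsub>?F\<^esub> \<psi>"
      unfolding free_space_simps
      by (rule extensionalityI[OF D(4)]) (use D(1) p in \<open>auto simp: gen_def \<psi>_def\<close>)
    moreover have "P ((\<phi> p \<odot>\<^bsub>?F\<^esub> gen K V W (fst p) (snd p)) \<oplus>\<^bsub>?F\<^esub> \<psi>)"
      by (rule assms(2)[OF D(1)[OF p] _ _ \<psi> insert(3)[OF S \<psi>]]) (use p in auto)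
    ultimately show ?case by simp
  qed
qed

section \<open>Bilinear maps and passage to the quotient\<close>

definition bilin :: "('k, 'v, 'x) module_scheme \<Rightarrow> ('k, 'w, 'y) module_scheme \<Rightarrow> ('k, 't, 'z) module_scheme \<Rightarrow>
    ('v \<Rightarrow> 'w \<Rightarrow> 't) \<Rightarrow> bool" where
  "bilin V W Z \<beta> \<longleftrightarrow> (\<forall>v\<in>carrier V. \<beta> v \<in> module_hom K W Z) \<and>
     (\<forall>w\<in>carrier W. (\<lambda>v. \<beta> v w) \<in> module_hom K V Z)"

lemma bilinI:
  assumes "\<And>v. v \<in> carrier V \<Longrightarrow> \<beta> v \<in> module_hom K W Z"
    and "\<And>w. w \<in> carrier W \<Longrightarrow> (\<lambda>v. \<beta> v w) \<in> module_hom K V Z"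
  shows "bilin V W Z \<beta>"
  using assms by (simp add: bilin_def)

lemma bilinD:
  assumes "bilin V W Z \<beta>"
  shows "v \<in> carrier V \<Longrightarrow> w \<in> carrier W \<Longrightarrow> \<beta> v w \<in> carrier Z"
    and "v \<in> carrier V \<Longrightarrow> v' \<in> carrier V \<Longrightarrow> w \<in> carrier W \<Longrightarrow> \<beta> (v \<oplus>\<^bsub>V\<^esub> v') w = \<beta> v w \<oplus>\<^bsub>Z\<^esub> \<beta> v' w"
    and "v \<in> carrier V \<Longrightarrow> w \<in> carrier W \<Longrightarrow> w' \<in> carrier W \<Longrightarrow> \<beta> v (w \<oplus>\<^bsub>W\<^esub> w') = \<beta> v w \<oplus>\<^bsub>Z\<^esub> \<beta> v w'"
    and "c \<in> carrier K \<Longrightarrow> v \<in> carrier V \<Longrightarrow> w \<in> carrier W \<Longrightarrow> \<beta> (c \<odot>\<^bsub>V\<^esub> v) w = c \<odot>\<^bsub>Z\<^esub> \<beta> v w"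
    and "c \<in> carrier K \<Longrightarrow> v \<in> carrier V \<Longrightarrow> w \<in> carrier W \<Longrightarrow> \<beta> v (c \<odot>\<^bsub>W\<^esub> w) = c \<odot>\<^bsub>Z\<^esub> \<beta> v w"
  using assms by (auto simp: bilin_def module_hom_def)

definition tensor_gens :: "('k, 'v, 'y) module_scheme \<Rightarrow> ('k, 'w, 'z) module_scheme \<Rightarrow> ('v \<times> 'w \<Rightarrow> 'k) set" where
  "tensor_gens V W = (let F = free_space K V W; \<delta> = gen K V W in
       ({\<delta> (v \<oplus>\<^bsub>V\<^esub> v') w \<ominus>\<^bsub>F\<^esub> (\<delta> v w \<oplus>\<^bsub>F\<^esub> \<delta> v' w) | v v' w.
            v \<in> carrier V \<and> v' \<in> carrier V \<and> w \<in> carrier W} \<union>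
        {\<delta> v (w \<oplus>\<^bsub>W\<^esub> w') \<ominus>\<^bsub>F\<^esub> (\<delta> v w \<oplus>\<^bsub>F\<^esub> \<delta> v w') | v w w'.
            v \<in> carrier V \<and> w \<in> carrier W \<and> w' \<in> carrier W} \<union>
        {\<delta> (c \<odot>\<^bsub>V\<^esub> v) w \<ominus>\<^bsub>F\<^esub> (c \<odot>\<^bsub>F\<^esub> \<delta> v w) | c v w.
            c \<in> carrier K \<and> v \<in> carrier V \<and> w \<in> carrier W} \<union>
        {\<delta> v (c \<odot>\<^bsub>W\<^esub> w) \<ominus>\<^bsub>F\<^esub> (c \<odot>\<^bsub>F\<^esub> \<delta> v w) | c v w.
            c \<in> carrier K \<and> v \<in> carrier V \<and> w \<in> carrier W}))"

lemma tensor_rel_eq: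
  "tensor_rel K V W = LinearCombinations.module.span K (free_space K V W) (tensor_gens V W)"
  by (simp add: tensor_rel_def tensor_gens_def Let_def)

lemma tensor_gens_subset: "tensor_gens V W \<subseteq> carrier (free_space K V W)"
  unfolding tensor_gens_def Let_def using free_space_vs[of V W] by auto

lemma tensor_rel_submodule: "LinearCombinations.submodule K (tensor_rel K V W) (free_space K V W)"
  unfolding tensor_rel_eq
  by (rule module.span_is_submodule[OF vs_module[OF free_space_vs] tensor_gens_subset])

lemma tensor_gens_rel: "tensor_gens V W \<subseteq> tensor_rel K V W"
  unfolding tensor_rel_eq
  by (rule module.in_own_span[OF vs_module[OF free_space_vs] tensor_gens_subset])

abbreviation (input) tcls :: "('k, 'v, 'y) module_scheme \<Rightarrow> ('k, 'w, 'z) module_scheme \<Rightarrow>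
    ('v \<times> 'w \<Rightarrow> 'k) \<Rightarrow> ('v \<times> 'w \<Rightarrow> 'k) set" where
  "tcls V W \<phi> \<equiv> tensor_rel K V W +>\<^bsub>free_space K V W\<^esub> \<phi>"

lemmas tcls_facts = coset_facts[OF free_space_vs tensor_rel_submodule]

lemma tensor_carrier: "carrier (tensor K V W) = tcls V W ` carrier (free_space K V W)"
  by (auto simp: tensor_def Let_def A_RCOSETS_def')

lemma tensor_zero: "\<zero>\<^bsub>tensor K V W\<^esub> = tcls V W \<zero>\<^bsub>free_space K V W\<^esub>"
  using tcls_facts(4)[of "\<zero>\<^bsub>free_space K V W\<^esub>" V W "\<zero>\<^bsub>free_space K V W\<^esub>"] free_space_vs[of V W]
  by (simp add: tensor_def Let_def)

lemma tensor_add: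
  "\<phi> \<in> carrier (free_space K V W) \<Longrightarrow> \<psi> \<in> carrier (free_space K V W) \<Longrightarrow>
    tcls V W \<phi> \<oplus>\<^bsub>tensor K V W\<^esub> tcls V W \<psi> = tcls V W (\<phi> \<oplus>\<^bsub>free_space K V W\<^esub> \<psi>)"
  using tcls_facts(3) by (simp add: tensor_def Let_def)

text \<open>Scalar multiplication on the quotient is a union over all representatives of a coset.
  Two representatives differ by a relation, whose multiples are again relations, so all members of
  the union coincide.\<close>

lemma tensor_smult:
  assumes c: "c \<in> carrier K" and \<phi>: "\<phi> \<in> carrier (free_space K V W)"
  shows "c \<odot>\<^bsub>tensor K V W\<^esub> tcls V W \<phi> = tcls V W (c \<odot>\<^bsub>free_space K V W\<^esub> \<phi>)"
proof -
  let ?F = "free_space K V W" and ?N = "tensor_rel K V W"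
  note [simp] = free_space_vs[of V W]
  interpret F: module K ?F by (rule vs_module) simp
  have eq: "tcls V W (c \<odot>\<^bsub>?F\<^esub> \<psi>) = tcls V W (c \<odot>\<^bsub>?F\<^esub> \<phi>)" if "\<psi> \<in> tcls V W \<phi>" for \<psi>
  proof -
    have \<psi>: "\<psi> \<in> carrier ?F" "\<psi> \<ominus>\<^bsub>?F\<^esub> \<phi> \<in> ?N"
      using that tcls_facts(5)[OF \<phi> \<phi>] by auto
    have "c \<odot>\<^bsub>?F\<^esub> \<psi> \<ominus>\<^bsub>?F\<^esub> c \<odot>\<^bsub>?F\<^esub> \<phi> = c \<odot>\<^bsub>?F\<^esub> (\<psi> \<ominus>\<^bsub>?F\<^esub> \<phi>)"
      using c \<phi> \<psi> by (simp add: a_minus_def F.smult_r_distr F.smult_r_minus)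
    then have "c \<odot>\<^bsub>?F\<^esub> \<psi> \<ominus>\<^bsub>?F\<^esub> c \<odot>\<^bsub>?F\<^esub> \<phi> \<in> ?N"
      using submodule.smult_closed[OF tensor_rel_submodule c \<psi>(2)] by simp
    then show ?thesis
      using tcls_facts(2)[of "c \<odot>\<^bsub>?F\<^esub> \<psi>" V W "c \<odot>\<^bsub>?F\<^esub> \<phi>"] c \<phi> \<psi> by simp
  qed
  have "(\<Union>\<psi>\<in>tcls V W \<phi>. tcls V W (c \<odot>\<^bsub>?F\<^esub> \<psi>)) = tcls V W (c \<odot>\<^bsub>?F\<^esub> \<phi>)"
    using tcls_facts(1)[OF \<phi> \<phi>] eq by blast
  then show ?thesis
    by (simp add: tensor_def Let_def)
qed

lemma tensor_vs [simp]: "vectorspace K (tensor K V W)"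
proof -
  let ?F = "free_space K V W" and ?T = "tensor K V W"
  note [simp] = free_space_vs[of V W]
  have rep: "\<exists>\<phi>. \<phi> \<in> carrier ?F \<and> t = tcls V W \<phi>" if "t \<in> carrier ?T" for t
    using that by (auto simp: tensor_carrier)
  have cl: "\<phi> \<in> carrier ?F \<Longrightarrow> tcls V W \<phi> \<in> carrier ?T" for \<phi>
    by (simp add: tensor_carrier)
  note simps [simp] = tensor_zero tensor_add tensor_smult cl
  show ?thesis
  proof (rule vsI)
    show "\<exists>y\<in>carrier ?T. x \<oplus>\<^bsub>?T\<^esub> y = \<zero>\<^bsub>?T\<^esub>" if x: "x \<in> carrier ?T" for x
    proof -
      obtain \<phi> where "\<phi> \<in> carrier ?F" "x = tcls V W \<phi>" using rep[OF x] by auto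
      then show ?thesis
        by (intro bexI[of _ "tcls V W (\<ominus>\<^bsub>?F\<^esub> \<phi>)"]) (simp_all add: vs_neg)
    qed
  qed (auto dest!: rep simp: vs_distrib vs_add_ac vs_smult_assoc)
qed

lemma tens_eq: "tens K V W v w = tcls V W (gen K V W v w)"
  by (simp add: tens_def)

lemma tens_closed [simp]: "tens K V W v w \<in> carrier (tensor K V W)"
  by (simp add: tens_eq tensor_carrier)

lemma tens_bilin:
  assumes [simp]: "vectorspace K V" "vectorspace K W"
  shows "bilin V W (tensor K V W) (tens K V W)"
proof -
  let ?F = "free_space K V W"
  note [simp] = free_space_vs[of V W]
  \<comment> \<open>Each bilinearity law has exactly one of the spanning relations as the difference
    of its two sides.\<close>
  have eq: "tcls V W \<phi> = tcls V W \<psi>"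
    if "\<phi> \<ominus>\<^bsub>?F\<^esub> \<psi> \<in> tensor_gens V W" "\<phi> \<in> carrier ?F" "\<psi> \<in> carrier ?F" for \<phi> \<psi>
    using tcls_facts(2)[OF that(2,3)] that(1) tensor_gens_rel by blast
  show ?thesis
  proof (intro bilinI module_homI)
    show "tens K V W v (w \<oplus>\<^bsub>W\<^esub> w') = tens K V W v w \<oplus>\<^bsub>tensor K V W\<^esub> tens K V W v w'"
      if "v \<in> carrier V" "w \<in> carrier W" "w' \<in> carrier W" for v w w'
      unfolding tens_eq by (subst tensor_add, simp_all, rule eq)
        (use that in \<open>auto simp: tensor_gens_def Let_def\<close>)
    show "tens K V W v (c \<odot>\<^bsub>W\<^esub> w) = c \<odot>\<^bsub>tensor K V W\<^esub> tens K V W v w"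
      if "v \<in> carrier V" "c \<in> carrier K" "w \<in> carrier W" for v c w
      unfolding tens_eq by (subst tensor_smult, simp_all add: that, rule eq)
        (use that in \<open>auto simp: tensor_gens_def Let_def\<close>)
    show "tens K V W (v \<oplus>\<^bsub>V\<^esub> v') w = tens K V W v w \<oplus>\<^bsub>tensor K V W\<^esub> tens K V W v' w"
      if "w \<in> carrier W" "v \<in> carrier V" "v' \<in> carrier V" for w v v'
      unfolding tens_eq by (subst tensor_add, simp_all, rule eq)
        (use that in \<open>auto simp: tensor_gens_def Let_def\<close>)
    show "tens K V W (c \<odot>\<^bsub>V\<^esub> v) w = c \<odot>\<^bsub>tensor K V W\<^esub> tens K V W v w"
      if "w \<in> carrier W" "c \<in> carrier K" "v \<in> carrier V" for w c v
      unfolding tens_eq by (subst tensor_smult, simp_all add: that, rule eq)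
        (use that in \<open>auto simp: tensor_gens_def Let_def\<close>)
  qed simp_all
qed

lemma tens_hom_l: "vectorspace K V \<Longrightarrow> vectorspace K W \<Longrightarrow> w \<in> carrier W \<Longrightarrow>
    (\<lambda>v. tens K V W v w) \<in> module_hom K V (tensor K V W)"
  and tens_hom_r: "vectorspace K V \<Longrightarrow> vectorspace K W \<Longrightarrow> v \<in> carrier V \<Longrightarrow>
    tens K V W v \<in> module_hom K W (tensor K V W)"
  using tens_bilin[of V W] by (auto simp: bilin_def)

text \<open>Pure tensors generate under addition alone: a scalar is absorbed into the left factor,
  and zero is the pure tensor of two zeros.\<close>

lemma tensor_induct [consumes 3, case_names tens add]:
  assumes "t \<in> carrier (tensor K V W)" "vectorspace K V" "vectorspace K W"
    and tens: "\<And>v w. v \<in> carrier V \<Longrightarrow> w \<in> carrier W \<Longrightarrow> P (tens K V W v w)"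
    and add: "\<And>t u. t \<in> carrier (tensor K V W) \<Longrightarrow> u \<in> carrier (tensor K V W) \<Longrightarrow> P t \<Longrightarrow> P u \<Longrightarrow>
      P (t \<oplus>\<^bsub>tensor K V W\<^esub> u)"
  shows "P t"
proof -
  let ?F = "free_space K V W" and ?T = "tensor K V W"
  note [simp] = free_space_vs[of V W] assms(2,3)
  obtain \<phi> where \<phi>: "\<phi> \<in> carrier ?F" "t = tcls V W \<phi>"
    using assms(1) by (auto simp: tensor_carrier)
  from \<phi>(1) have "P (tcls V W \<phi>)"
  proof (induction rule: free_induct)
    case (add c v w \<phi>)
    have cv: "tens K V W (c \<odot>\<^bsub>V\<^esub> v) w = tcls V W (c \<odot>\<^bsub>?F\<^esub> gen K V W v w)"
      using module_homD(3)[OF tens_hom_l, of V W w c v] add by (simp add: tens_eq tensor_smult)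
    have "P (tens K V W (c \<odot>\<^bsub>V\<^esub> v) w \<oplus>\<^bsub>?T\<^esub> tcls V W \<phi>)"
      by (rule assms(5)[OF tens_closed _ tens]) (use add in \<open>simp_all add: tensor_carrier\<close>)
    then show ?case
      using add by (simp add: cv tensor_add)
  next
    case zero
    have "tens K V W \<zero>\<^bsub>V\<^esub> \<zero>\<^bsub>W\<^esub> = tcls V W \<zero>\<^bsub>?F\<^esub>"
      using module_hom_zero[OF tens_hom_l, of V W "\<zero>\<^bsub>W\<^esub>"] by (simp add: tensor_zero)
    then show ?case
      using tens[of "\<zero>\<^bsub>V\<^esub>" "\<zero>\<^bsub>W\<^esub>"] by simp
  qed
  then show ?thesis by (simp add: \<phi>)
qed

lemma tensor_hom_eqI:
  assumes "f \<in> module_hom K (tensor K V W) Z" "g \<in> module_hom K (tensor K V W) Z"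
    and "vectorspace K V" "vectorspace K W" "t \<in> carrier (tensor K V W)"
    and "\<And>v w. v \<in> carrier V \<Longrightarrow> w \<in> carrier W \<Longrightarrow> f (tens K V W v w) = g (tens K V W v w)"
  shows "f t = g t"
  using assms(5,3,4)
  by (induction rule: tensor_induct)
    (use assms(6) module_homD(2)[OF assms(1)] module_homD(2)[OF assms(2)] in auto)

text \<open>Bilinearity puts the spanning relations into the kernel, and the kernel, being a
  submodule, then contains their span.\<close>

lemma lext_rel_zero:
  assumes Z: "vectorspace K Z" and V: "vectorspace K V" and W: "vectorspace K W"
    and \<beta>: "bilin V W Z \<beta>" and "\<phi> \<in> tensor_rel K V W"
  shows "lext V W Z \<beta> \<phi> = \<zero>\<^bsub>Z\<^esub>"
proof -
  let ?F = "free_space K V W" and ?L = "lext V W Z \<beta>"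
  note [simp] = free_space_vs[of V W] V W Z
  note [simp] = bilinD[OF \<beta>]
  have hom: "?L \<in> module_hom K ?F Z" by (rule lext_hom) simp_all
  interpret L: mod_hom K ?F Z ?L
    by (simp add: mod_hom_def mod_hom_axioms_def vs_module hom)
  have g: "v \<in> carrier V \<Longrightarrow> w \<in> carrier W \<Longrightarrow> ?L (gen K V W v w) = \<beta> v w" for v w
    by (rule lext_gen) simp_all
  have "tensor_gens V W \<subseteq> L.ker"
  proof
    fix \<psi> assume \<psi>: "\<psi> \<in> tensor_gens V W"
    have "?L \<psi> = \<zero>\<^bsub>Z\<^esub>"
      using \<psi> unfolding tensor_gens_def Let_def
      by (auto simp: g)
    then show "\<psi> \<in> L.ker"
      using \<psi> tensor_gens_subset by (auto simp: L.ker_def)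
  qed
  then have "tensor_rel K V W \<subseteq> L.ker"
    unfolding tensor_rel_eq by (rule L.M.span_is_subset[OF _ L.ker_is_submodule])
  with assms(5) show ?thesis by (auto simp: L.ker_def)
qed

text \<open>The universal property, in the shape required by the definite description in
  \<open>tlift\<close>: \<open>lext\<close> descends to classes, and a linear map is determined by
  its values on pure tensors.\<close>

lemma tlift_ex1:
  assumes Z: "vectorspace K Z" and V: "vectorspace K V" and W: "vectorspace K W"
    and \<beta>: "bilin V W Z \<beta>"
  shows "\<exists>!h. h \<in> lin K (tensor K V W) Z \<and>
    (\<forall>v\<in>carrier V. \<forall>w\<in>carrier W. h (tens K V W v w) = \<beta> v w)"
proof -
  let ?F = "free_space K V W" and ?L = "lext V W Z \<beta>" and ?T = "tensor K V W"
  note [simp] = free_space_vs[of V W] V W Z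
  note [simp] = bilinD(1)[OF \<beta>]
  have hom: "?L \<in> module_hom K ?F Z" by (rule lext_hom) simp_all
  interpret L: mod_hom K ?F Z ?L
    by (simp add: mod_hom_def mod_hom_axioms_def vs_module hom)
  have L_eq: "?L \<phi> = ?L \<psi>" if "\<phi> \<in> carrier ?F" "\<psi> \<in> carrier ?F" "tcls V W \<phi> = tcls V W \<psi>" for \<phi> \<psi>
  proof -
    have "?L (\<phi> \<ominus>\<^bsub>?F\<^esub> \<psi>) = \<zero>\<^bsub>Z\<^esub>"
      by (rule lext_rel_zero[OF Z V W \<beta>]) (use tcls_facts(2) that in blast)
    with that have "?L \<phi> \<ominus>\<^bsub>Z\<^esub> ?L \<psi> = \<zero>\<^bsub>Z\<^esub>"
      by simp
    then show ?thesis
      by (rule vs_minus_zero[OF Z, rotated 2]) (use that in simp_all)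
  qed
  \<comment> \<open>An arbitrary representative is chosen in each class; by \<open>L_eq\<close> the
    value does not depend on it.\<close>
  define h where "h = (\<lambda>t\<in>carrier ?T. ?L (SOME \<phi>. \<phi> \<in> carrier ?F \<and> tcls V W \<phi> = t))"
  have h: "h (tcls V W \<phi>) = ?L \<phi>" if "\<phi> \<in> carrier ?F" for \<phi>
  proof -
    have "\<exists>\<psi>. \<psi> \<in> carrier ?F \<and> tcls V W \<psi> = tcls V W \<phi>" using that by blast
    from someI_ex[OF this]
    have "?L (SOME \<psi>. \<psi> \<in> carrier ?F \<and> tcls V W \<psi> = tcls V W \<phi>) = ?L \<phi>"
      using that by (intro L_eq) blast+
    then show ?thesis
      using that by (simp add: h_def tensor_carrier)
  qed
  have h_lin: "h \<in> lin K ?T Z"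
  proof (rule linI[OF module_homI])
    have rep: "\<exists>\<phi>. \<phi> \<in> carrier ?F \<and> t = tcls V W \<phi>" if "t \<in> carrier ?T" for t
      using that by (auto simp: tensor_carrier)
    show "h \<in> extensional (carrier ?T)" by (simp add: h_def)
    show "h x \<in> carrier Z" if x: "x \<in> carrier ?T" for x
    proof -
      obtain \<phi> where "\<phi> \<in> carrier ?F" "x = tcls V W \<phi>"
        using rep[OF x] by blast
      then show ?thesis by (simp add: h)
    qed
    show "h (x \<oplus>\<^bsub>?T\<^esub> y) = h x \<oplus>\<^bsub>Z\<^esub> h y" if xy: "x \<in> carrier ?T" "y \<in> carrier ?T" for x y
    proof -
      obtain \<phi> \<psi> where "\<phi> \<in> carrier ?F" "x = tcls V W \<phi>" "\<psi> \<in> carrier ?F" "y = tcls V W \<psi>"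
        using rep[OF xy(1)] rep[OF xy(2)] by blast
      then show ?thesis by (simp add: h tensor_add)
    qed
    show "h (c \<odot>\<^bsub>?T\<^esub> x) = c \<odot>\<^bsub>Z\<^esub> h x" if cx: "c \<in> carrier K" "x \<in> carrier ?T" for c x
    proof -
      obtain \<phi> where "\<phi> \<in> carrier ?F" "x = tcls V W \<phi>"
        using rep[OF cx(2)] by blast
      with cx(1) show ?thesis by (simp add: h tensor_smult)
    qed
  qed
  have h_tens: "h (tens K V W v w) = \<beta> v w" if "v \<in> carrier V" "w \<in> carrier W" for v w
    using that by (simp add: tens_eq h lext_gen)
  show ?thesis
  proof (rule ex1I[of _ h])
    fix g assume g: "g \<in> lin K ?T Z \<and> (\<forall>v\<in>carrier V. \<forall>w\<in>carrier W. g (tens K V W v w) = \<beta> v w)"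
    then have gl: "g \<in> lin K ?T Z" by blast
    show "g = h"
    proof (rule lin_eqI[OF gl h_lin])
      fix t assume t: "t \<in> carrier ?T"
      show "g t = h t"
        by (rule tensor_hom_eqI[OF linD(1)[OF gl] linD(1)[OF h_lin] V W t]) (use g h_tens in simp)
    qed
  qed (use h_lin h_tens in blast)
qed

lemma tlift:
  assumes "bilin V W Z \<beta>" "vectorspace K V" "vectorspace K W" "vectorspace K Z"
  shows "tlift K V W Z \<beta> \<in> lin K (tensor K V W) Z"
    and "v \<in> carrier V \<Longrightarrow> w \<in> carrier W \<Longrightarrow> tlift K V W Z \<beta> (tens K V W v w) = \<beta> v w"
  using theI'[OF tlift_ex1[OF assms(4,2,3,1)]] unfolding tlift_def by auto

lemma submodule_preimage:
  assumes "f \<in> module_hom K U V" "LinearCombinations.submodule K N V" "vectorspace K U" "vectorspace K V"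
  shows "LinearCombinations.submodule K {x \<in> carrier U. f x \<in> N} U"
proof (rule submoduleI)
  interpret N: LinearCombinations.submodule K N V by (rule assms(2))
  show "\<zero>\<^bsub>U\<^esub> \<in> {x \<in> carrier U. f x \<in> N}"
    using assms by (simp add: module_hom_zero[OF assms(1)])
qed (use assms in \<open>auto simp: module_homD[OF assms(1)] intro: submodule.m_closed submodule.smult_closed\<close>)

text \<open>A submodule containing the tensors of generators is tested one factor at a time: its
  preimage under tensoring with a fixed vector is a submodule containing the generators of the other
  factor.\<close>

lemma tensor_fd [simp]:
  assumes [simp]: "fd_space K V" "fd_space K W"
  shows "fd_space K (tensor K V W)"
proof -
  let ?T = "tensor K V W"
  obtain S where S: "finite S" "S \<subseteq> carrier V"
    "\<And>N. LinearCombinations.submodule K N V \<Longrightarrow> S \<subseteq> N \<Longrightarrow> carrier V \<subseteq> N"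
    using fd_spaceE[OF assms(1)] by metis
  obtain R where R: "finite R" "R \<subseteq> carrier W"
    "\<And>N. LinearCombinations.submodule K N W \<Longrightarrow> R \<subseteq> N \<Longrightarrow> carrier W \<subseteq> N"
    using fd_spaceE[OF assms(2)] by metis
  have preV: "LinearCombinations.submodule K {x \<in> carrier V. tens K V W x w \<in> N} V"
    if w: "w \<in> carrier W" and N: "LinearCombinations.submodule K N ?T" for N w
    by (rule submodule_preimage[OF tens_hom_l N]) (use w in simp_all)
  have preW: "LinearCombinations.submodule K {x \<in> carrier W. tens K V W v x \<in> N} W"
    if v: "v \<in> carrier V" and N: "LinearCombinations.submodule K N ?T" for N v
    by (rule submodule_preimage[OF tens_hom_r N]) (use v in simp_all)
  show ?thesis
  proof (rule fd_spaceI)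
    show "finite ((\<lambda>(v, w). tens K V W v w) ` (S \<times> R))" using S(1) R(1) by simp
    show "(\<lambda>(v, w). tens K V W v w) ` (S \<times> R) \<subseteq> carrier ?T" by auto
    fix N assume N: "LinearCombinations.submodule K N ?T" "(\<lambda>(v, w). tens K V W v w) ` (S \<times> R) \<subseteq> N"
    have gens: "tens K V W v w \<in> N" if "v \<in> S" "w \<in> R" for v w
      using N(2) that by blast
    have 1: "tens K V W v w \<in> N" if "v \<in> carrier V" "w \<in> R" for v w
    proof -
      have "carrier V \<subseteq> {x \<in> carrier V. tens K V W x w \<in> N}"
        by (rule S(3)[OF preV[OF _ N(1)]]) (use that S(2) R(2) gens in auto)
      then show ?thesis using that by auto
    qed
    have 2: "tens K V W v w \<in> N" if "v \<in> carrier V" "w \<in> carrier W" for v w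
    proof -
      have "carrier W \<subseteq> {x \<in> carrier W. tens K V W v x \<in> N}"
        by (rule R(3)[OF preW[OF _ N(1)]]) (use that R(2) 1 in auto)
      then show ?thesis using that by auto
    qed
    show "carrier ?T \<subseteq> N"
    proof
      fix t assume "t \<in> carrier ?T"
      then show "t \<in> N"
        using fd_space_vs[OF assms(1)] fd_space_vs[OF assms(2)]
        by (induction rule: tensor_induct) (auto intro: 2 submodule.m_closed[OF N(1)])
    qed
  qed simp
qed

end

section \<open>Copies in the universe\<close>

text \<open>The map x \<mapsto> x x - x takes the same value at zero and one. On a finite field it
  would therefore miss some c, and X X - X - c would have no root.\<close>

lemma (in algebraically_closed) infinite_carrier: "infinite (carrier L)"
proof
  assume fin: "finite (carrier L)"
  let ?f = "\<lambda>x. x \<otimes> x \<ominus> x"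
  have f: "?f ` carrier L \<subseteq> carrier L" by auto
  have "?f \<zero> = ?f \<one>" by (simp add: minus_eq r_neg)
  then have "\<not> inj_on ?f (carrier L)"
    using zero_not_one unfolding inj_on_def by blast
  then have "?f ` carrier L \<noteq> carrier L"
    using fin by (metis eq_card_imp_inj_on)
  then obtain c where c: "c \<in> carrier L" "c \<notin> ?f ` carrier L"
    using f by blast
  \<comment> \<open>Coefficients of X X - X - c, leading coefficient first.\<close>
  let ?p = "[\<one>, \<ominus> \<one>, \<ominus> c]"
  have p: "?p \<in> carrier (poly_ring L)"
    using c(1) unfolding sym[OF univ_poly_carrier] polynomial_def by auto
  then have "size (roots ?p) = 2"
    using roots_over_carrier unfolding splitted_def by simp
  then have "roots ?p \<noteq> {#}"
    by auto
  then obtain x where "x \<in># roots ?p"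
    by blast
  then have x: "x \<in> carrier L" "eval ?p x = \<zero>"
    using roots_mem_iff_is_root[OF p] unfolding is_root_def by auto
  have "x \<otimes> x \<ominus> x = c"
  proof -
    have "eval ?p x = (x \<otimes> x \<ominus> x) \<ominus> c"
      using x(1) c(1) by (simp add: numeral_2_eq_2 minus_eq l_minus a_assoc)
    then show ?thesis
      using x c(1) by (metis m_closed minus_closed r_right_minus_eq)
  qed
  then show False
    using c(2) x(1) by blast
qed

text \<open>An infinite set absorbs its square, so adding one more argument does not enlarge the set
  of functions beyond \<open>C\<close>.\<close>

lemma funcset_lepoll:
  assumes "finite S" "infinite C"
  shows "(S \<rightarrow>\<^sub>E C) \<lesssim> C"
  using assms(1)
proof (induction S)
  case empty
  obtain c where "c \<in> C" using assms(2) by (metis finite.emptyI ex_in_conv)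
  then show ?case
    by (auto simp: lepoll_def intro!: exI[of _ "\<lambda>_. c"])
next
  case (insert s S)
  have "(insert s S \<rightarrow>\<^sub>E C) \<lesssim> C \<times> (S \<rightarrow>\<^sub>E C)"
    unfolding PiE_insert_eq by (rule image_lepoll)
  also have "C \<times> (S \<rightarrow>\<^sub>E C) \<lesssim> C \<times> C"
    by (rule times_lepoll_mono[OF lepoll_refl insert.IH])
  also have "C \<times> C \<lesssim> C"
    using card_of_Times_same_infinite[OF assms(2)] by (simp add: lepoll_def card_of_ordLeq ordIso_iff_ordLeq)
  finally show ?case .
qed

context ground_field begin

text \<open>The vectors are the image of the coefficient functions on a finite basis. This bound is
  what makes room for a copy of every finite-dimensional space in the universe.\<close>

lemma fd_space_lepoll:
  assumes "fd_space K V" "infinite (carrier K)"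
  shows "carrier V \<lesssim> carrier K"
proof -
  let ?S = "some_basis V"
  let ?f = "\<lambda>a. finsum V (\<lambda>b. a b \<odot>\<^bsub>V\<^esub> b) ?S"
  have "carrier V \<subseteq> ?f ` (?S \<rightarrow>\<^sub>E carrier K)"
  proof
    fix v assume v: "v \<in> carrier V"
    have "?f (\<lambda>b\<in>?S. bcoord V b v) = ?f (\<lambda>b. bcoord V b v)"
      by (rule finsum_cong) (use assms v some_basis(3)[OF assms(1)] in auto)
    then show "v \<in> ?f ` (?S \<rightarrow>\<^sub>E carrier K)"
      using assms v by (intro image_eqI[of _ _ "\<lambda>b\<in>?S. bcoord V b v"]) (auto simp: bcoord_expand(1))
  qed
  then have "carrier V \<lesssim> (?S \<rightarrow>\<^sub>E carrier K)"
    by (rule subset_image_lepoll)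
  also have "\<dots> \<lesssim> carrier K"
    by (rule funcset_lepoll[OF some_basis(2)[OF assms(1)] assms(2)])
  finally show ?thesis .
qed

text \<open>Adding a right action to a module record changes the record type but none of the linear
  structure; this lemma moves finite dimension across that change.\<close>

lemma fd_space_cong:
  assumes V: "fd_space K V" and eq: "carrier W = carrier V" "\<zero>\<^bsub>W\<^esub> = \<zero>\<^bsub>V\<^esub>" "add W = add V" "smult W = smult V"
  shows "fd_space K W"
proof (rule fd_space_image[OF V])
  note [simp] = fd_space_vs[OF V]
  show "vectorspace K W"
  proof (rule vsI)
    show "\<exists>y\<in>carrier W. x \<oplus>\<^bsub>W\<^esub> y = \<zero>\<^bsub>W\<^esub>" if "x \<in> carrier W" for x
      using that unfolding eq by (intro bexI[of _ "\<ominus>\<^bsub>V\<^esub> x"]) (simp_all add: vs_neg)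
  qed (unfold eq, simp_all add: vs_distrib vs_add_comm vs_smult_assoc, simp add: vs_add_ac)
  show "(\<lambda>x. x) \<in> module_hom K V W" by (rule module_homI) (simp_all add: eq)
qed (simp add: eq)

end

section \<open>Injections into the universe and transport along them\<close>

lemma enc_inj: "S \<lesssim> (UNIV :: 'u set) \<Longrightarrow> inj_on (enc S :: 'v \<Rightarrow> 'u) S"
  unfolding enc_def lepoll_def using someI_ex[of "\<lambda>f :: 'v \<Rightarrow> 'u. inj_on f S"] by blast

lemma dec_enc: "inj_on (enc S :: 'v \<Rightarrow> 'u) S \<Longrightarrow> x \<in> S \<Longrightarrow> dec S (enc S x :: 'u) = x"
  by (simp add: dec_def)

lemma add_ract_simps [simp]:
  "carrier (add_ract M r) = carrier M" "\<zero>\<^bsub>add_ract M r\<^esub> = \<zero>\<^bsub>M\<^esub>" "add (add_ract M r) = add M"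
  "smult (add_ract M r) = smult M" "lact (add_ract M r) = lact M" "ract (add_ract M r) = r"
  by (simp_all add: add_ract_def lmod.defs bimod.defs)

locale setting = ground_field K for K :: "'k ring" +
  fixes A :: "('k, 'a) module"
    and B :: "('k, 'b) module"
    and G :: "(('k, 'u, 'a) lmod, 'u \<Rightarrow> 'u, ('k, 'u, 'b) lmod, 'u \<Rightarrow> 'u) fctr"
  assumes alg_closed: "algebraically_closed K"
    and fd_A: "fd_algebra K A"
    and fd_B: "fd_algebra K B"
    and univ: "carrier K \<lesssim> (UNIV :: 'u set)"
    and G: "linear_functor K A B G"
begin

text \<open>An algebraically closed field is infinite, so a finite-dimensional space is no larger
  than the field, which embeds into \<open>'u\<close>. Hence the choice in \<open>enc\<close> really
  yields an injection.\<close>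

lemma inj_enc [simp]:
  fixes V :: "('k, 'v, 'z) module_scheme"
  assumes "fd_space K V"
  shows "inj_on (enc (carrier V) :: 'v \<Rightarrow> 'u) (carrier V)"
  using fd_space_lepoll[OF assms algebraically_closed.infinite_carrier[OF alg_closed]]
    lepoll_trans[OF _ univ] by (intro enc_inj) blast

lemma dec_enc' [simp]:
  fixes V :: "('k, 'v, 'z) module_scheme"
  assumes "fd_space K V" "x \<in> carrier V"
  shows "dec (carrier V) (enc (carrier V) x :: 'u) = x"
  by (rule dec_enc[OF inj_enc]) (rule assms)+

lemma enc_eq_iff:
  fixes V :: "('k, 'v, 'z) module_scheme"
  assumes "fd_space K V" "x \<in> carrier V" "y \<in> carrier V"
  shows "(enc (carrier V) x :: 'u) = enc (carrier V) y \<longleftrightarrow> x = y"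
  using inj_enc[OF assms(1)] assms by (auto simp: inj_on_def)

lemma copy_simps:
  fixes V :: "('k, 'v, 'z) module_scheme"
  shows "carrier (copy_lmod V l :: ('k, 'u, 'c) lmod) = enc (carrier V) ` carrier V"
    "\<zero>\<^bsub>(copy_lmod V l :: ('k, 'u, 'c) lmod)\<^esub> = enc (carrier V) \<zero>\<^bsub>V\<^esub>"
  by (simp_all add: copy_lmod_def Let_def)

lemma enc_copy [simp]:
  fixes V :: "('k, 'v, 'z) module_scheme"
  assumes "x \<in> carrier V"
  shows "enc (carrier V) x \<in> carrier (copy_lmod V l :: ('k, 'u, 'c) lmod)"
  using assms by (simp add: copy_simps)

lemma copy_ops [simp]:
  fixes V :: "('k, 'v, 'z) module_scheme"
  assumes "fd_space K V" "x \<in> carrier V"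
  shows "y \<in> carrier V \<Longrightarrow> enc (carrier V) x \<oplus>\<^bsub>(copy_lmod V l :: ('k, 'u, 'c) lmod)\<^esub> enc (carrier V) y =
      enc (carrier V) (x \<oplus>\<^bsub>V\<^esub> y)"
    "c \<odot>\<^bsub>(copy_lmod V l :: ('k, 'u, 'c) lmod)\<^esub> enc (carrier V) x = enc (carrier V) (c \<odot>\<^bsub>V\<^esub> x)"
    "lact (copy_lmod V l :: ('k, 'u, 'c) lmod) b (enc (carrier V) x) = enc (carrier V) (l b x)"
  using assms by (simp_all add: copy_lmod_def Let_def tr_def)

lemma tr_enc [simp]:
  fixes V :: "('k, 'v, 'z) module_scheme"
  assumes "fd_space K V" "x \<in> carrier V"
  shows "(tr (carrier V) T h :: 'u \<Rightarrow> 'u) (enc (carrier V) x) = enc T (h x)"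
  using assms by (simp add: tr_def)

lemma copyE:
  fixes V :: "('k, 'v, 'z) module_scheme"
  assumes "y \<in> carrier (copy_lmod V l :: ('k, 'u, 'c) lmod)"
  obtains x where "x \<in> carrier V" "y = enc (carrier V) x"
  using assms by (auto simp: copy_simps)

lemma dec_closed [simp]:
  fixes V :: "('k, 'v, 'z) module_scheme"
  assumes "fd_space K V" "y \<in> carrier (copy_lmod V l :: ('k, 'u, 'c) lmod)"
  shows "dec (carrier V) y \<in> carrier V"
  using assms(2) by (rule copyE) (simp add: assms(1))

lemma enc_dec [simp]:
  fixes V :: "('k, 'v, 'z) module_scheme"
  assumes "fd_space K V" "y \<in> carrier (copy_lmod V l :: ('k, 'u, 'c) lmod)"
  shows "enc (carrier V) (dec (carrier V) y) = y"
  using assms(2) by (rule copyE) (simp add: assms(1))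

lemma copy_fd [simp]:
  fixes V :: "('k, 'v, 'z) module_scheme"
  assumes V [simp]: "fd_space K V"
  shows "fd_space K (copy_lmod V l :: ('k, 'u, 'c) lmod)"
proof (rule fd_space_image[OF V])
  let ?C = "copy_lmod V l :: ('k, 'u, 'c) lmod"
  let ?e = "enc (carrier V) :: 'v \<Rightarrow> 'u"
  have E: "\<exists>v. v \<in> carrier V \<and> x = ?e v" if "x \<in> carrier ?C" for x
    using that by (auto simp: copy_simps)
  have z: "\<zero>\<^bsub>?C\<^esub> = ?e \<zero>\<^bsub>V\<^esub>" by (rule copy_simps(2))
  show "vectorspace K ?C"
  proof (rule vsI)
    show "\<exists>y\<in>carrier ?C. x \<oplus>\<^bsub>?C\<^esub> y = \<zero>\<^bsub>?C\<^esub>" if x: "x \<in> carrier ?C" for x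
    proof -
      obtain v where "v \<in> carrier V" "x = ?e v" using E[OF x] by auto
      then show ?thesis
        by (intro bexI[of _ "?e (\<ominus>\<^bsub>V\<^esub> v)"]) (simp_all add: vs_neg z)
    qed
  qed (auto dest!: E simp: z vs_distrib vs_add_ac vs_smult_assoc)
  show "?e \<in> module_hom K V ?C" by (rule module_homI) simp_all
  show "?e ` carrier V = carrier ?C" by (simp add: copy_simps)
qed

lemma dec_hom:
  fixes V :: "('k, 'v, 'z) module_scheme"
  assumes "fd_space K V"
  shows "dec (carrier V) \<in> module_hom K (copy_lmod V l :: ('k, 'u, 'c) lmod) V"
  by (rule module_homI) (use assms in \<open>auto elim!: copyE\<close>)

section \<open>Actions, module maps and their transport to copies\<close>

lemma left_actionI:
  assumes "\<And>a. a \<in> carrier C \<Longrightarrow> l a \<in> module_hom K V V"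
    and "\<And>x. x \<in> carrier V \<Longrightarrow> l \<one>\<^bsub>C\<^esub> x = x"
    and "\<And>a x c. a \<in> carrier C \<Longrightarrow> x \<in> carrier V \<Longrightarrow> c \<in> carrier K \<Longrightarrow> l (c \<odot>\<^bsub>C\<^esub> a) x = c \<odot>\<^bsub>V\<^esub> l a x"
    and "\<And>a a' x. a \<in> carrier C \<Longrightarrow> a' \<in> carrier C \<Longrightarrow> x \<in> carrier V \<Longrightarrow>
      l (a \<oplus>\<^bsub>C\<^esub> a') x = l a x \<oplus>\<^bsub>V\<^esub> l a' x"
    and "\<And>a a' x. a \<in> carrier C \<Longrightarrow> a' \<in> carrier C \<Longrightarrow> x \<in> carrier V \<Longrightarrow> l (a \<otimes>\<^bsub>C\<^esub> a') x = l a (l a' x)"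
  shows "left_action K C V l"
  using assms by (simp add: left_action_def)

lemma left_actionD:
  assumes "left_action K C V l"
  shows "a \<in> carrier C \<Longrightarrow> l a \<in> module_hom K V V"
    and "x \<in> carrier V \<Longrightarrow> l \<one>\<^bsub>C\<^esub> x = x"
    and "a \<in> carrier C \<Longrightarrow> x \<in> carrier V \<Longrightarrow> c \<in> carrier K \<Longrightarrow> l (c \<odot>\<^bsub>C\<^esub> a) x = c \<odot>\<^bsub>V\<^esub> l a x"
    and "a \<in> carrier C \<Longrightarrow> a' \<in> carrier C \<Longrightarrow> x \<in> carrier V \<Longrightarrow>
      l (a \<oplus>\<^bsub>C\<^esub> a') x = l a x \<oplus>\<^bsub>V\<^esub> l a' x"
    and "a \<in> carrier C \<Longrightarrow> a' \<in> carrier C \<Longrightarrow> x \<in> carrier V \<Longrightarrow> l (a \<otimes>\<^bsub>C\<^esub> a') x = l a (l a' x)"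
    and "a \<in> carrier C \<Longrightarrow> x \<in> carrier V \<Longrightarrow> l a x \<in> carrier V"
  using assms by (auto simp: left_action_def module_hom_def)

lemma right_actionI:
  assumes "\<And>a. a \<in> carrier C \<Longrightarrow> r a \<in> module_hom K V V"
    and "\<And>x. x \<in> carrier V \<Longrightarrow> r \<one>\<^bsub>C\<^esub> x = x"
    and "\<And>a x c. a \<in> carrier C \<Longrightarrow> x \<in> carrier V \<Longrightarrow> c \<in> carrier K \<Longrightarrow> r (c \<odot>\<^bsub>C\<^esub> a) x = c \<odot>\<^bsub>V\<^esub> r a x"
    and "\<And>a a' x. a \<in> carrier C \<Longrightarrow> a' \<in> carrier C \<Longrightarrow> x \<in> carrier V \<Longrightarrow>
      r (a \<oplus>\<^bsub>C\<^esub> a') x = r a x \<oplus>\<^bsub>V\<^esub> r a' x"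
    and "\<And>a a' x. a \<in> carrier C \<Longrightarrow> a' \<in> carrier C \<Longrightarrow> x \<in> carrier V \<Longrightarrow> r (a \<otimes>\<^bsub>C\<^esub> a') x = r a' (r a x)"
  shows "right_action K C V r"
  using assms by (simp add: right_action_def)

lemma right_actionD:
  assumes "right_action K C V r"
  shows "a \<in> carrier C \<Longrightarrow> r a \<in> module_hom K V V"
    and "x \<in> carrier V \<Longrightarrow> r \<one>\<^bsub>C\<^esub> x = x"
    and "a \<in> carrier C \<Longrightarrow> x \<in> carrier V \<Longrightarrow> c \<in> carrier K \<Longrightarrow> r (c \<odot>\<^bsub>C\<^esub> a) x = c \<odot>\<^bsub>V\<^esub> r a x"
    and "a \<in> carrier C \<Longrightarrow> a' \<in> carrier C \<Longrightarrow> x \<in> carrier V \<Longrightarrow>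
      r (a \<oplus>\<^bsub>C\<^esub> a') x = r a x \<oplus>\<^bsub>V\<^esub> r a' x"
    and "a \<in> carrier C \<Longrightarrow> a' \<in> carrier C \<Longrightarrow> x \<in> carrier V \<Longrightarrow> r (a \<otimes>\<^bsub>C\<^esub> a') x = r a' (r a x)"
    and "a \<in> carrier C \<Longrightarrow> x \<in> carrier V \<Longrightarrow> r a x \<in> carrier V"
  using assms by (auto simp: right_action_def module_hom_def)

lemma tr_hom:
  fixes V :: "('k, 'v, 'z) module_scheme" and W :: "('k, 'w, 'y) module_scheme"
  assumes "fd_space K V" "fd_space K W" "h \<in> module_hom K V W"
  shows "tr (carrier V) (carrier W) h \<in> lin K (copy_lmod V l :: ('k, 'u, 'c) lmod) (copy_lmod W l' :: ('k, 'u, 'd) lmod)"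
proof (rule linI[OF module_homI])
  note [simp] = assms(1,2) module_homD[OF assms(3)]
  show "(tr (carrier V) (carrier W) h :: 'u \<Rightarrow> 'u) \<in> extensional (carrier (copy_lmod V l :: ('k, 'u, 'c) lmod))"
    by (simp add: tr_def copy_simps)
qed (use assms(1,2) in \<open>auto elim!: copyE simp: module_homD[OF assms(3)]\<close>)

lemma copy_left_module:
  fixes V :: "('k, 'v, 'z) module_scheme"
  assumes V [simp]: "fd_space K V" and l: "left_action K C V l"
  shows "left_module K C (copy_lmod V l :: ('k, 'u, 'c) lmod)"
  unfolding left_module_def
proof (intro conjI left_actionI)
  let ?M = "copy_lmod V l :: ('k, 'u, 'c) lmod"
  note D [simp] = left_actionD[OF l]
  show "lact ?M b \<in> module_hom K ?M ?M" if "b \<in> carrier C" for b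
    using linD(1)[OF tr_hom[OF V V D(1)[OF that]], of l l] by (simp add: copy_lmod_def Let_def)
qed (auto elim!: copyE simp: left_actionD[OF l])

lemma copy_right_action:
  fixes V :: "('k, 'v, 'z) module_scheme"
  assumes V [simp]: "fd_space K V" and r: "right_action K C V r"
  shows "right_action K C (copy_lmod V l :: ('k, 'u, 'c) lmod) (\<lambda>a. tr (carrier V) (carrier V) (r a))"
proof (rule right_actionI)
  let ?M = "copy_lmod V l :: ('k, 'u, 'c) lmod"
  note D [simp] = right_actionD[OF r]
  show "tr (carrier V) (carrier V) (r a) \<in> module_hom K ?M ?M" if "a \<in> carrier C" for a
    by (rule linD(1)[OF tr_hom[OF V V D(1)[OF that]]])
qed (auto elim!: copyE simp: right_actionD[OF r])

lemma add_ract_bimodule: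
  assumes "left_module K C M" "right_action K D M r"
    "\<And>b a x. b \<in> carrier C \<Longrightarrow> a \<in> carrier D \<Longrightarrow> x \<in> carrier M \<Longrightarrow> lact M b (r a x) = r a (lact M b x)"
  shows "bimodule K C D (add_ract M r)"
proof -
  have "fd_space K (add_ract M r)"
    by (rule fd_space_cong[of M]) (use assms in \<open>simp_all add: left_module_def\<close>)
  then show ?thesis
    using assms
    by (simp add: bimodule_def left_module_def left_action_def right_action_def module_hom_def)
qed

lemma lin_add_ract [simp]:
  "lin K (add_ract M r) N = lin K M N" "lin K M' (add_ract M r) = lin K M' M"
  by (simp_all add: lin_def module_hom_def)

lemma copy_bimodule:
  fixes V :: "('k, 'v, 'z) module_scheme"
  assumes V: "fd_space K V" and l: "left_action K C V l" and r: "right_action K D V r"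
    and lr: "\<And>b a x. b \<in> carrier C \<Longrightarrow> a \<in> carrier D \<Longrightarrow> x \<in> carrier V \<Longrightarrow> l b (r a x) = r a (l b x)"
  shows "bimodule K C D (copy_bimod V l r :: ('k, 'u, 'c, 'd) bimod)"
  unfolding copy_bimod_def
  by (rule add_ract_bimodule[OF copy_left_module[OF V l] copy_right_action[OF V r]])
    (use V in \<open>auto elim!: copyE simp: left_actionD(6)[OF l] right_actionD(6)[OF r] lr\<close>)

lemma lmod_homI:
  assumes "f \<in> lin K M N" "\<And>b x. b \<in> carrier C \<Longrightarrow> x \<in> carrier M \<Longrightarrow> f (lact M b x) = lact N b (f x)"
  shows "f \<in> lmod_hom K C M N"
  using assms by (simp add: lmod_hom_def)

lemma lmod_homD:
  assumes "f \<in> lmod_hom K C M N"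
  shows "f \<in> lin K M N" "f \<in> module_hom K M N" "x \<in> carrier M \<Longrightarrow> f x \<in> carrier N"
    "b \<in> carrier C \<Longrightarrow> x \<in> carrier M \<Longrightarrow> f (lact M b x) = lact N b (f x)"
  using assms linD(1) linD(3) by (auto simp: lmod_hom_def)

lemma tr_lmod_hom:
  fixes V :: "('k, 'v, 'z) module_scheme" and W :: "('k, 'w, 'y) module_scheme"
  assumes V: "fd_space K V" and W: "fd_space K W" and h: "h \<in> module_hom K V W"
    and l: "left_action K C V l"
    and lh: "\<And>b x. b \<in> carrier C \<Longrightarrow> x \<in> carrier V \<Longrightarrow> h (l b x) = l' b (h x)"
  shows "tr (carrier V) (carrier W) h \<in> lmod_hom K C (copy_lmod V l :: ('k, 'u, 'c) lmod) (copy_lmod W l')"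
  by (rule lmod_homI[OF tr_hom[OF V W h]])
    (use V W in \<open>auto elim!: copyE simp: module_homD(1)[OF h] left_actionD(6)[OF l] lh\<close>)

lemma bimod_homI:
  assumes "f \<in> lin K M N" "\<And>b x. b \<in> carrier C \<Longrightarrow> x \<in> carrier M \<Longrightarrow> f (lact M b x) = lact N b (f x)"
    "\<And>a x. a \<in> carrier D \<Longrightarrow> x \<in> carrier M \<Longrightarrow> f (ract M a x) = ract N a (f x)"
  shows "f \<in> bimod_hom K C D M N"
  using assms by (simp add: bimod_hom_def lmod_hom_def)

lemma bimod_homD:
  assumes "f \<in> bimod_hom K C D M N"
  shows "f \<in> lin K M N" "x \<in> carrier M \<Longrightarrow> f x \<in> carrier N"
    "b \<in> carrier C \<Longrightarrow> x \<in> carrier M \<Longrightarrow> f (lact M b x) = lact N b (f x)"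
    "a \<in> carrier D \<Longrightarrow> x \<in> carrier M \<Longrightarrow> f (ract M a x) = ract N a (f x)"
  using assms linD(3) by (auto simp: bimod_hom_def lmod_hom_def)

lemma copy_bimod_simps [simp]:
  "carrier (copy_bimod V l r) = carrier (copy_lmod V l)"
  "lact (copy_bimod V l r) = lact (copy_lmod V l)"
  "ract (copy_bimod V l r) a = tr (carrier V) (carrier V) (r a)"
  "lin K (copy_bimod V l r) N = lin K (copy_lmod V l) N"
  "lin K M (copy_bimod V l r) = lin K M (copy_lmod V l)"
  by (simp_all add: copy_bimod_def)

lemma tr_bimod_hom:
  fixes V :: "('k, 'v, 'z) module_scheme" and W :: "('k, 'w, 'y) module_scheme"
  assumes V: "fd_space K V" and W: "fd_space K W" and h: "h \<in> module_hom K V W"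
    and l: "left_action K C V l" and r: "right_action K D V r"
    and lh: "\<And>b x. b \<in> carrier C \<Longrightarrow> x \<in> carrier V \<Longrightarrow> h (l b x) = l' b (h x)"
    and rh: "\<And>a x. a \<in> carrier D \<Longrightarrow> x \<in> carrier V \<Longrightarrow> h (r a x) = r' a (h x)"
  shows "tr (carrier V) (carrier W) h \<in> bimod_hom K C D (copy_bimod V l r :: ('k, 'u, 'c, 'd) bimod) (copy_bimod W l' r')"
  by (rule bimod_homI)
    (use V W in \<open>auto elim!: copyE intro!: tr_hom h simp: module_homD(1)[OF h] left_actionD(6)[OF l] right_actionD(6)[OF r] lh rh\<close>)

lemma tr_cong:
  fixes V :: "('k, 'v, 'z) module_scheme"
  assumes "fd_space K V" "\<And>x. x \<in> carrier V \<Longrightarrow> h x = h' x"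
  shows "(tr (carrier V) T h :: 'u \<Rightarrow> 'u) = tr (carrier V) T h'"
  unfolding tr_def by (rule restrict_ext) (use assms in auto)

lemma tr_idmap:
  fixes V :: "('k, 'v, 'z) module_scheme"
  assumes "fd_space K V" "\<And>x. x \<in> carrier V \<Longrightarrow> h x = x"
  shows "tr (carrier V) (carrier V) h = idmap (copy_lmod V l :: ('k, 'u, 'c) lmod)"
  unfolding tr_def idmap_def copy_simps by (rule restrict_ext) (use assms in auto)

lemma tr_compose:
  fixes V :: "('k, 'v, 'z) module_scheme" and W :: "('k, 'w, 'y) module_scheme"
  assumes "fd_space K V" "fd_space K W" "\<And>x. x \<in> carrier V \<Longrightarrow> h x \<in> carrier W"
  shows "compose (carrier (copy_lmod V l :: ('k, 'u, 'c) lmod)) (tr (carrier W) T g) (tr (carrier V) (carrier W) h) =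
    tr (carrier V) T (\<lambda>x. g (h x))"
  unfolding compose_def copy_simps by (subst tr_def[of _ T], rule restrict_ext) (use assms in auto)

end

context ground_field begin

subsection \<open>Maps of tensor products\<close>

lemma tmap:
  assumes f: "f \<in> module_hom K V V'" and g: "g \<in> module_hom K W W'"
    and vs: "vectorspace K V" "vectorspace K W" "vectorspace K V'" "vectorspace K W'"
  shows "tmap K V W V' W' f g \<in> lin K (tensor K V W) (tensor K V' W')"
    and "v \<in> carrier V \<Longrightarrow> w \<in> carrier W \<Longrightarrow> tmap K V W V' W' f g (tens K V W v w) = tens K V' W' (f v) (g w)"
proof -
  have "bilin V W (tensor K V' W') (\<lambda>v w. tens K V' W' (f v) (g w))"
    by (rule bilinI) (use module_hom_comp[OF g tens_hom_r[OF vs(3,4)]] module_hom_comp[OF f tens_hom_l[OF vs(3,4)]]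
      module_homD(1)[OF f] module_homD(1)[OF g] in auto)
  from tlift[OF this vs(1,2) tensor_vs]
  show "tmap K V W V' W' f g \<in> lin K (tensor K V W) (tensor K V' W')"
    and "v \<in> carrier V \<Longrightarrow> w \<in> carrier W \<Longrightarrow> tmap K V W V' W' f g (tens K V W v w) = tens K V' W' (f v) (g w)"
    unfolding tmap_def by auto
qed

text \<open>The maps \<open>assoc\<close> and \<open>assoc_inv\<close> are nested lifts; the outer
  one requires the inner one to depend linearly on its parameter, which is checked on pure
  tensors.\<close>

lemma tlift_param_hom:
  assumes b: "\<And>w. w \<in> carrier W \<Longrightarrow> bilin U V Z (\<beta> w)"
    and hom: "\<And>u v. u \<in> carrier U \<Longrightarrow> v \<in> carrier V \<Longrightarrow> (\<lambda>w. \<beta> w u v) \<in> module_hom K W Z"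
    and vs [simp]: "vectorspace K U" "vectorspace K V" "vectorspace K W" "vectorspace K Z"
    and p: "p \<in> carrier (tensor K U V)"
  shows "(\<lambda>w. tlift K U V Z (\<beta> w) p) \<in> module_hom K W Z"
proof (rule module_homI)
  note t = tlift[OF b vs(1,2,4)]
  note [simp] = linD(3,4)[OF t(1)] t(2)
  show "tlift K U V Z (\<beta> x) p \<in> carrier Z" if "x \<in> carrier W" for x
    using that p by simp
  show "tlift K U V Z (\<beta> (x \<oplus>\<^bsub>W\<^esub> y)) p = tlift K U V Z (\<beta> x) p \<oplus>\<^bsub>Z\<^esub> tlift K U V Z (\<beta> y) p"
    if [simp]: "x \<in> carrier W" "y \<in> carrier W" for x y
    using p vs(1,2)
    by (induction rule: tensor_induct) (simp_all add: module_homD(2)[OF hom] vs_add_ac)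
  show "tlift K U V Z (\<beta> (c \<odot>\<^bsub>W\<^esub> x)) p = c \<odot>\<^bsub>Z\<^esub> tlift K U V Z (\<beta> x) p"
    if [simp]: "c \<in> carrier K" "x \<in> carrier W" for c x
    using p vs(1,2)
    by (induction rule: tensor_induct) (simp_all add: module_homD(3)[OF hom] vs_distrib)
qed

text \<open>The evaluations \<open>V \<otimes> W\<^sup>* \<rightarrow> V\<close> at the points of \<open>W\<close> stand in for the isomorphism
  \<open>V \<otimes> W\<^sup>* \<cong> Hom(W, V)\<close>.\<close>

definition contr :: "('k, 'v, 'y) module_scheme \<Rightarrow> ('k, 'w, 'z) module_scheme \<Rightarrow> 'w \<Rightarrow>
    ('v \<times> ('w \<Rightarrow> 'k) \<Rightarrow> 'k) set \<Rightarrow> 'v" where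
  "contr V W x = tlift K V (dual K W) V (\<lambda>y \<phi>. \<phi> x \<odot>\<^bsub>V\<^esub> y)"

context
  fixes V :: "('k, 'v, 'y) module_scheme" and W :: "('k, 'w, 'z) module_scheme"
  assumes V [simp]: "vectorspace K V" and W [simp]: "vectorspace K W"
begin

lemma contr_lin: "x \<in> carrier W \<Longrightarrow> contr V W x \<in> lin K (tensor K V (dual K W)) V"
  and contr_tens [simp]: "x \<in> carrier W \<Longrightarrow> y \<in> carrier V \<Longrightarrow> \<phi> \<in> lin K W (base_space K) \<Longrightarrow>
    contr V W x (tens K V (dual K W) y \<phi>) = \<phi> x \<odot>\<^bsub>V\<^esub> y"
proof -
  assume x: "x \<in> carrier W"
  note cl [simp] = dual_closed[OF _ x]
  have b: "bilin V (dual K W) V (\<lambda>y \<phi>. \<phi> x \<odot>\<^bsub>V\<^esub> y)"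
    by (rule bilinI; rule module_homI)
      (use x in \<open>simp_all add: vs_distrib vs_smult_assoc vs_smult_lcomm\<close>)
  show "contr V W x \<in> lin K (tensor K V (dual K W)) V"
    unfolding contr_def by (rule tlift(1)[OF b]) simp_all
  show "contr V W x (tens K V (dual K W) y \<phi>) = \<phi> x \<odot>\<^bsub>V\<^esub> y"
    if "y \<in> carrier V" "\<phi> \<in> lin K W (base_space K)"
    unfolding contr_def by (rule tlift(2)[OF b]) (use that in simp_all)
qed

lemma contr_simps [simp]:
  assumes "x \<in> carrier W" "t \<in> carrier (tensor K V (dual K W))"
  shows "contr V W x t \<in> carrier V"
    and "u \<in> carrier (tensor K V (dual K W)) \<Longrightarrow>
      contr V W x (t \<oplus>\<^bsub>tensor K V (dual K W)\<^esub> u) = contr V W x t \<oplus>\<^bsub>V\<^esub> contr V W x u"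
    and "c \<in> carrier K \<Longrightarrow> contr V W x (c \<odot>\<^bsub>tensor K V (dual K W)\<^esub> t) = c \<odot>\<^bsub>V\<^esub> contr V W x t"
  using linD[OF contr_lin[OF assms(1)]] assms(2) by auto

text \<open>Linearity in the point of evaluation, together with \<open>contr_smult\<close>. It turns
  linearity of the action on \<open>n\<close> in the algebra element into the same property of the
  dual action on the right factor.\<close>

lemma contr_add:
  assumes "t \<in> carrier (tensor K V (dual K W))" "x \<in> carrier W" "y \<in> carrier W"
  shows "contr V W (x \<oplus>\<^bsub>W\<^esub> y) t = contr V W x t \<oplus>\<^bsub>V\<^esub> contr V W y t"
  using assms(1) V dual_vs[OF W]
proof (induction rule: tensor_induct)
  case (tens v \<phi>)
  then show ?case
    using assms(2,3) by (simp add: linD(4) dual_closed vs_distrib)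
next
  case (add t u)
  then show ?case
    using assms(2,3) by (simp add: vs_add_ac)
qed

lemma contr_smult:
  assumes "t \<in> carrier (tensor K V (dual K W))" "x \<in> carrier W" "c \<in> carrier K"
  shows "contr V W (c \<odot>\<^bsub>W\<^esub> x) t = c \<odot>\<^bsub>V\<^esub> contr V W x t"
  using assms(1) V dual_vs[OF W]
proof (induction rule: tensor_induct)
  case (tens v \<phi>)
  then show ?case
    using assms(2,3) by (simp add: linD(5) dual_closed vs_smult_assoc)
next
  case (add t u)
  then show ?case
    using assms(2,3) by (simp add: vs_distrib)
qed

end

text \<open>If \<open>g\<close> is the transpose of a map sending \<open>x\<close> to
  \<open>x'\<close>, then in terms of Hom(W, V) the map induced by \<open>f\<close> and
  \<open>g\<close> is composition on both sides. The transpose is assumed only at the point in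
  question.\<close>

lemma contr_tmap:
  assumes t: "t \<in> carrier (tensor K V (dual K W))"
    and f: "f \<in> module_hom K V V'" and g: "g \<in> module_hom K (dual K W) (dual K W')"
    and vs [simp]: "vectorspace K V" "vectorspace K W" "vectorspace K V'" "vectorspace K W'"
    and x: "x \<in> carrier W'" "x' \<in> carrier W"
    and gx: "\<And>\<phi>. \<phi> \<in> lin K W (base_space K) \<Longrightarrow> g \<phi> x = \<phi> x'"
  shows "contr V' W' x (tmap K V (dual K W) V' (dual K W') f g t) = f (contr V W x' t)"
proof -
  note tm = tmap[OF f g vs(1) dual_vs[OF vs(2)] vs(3) dual_vs[OF vs(4)]]
  note tl = linD(3,4)[OF tm(1)]
  note [simp] = x module_homD[OF f]
  show ?thesis
    using t vs(1) dual_vs[OF vs(2)]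
  proof (induction rule: tensor_induct)
    case (tens v \<phi>)
    then have "g \<phi> \<in> lin K W' (base_space K)" "\<phi> \<in> lin K W (base_space K)"
      using module_homD(1)[OF g] by auto
    then show ?case
      using tens dual_closed[of \<phi> W x'] by (simp add: tm(2) gx)
  next
    case (add t u)
    then show ?case by (simp add: tl)
  qed
qed

text \<open>A tensor is the sum over a basis of its evaluation at \<open>b\<close> tensored with the
  dual vector of \<open>b\<close>. On a pure tensor the scalars \<open>\<phi> b\<close> move to the
  right factor, where they assemble to \<open>\<phi>\<close>.\<close>

lemma contr_expand:
  assumes [simp]: "vectorspace K V" and W [simp]: "fd_space K W" and t: "t \<in> carrier (tensor K V (dual K W))"
  shows "finsum (tensor K V (dual K W)) (\<lambda>b. tens K V (dual K W) (contr V W b t) (bcoord W b)) (some_basis W) = t"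
proof -
  let ?T = "tensor K V (dual K W)"
  note [simp] = set_mp[OF some_basis(3)[OF W]]
  show ?thesis
    using t assms(1) dual_vs[OF fd_space_vs[OF W]]
  proof (induction rule: tensor_induct)
    case (tens v \<phi>)
    then have \<phi>: "\<phi> \<in> lin K W (base_space K)" by simp
    note [simp] = dual_closed[OF \<phi>]
    have hom_l: "tens K V (dual K W) v \<in> module_hom K (dual K W) ?T"
      by (rule tens_hom_r) (use tens in simp_all)
    have "finsum ?T (\<lambda>b. tens K V (dual K W) (contr V W b (tens K V (dual K W) v \<phi>)) (bcoord W b)) (some_basis W) =
        finsum ?T (\<lambda>b. tens K V (dual K W) v (\<phi> b \<odot>\<^bsub>dual K W\<^esub> bcoord W b)) (some_basis W)"
    proof (rule finsum_cong)
      fix b assume b: "b \<in> some_basis W"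
      show "tens K V (dual K W) (contr V W b (tens K V (dual K W) v \<phi>)) (bcoord W b) =
          tens K V (dual K W) v (\<phi> b \<odot>\<^bsub>dual K W\<^esub> bcoord W b)"
        using tens \<phi> b module_homD(3)[OF hom_l, of "\<phi> b" "bcoord W b"]
          module_homD(3)[OF tens_hom_l, of V "dual K W" "bcoord W b" "\<phi> b" v] by simp
    qed simp_all
    also have "\<dots> = tens K V (dual K W) v (finsum (dual K W) (\<lambda>b. \<phi> b \<odot>\<^bsub>dual K W\<^esub> bcoord W b) (some_basis W))"
      by (rule module_hom_finsum[OF hom_l, symmetric]) simp_all
    also have "\<dots> = tens K V (dual K W) v \<phi>"
      by (simp add: dual_expand[OF W \<phi>])
    finally show ?case .
  next
    case (add t u)
    have "finsum ?T (\<lambda>b. tens K V (dual K W) (contr V W b (t \<oplus>\<^bsub>?T\<^esub> u)) (bcoord W b)) (some_basis W) =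
      finsum ?T (\<lambda>b. tens K V (dual K W) (contr V W b t) (bcoord W b) \<oplus>\<^bsub>?T\<^esub>
        tens K V (dual K W) (contr V W b u) (bcoord W b)) (some_basis W)"
    proof (rule finsum_cong)
      fix b assume b: "b \<in> some_basis W"
      show "tens K V (dual K W) (contr V W b (t \<oplus>\<^bsub>?T\<^esub> u)) (bcoord W b) =
          tens K V (dual K W) (contr V W b t) (bcoord W b) \<oplus>\<^bsub>?T\<^esub> tens K V (dual K W) (contr V W b u) (bcoord W b)"
        using add b module_homD(2)[OF tens_hom_l, of V "dual K W" "bcoord W b" "contr V W b t" "contr V W b u"]
        by simp
    qed simp_all
    also have "\<dots> = t \<oplus>\<^bsub>?T\<^esub> u"
      using add by (subst finsum_addf) simp_all
    finally show ?case .
  qed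
qed

text \<open>Injectivity of the map from V \<otimes> W* to Hom(W, V), by reconstruction from the
  values on a basis.\<close>

lemma contr_eqI:
  assumes "vectorspace K V" "fd_space K W" "t \<in> carrier (tensor K V (dual K W))" "u \<in> carrier (tensor K V (dual K W))"
    and "\<And>x. x \<in> carrier W \<Longrightarrow> contr V W x t = contr V W x u"
  shows "t = u"
proof -
  have "finsum (tensor K V (dual K W)) (\<lambda>b. tens K V (dual K W) (contr V W b t) (bcoord W b)) (some_basis W) =
      finsum (tensor K V (dual K W)) (\<lambda>b. tens K V (dual K W) (contr V W b u) (bcoord W b)) (some_basis W)"
    by (rule finsum_cong) (use assms some_basis(3)[OF assms(2)] in auto)
  then show ?thesis
    using contr_expand[OF assms(1,2,3)] contr_expand[OF assms(1,2,4)] by simp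
qed

end

section \<open>Opposite, product and bimodule categories\<close>

lemma opp_cat_category: "is_category C \<Longrightarrow> is_category (opp_cat C)"
  unfolding is_category_def opp_cat_def by simp

lemma prod_cat_category:
  assumes "is_category C" "is_category D"
  shows "is_category (prod_cat C D)"
  using assms unfolding is_category_def prod_cat_def by (simp add: mem_Times_iff)

context setting begin

lemma left_module_fd: "left_module K C M \<Longrightarrow> fd_space K M"
  by (simp add: left_module_def)

lemmas left_module_fd_A [simp] = left_module_fd[where C = A]
lemmas left_module_fd_B [simp] = left_module_fd[where C = B]

lemma left_module_action: "left_module K C M \<Longrightarrow> left_action K C M (lact M)"
  by (simp add: left_module_def)

lemmas lactD = left_actionD[OF left_module_action]

lemma bimodule_left: "bimodule K C D M \<Longrightarrow> left_module K C M"
  by (simp add: bimodule_def)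

lemma lmod_hom_eqI:
  assumes "f \<in> lmod_hom K C M N" "g \<in> lmod_hom K C M N" "\<And>x. x \<in> carrier M \<Longrightarrow> f x = g x"
  shows "f = g"
  by (rule lin_eqI[OF lmod_homD(1)[OF assms(1)] lmod_homD(1)[OF assms(2)] assms(3)])

lemma compose_lin:
  assumes "vectorspace K M" "f \<in> lin K M N" "g \<in> lin K N L"
  shows "compose (carrier M) g f \<in> lin K M L"
  unfolding compose_def by (rule lin_restrict[OF assms(1) module_hom_comp[OF linD(1)[OF assms(2)] linD(1)[OF assms(3)]]])

lemma bimod_cat_category: "is_category (bimod_cat K C D :: (('k, 'u, 'c, 'd) bimod, 'u \<Rightarrow> 'u) cat)"
proof -
  have bm: "vectorspace K P"
      "\<And>b x. b \<in> carrier C \<Longrightarrow> x \<in> carrier P \<Longrightarrow> lact P b x \<in> carrier P"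
      "\<And>a x. a \<in> carrier D \<Longrightarrow> x \<in> carrier P \<Longrightarrow> ract P a x \<in> carrier P"
    if "bimodule K C D P" for P :: "('k, 'u, 'c, 'd) bimod"
    using that left_module_fd[OF bimodule_left[OF that]] lactD(6)[OF bimodule_left[OF that]] right_actionD(6)[of D P "ract P"]
    by (auto simp: bimodule_def)
  have id: "idmap P \<in> bimod_hom K C D P P" if "bimodule K C D P" for P :: "('k, 'u, 'c, 'd) bimod"
    by (rule bimod_homI) (simp_all add: idmap_lin bm[OF that])
  have comp: "compose (carrier P) g f \<in> bimod_hom K C D P R"
    if "bimodule K C D P" "f \<in> bimod_hom K C D P Q" "g \<in> bimod_hom K C D Q R"
    for P Q R :: "('k, 'u, 'c, 'd) bimod" and f g
    by (rule bimod_homI[OF compose_lin[OF _ bimod_homD(1)[OF that(2)] bimod_homD(1)[OF that(3)]]])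
      (simp_all add: bm[OF that(1)] compose_eq bimod_homD(2-)[OF that(2)] bimod_homD(2-)[OF that(3)])
  have ext: "f \<in> extensional (carrier P)" "x \<in> carrier P \<Longrightarrow> f x \<in> carrier Q"
    if "f \<in> bimod_hom K C D P Q" for P Q :: "('k, 'u, 'c, 'd) bimod" and f :: "'u \<Rightarrow> 'u" and x
    using linD(2)[OF bimod_homD(1)[OF that]] bimod_homD(2)[OF that] by auto
  show ?thesis
    unfolding is_category_def bimod_cat_def cat.simps mem_Collect_eq
  proof (intro conjI ballI)
    fix x y :: "('k, 'u, 'c, 'd) bimod" and f :: "'u \<Rightarrow> 'u"
    assume "x \<in> Collect (bimodule K C D)" "f \<in> bimod_hom K C D x y"
    then show "compose (carrier x) f (idmap x) = f" "compose (carrier x) (idmap y) f = f"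
      using ext[of f x y] by (auto simp: compose_def fun_eq_iff extensional_def idmap_def)
  next
    fix w x y z :: "('k, 'u, 'c, 'd) bimod" and f g h :: "'u \<Rightarrow> 'u"
    assume "f \<in> bimod_hom K C D w x"
    then show "compose (carrier w) (compose (carrier x) h g) f = compose (carrier w) h (compose (carrier w) g f)"
      using ext(2)[of f w x] by (auto simp: compose_def fun_eq_iff)
  qed (use id comp in simp_all)
qed

section \<open>Functoriality and linearity of \<open>G\<close> on elements\<close>

lemma G_functor: "is_functor (lmod_cat K A) (lmod_cat K B) G"
  using G by (simp add: linear_functor_def)

lemma G_ob [simp]: "left_module K A M \<Longrightarrow> left_module K B (fob G M)"
  using G_functor by (simp add: is_functor_def lmod_cat_def)

lemma G_hom:
  "left_module K A M \<Longrightarrow> left_module K A N \<Longrightarrow> f \<in> lmod_hom K A M N \<Longrightarrow>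
    farr G M N f \<in> lmod_hom K B (fob G M) (fob G N)"
  using G_functor by (simp add: is_functor_def lmod_cat_def)

lemma G_id: "left_module K A M \<Longrightarrow> farr G M M (idmap M) = idmap (fob G M)"
  using G_functor by (simp add: is_functor_def lmod_cat_def)

lemma G_comp:
  "left_module K A L \<Longrightarrow> left_module K A M \<Longrightarrow> left_module K A N \<Longrightarrow>
    f \<in> lmod_hom K A L M \<Longrightarrow> g \<in> lmod_hom K A M N \<Longrightarrow>
    farr G L N (compose (carrier L) g f) = compose (carrier (fob G L)) (farr G M N g) (farr G L M f)"
  using G_functor by (simp add: is_functor_def lmod_cat_def)

text \<open>The composite may be given as any morphism \<open>h\<close> that agrees with it
  pointwise, since extensional maps that agree are equal. \<open>G_add\<close> and
  \<open>G_smult\<close> treat linear combinations in the same way.\<close>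

lemma G_comp_apply:
  assumes "left_module K A L" "left_module K A M" "left_module K A N"
    "f \<in> lmod_hom K A L M" "g \<in> lmod_hom K A M N" "h \<in> lmod_hom K A L N"
    and "\<And>x. x \<in> carrier L \<Longrightarrow> g (f x) = h x" and "y \<in> carrier (fob G L)"
  shows "farr G M N g (farr G L M f y) = farr G L N h y"
proof -
  have "compose (carrier L) g f = h"
    using linD(2)[OF lmod_homD(1)[OF assms(6)]] assms(7) by (auto simp: compose_def fun_eq_iff extensional_def)
  with G_comp[OF assms(1-5)]
  have "farr G L N h = compose (carrier (fob G L)) (farr G M N g) (farr G L M f)"
    by simp
  with assms(8) show ?thesis
    by (simp add: compose_eq)
qed

lemma G_add:
  assumes "left_module K A M" "left_module K A N" "f \<in> lmod_hom K A M N" "g \<in> lmod_hom K A M N"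
    and "h \<in> lmod_hom K A M N" "\<And>x. x \<in> carrier M \<Longrightarrow> h x = f x \<oplus>\<^bsub>N\<^esub> g x" "y \<in> carrier (fob G M)"
  shows "farr G M N h y = farr G M N f y \<oplus>\<^bsub>fob G N\<^esub> farr G M N g y"
proof -
  have "h = f \<oplus>\<^bsub>hom_space K M N\<^esub> g"
    using linD(2)[OF lmod_homD(1)[OF assms(5)]] assms(6)
    by (auto simp: hom_space_simps fun_eq_iff extensional_def)
  moreover have "farr G M N (f \<oplus>\<^bsub>hom_space K M N\<^esub> g) =
      farr G M N f \<oplus>\<^bsub>hom_space K (fob G M) (fob G N)\<^esub> farr G M N g"
    using G assms(1-4) unfolding linear_functor_def by blast
  ultimately show ?thesis
    using assms(7) by (simp add: hom_space_simps(3))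
qed

lemma G_smult:
  assumes "left_module K A M" "left_module K A N" "f \<in> lmod_hom K A M N" "c \<in> carrier K"
    and "h \<in> lmod_hom K A M N" "\<And>x. x \<in> carrier M \<Longrightarrow> h x = c \<odot>\<^bsub>N\<^esub> f x" "y \<in> carrier (fob G M)"
  shows "farr G M N h y = c \<odot>\<^bsub>fob G N\<^esub> farr G M N f y"
proof -
  have "h = c \<odot>\<^bsub>hom_space K M N\<^esub> f"
    using linD(2)[OF lmod_homD(1)[OF assms(5)]] assms(6)
    by (auto simp: hom_space_simps fun_eq_iff extensional_def)
  moreover have "farr G M N (c \<odot>\<^bsub>hom_space K M N\<^esub> f) =
      c \<odot>\<^bsub>hom_space K (fob G M) (fob G N)\<^esub> farr G M N f"
    using G assms(1-4) unfolding linear_functor_def by blast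
  ultimately show ?thesis
    using assms(7) by (simp add: hom_space_simps(4))
qed

text \<open>Action on the left tensor factor. One formula serves both m \<otimes> m* over
  \<open>A\<close> and G(m) \<otimes> n* over \<open>B\<close>.\<close>

definition tact where
  "tact M n b = tmap K M (dual K n) M (dual K n) (lact M b) (idmap (dual K n))"

lemma fd_algebra_closed:
  assumes "fd_algebra K C"
  shows "\<one>\<^bsub>C\<^esub> \<in> carrier C" "c \<in> carrier K \<Longrightarrow> a \<in> carrier C \<Longrightarrow> c \<odot>\<^bsub>C\<^esub> a \<in> carrier C"
    "a \<in> carrier C \<Longrightarrow> a' \<in> carrier C \<Longrightarrow> a \<oplus>\<^bsub>C\<^esub> a' \<in> carrier C"
    "a \<in> carrier C \<Longrightarrow> a' \<in> carrier C \<Longrightarrow> a \<otimes>\<^bsub>C\<^esub> a' \<in> carrier C"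
  using assms by (auto simp: fd_algebra_def ring.ring_simprules)

lemmas A_closed [simp] = fd_algebra_closed[OF fd_A]

context
  fixes M :: "('k, 'v, 'c) lmod" and C :: "('k, 'c) module" and n :: "('k, 'w, 'z) module_scheme"
  assumes C: "fd_algebra K C" and M: "left_module K C M" and n [simp]: "fd_space K n"
begin

private lemma fd_M [simp]: "fd_space K M" by (rule left_module_fd[OF M])

lemma tact_hom: "b \<in> carrier C \<Longrightarrow> tact M n b \<in> module_hom K (tensor K M (dual K n)) (tensor K M (dual K n))"
  unfolding tact_def by (rule linD(1)[OF tmap(1)[OF lactD(1)[OF M] idmap_hom]]) simp_all

lemmas tact_closed = module_homD(1)[OF tact_hom]

lemma contr_tact:
  assumes "t \<in> carrier (tensor K M (dual K n))" "x \<in> carrier n" "b \<in> carrier C"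
  shows "contr M n x (tact M n b t) = lact M b (contr M n x t)"
  unfolding tact_def
  by (rule contr_tmap[OF assms(1) lactD(1)[OF M assms(3)] idmap_hom]) (use assms in simp_all)

lemma tact_tens:
  assumes "v \<in> carrier M" "\<phi> \<in> lin K n (base_space K)" "b \<in> carrier C"
  shows "tact M n b (tens K M (dual K n) v \<phi>) = tens K M (dual K n) (lact M b v) \<phi>"
  unfolding tact_def using assms by (subst tmap(2)[OF lactD(1)[OF M] idmap_hom]) simp_all

text \<open>After evaluation at a point of \<open>n\<close> each axiom becomes the corresponding
  axiom of \<open>M\<close>.\<close>

lemma tact_left_action: "left_action K C (tensor K M (dual K n)) (tact M n)"
proof (rule left_actionI)
  let ?T = "tensor K M (dual K n)"
  note [simp] = fd_algebra_closed[OF C] tact_closed contr_tact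
  note D = lactD[OF M]
  note eqI = contr_eqI[OF fd_space_vs[OF fd_M] n]
  show "tact M n \<one>\<^bsub>C\<^esub> t = t" if "t \<in> carrier ?T" for t
    by (rule eqI) (use that in \<open>simp_all add: D\<close>)
  show "tact M n (c \<odot>\<^bsub>C\<^esub> b) t = c \<odot>\<^bsub>?T\<^esub> tact M n b t"
    if "b \<in> carrier C" "t \<in> carrier ?T" "c \<in> carrier K" for b t c
    by (rule eqI) (use that in \<open>simp_all add: D\<close>)
  show "tact M n (b \<oplus>\<^bsub>C\<^esub> b') t = tact M n b t \<oplus>\<^bsub>?T\<^esub> tact M n b' t"
    if "b \<in> carrier C" "b' \<in> carrier C" "t \<in> carrier ?T" for b b' t
    by (rule eqI) (use that in \<open>simp_all add: D\<close>)
  show "tact M n (b \<otimes>\<^bsub>C\<^esub> b') t = tact M n b (tact M n b' t)"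
    if "b \<in> carrier C" "b' \<in> carrier C" "t \<in> carrier ?T" for b b' t
    by (rule eqI) (use that in \<open>simp_all add: D\<close>)
qed (rule tact_hom)

end

subsection \<open>The functor \<open>(m, n) \<mapsto> G(m) \<otimes> n\<^sup>*\<close>\<close>

abbreviation T :: "('k, 'u, 'a) lmod \<Rightarrow> ('k, 'u, 'a) lmod \<Rightarrow> ('k, ('u \<times> ('u \<Rightarrow> 'k) \<Rightarrow> 'k) set) module" where
  "T m n \<equiv> Gt_space K G m n"

abbreviation Lact where
  "Lact m n \<equiv> tact (fob G m) n"

definition Ract where
  "Ract m n a = tmap K (fob G m) (dual K n) (fob G m) (dual K n) (idmap (fob G m)) (dual_map n (lact n a))"

abbreviation Tmap where
  "Tmap m n m' n' f g \<equiv> tmap K (fob G m) (dual K n) (fob G m') (dual K n') (farr G m m' f) (dual_map n' g)"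

lemma Gtilde_ob: "fob (Gtilde K G) (m, n) = copy_bimod (T m n) (Lact m n) (Ract m n)"
  by (simp add: Gtilde_def tact_def[abs_def] Ract_def[abs_def])

lemma Gtilde_arr:
  "farr (Gtilde K G) (m, n) (m', n') (f, g) = tr (carrier (T m n)) (carrier (T m' n')) (Tmap m n m' n' f g)"
  by (simp add: Gtilde_def)

lemma T_fd [simp]: "left_module K A m \<Longrightarrow> left_module K A n \<Longrightarrow> fd_space K (T m n)"
  by simp

context
  fixes m n :: "('k, 'u, 'a) lmod"
  assumes m [simp]: "left_module K A m" and n [simp]: "left_module K A n"
begin

lemma T_eqI:
  assumes "t \<in> carrier (T m n)" "u \<in> carrier (T m n)"
    "\<And>x. x \<in> carrier n \<Longrightarrow> contr (fob G m) n x t = contr (fob G m) n x u"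
  shows "t = u"
  by (rule contr_eqI[OF _ _ assms]) simp_all

lemma Ract_hom: "a \<in> carrier A \<Longrightarrow> Ract m n a \<in> module_hom K (T m n) (T m n)"
  unfolding Ract_def by (rule linD(1)[OF tmap(1)[OF idmap_hom dual_map_hom[OF _ _ lactD(1)[OF n]]]]) simp_all

text \<open>The right action on n* is the transpose of the left action on \<open>n\<close>, so it
  acts on the point of evaluation. The reversal of order under transposition is what makes it a
  right action.\<close>

lemma contr_Ract [simp]:
  assumes "t \<in> carrier (T m n)" "x \<in> carrier n" "a \<in> carrier A"
  shows "contr (fob G m) n x (Ract m n a t) = contr (fob G m) n (lact n a x) t"
proof -
  have "contr (fob G m) n x (Ract m n a t) = idmap (fob G m) (contr (fob G m) n (lact n a x) t)"
    unfolding Ract_def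
    by (rule contr_tmap[OF assms(1) idmap_hom dual_map_hom[OF _ _ lactD(1)[OF n assms(3)]]])
      (use assms lactD(6)[OF n] in simp_all)
  then show ?thesis
    using assms lactD(6)[OF n] by simp
qed

lemmas contr_Lact [simp] = contr_tact[OF fd_B G_ob[OF m] left_module_fd_A[OF n]]
lemmas Lact_closed [simp] = tact_closed[OF fd_B G_ob[OF m] left_module_fd_A[OF n]]
lemmas Lact_left_action = tact_left_action[OF fd_B G_ob[OF m] left_module_fd_A[OF n]]
lemmas Ract_closed [simp] = module_homD(1)[OF Ract_hom]

lemma Ract_right_action: "right_action K A (T m n) (Ract m n)"
proof (rule right_actionI)
  note D = lactD[OF n]
  show "Ract m n \<one>\<^bsub>A\<^esub> t = t" if "t \<in> carrier (T m n)" for t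
    by (rule T_eqI) (use that in \<open>simp_all add: D\<close>)
  show "Ract m n (c \<odot>\<^bsub>A\<^esub> b) t = c \<odot>\<^bsub>T m n\<^esub> Ract m n b t"
    if "b \<in> carrier A" "t \<in> carrier (T m n)" "c \<in> carrier K" for b t c
    by (rule T_eqI) (use that in \<open>simp_all add: D contr_smult\<close>)
  show "Ract m n (b \<oplus>\<^bsub>A\<^esub> b') t = Ract m n b t \<oplus>\<^bsub>T m n\<^esub> Ract m n b' t"
    if "b \<in> carrier A" "b' \<in> carrier A" "t \<in> carrier (T m n)" for b b' t
    by (rule T_eqI) (use that in \<open>simp_all add: D contr_add\<close>)
  show "Ract m n (b \<otimes>\<^bsub>A\<^esub> b') t = Ract m n b' (Ract m n b t)"
    if "b \<in> carrier A" "b' \<in> carrier A" "t \<in> carrier (T m n)" for b b' t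
    by (rule T_eqI) (use that in \<open>simp_all add: D\<close>)
qed (rule Ract_hom)

lemma Lact_Ract:
  assumes "b \<in> carrier B" "a \<in> carrier A" "t \<in> carrier (T m n)"
  shows "Lact m n b (Ract m n a t) = Ract m n a (Lact m n b t)"
  by (rule T_eqI) (use assms in \<open>simp_all add: lactD[OF n]\<close>)

lemma Gtilde_bimodule: "bimodule K B A (fob (Gtilde K G) (m, n))"
  unfolding Gtilde_ob
  by (rule copy_bimodule[OF T_fd[OF m n] Lact_left_action Ract_right_action Lact_Ract])

end

context
  fixes m n m' n' :: "('k, 'u, 'a) lmod" and f g
  assumes m [simp]: "left_module K A m" and n [simp]: "left_module K A n"
    and m' [simp]: "left_module K A m'" and n' [simp]: "left_module K A n'"
    and f: "f \<in> lmod_hom K A m m'" and g: "g \<in> lmod_hom K A n' n"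
begin

lemma Tmap_hom: "Tmap m n m' n' f g \<in> module_hom K (T m n) (T m' n')"
  by (rule linD(1)[OF tmap(1)[OF lmod_homD(2)[OF G_hom[OF m m' f]] dual_map_hom[OF _ _ lmod_homD(2)[OF g]]]]) simp_all

lemmas Tmap_closed = module_homD(1)[OF Tmap_hom]

lemma Tmap_tens:
  assumes "y \<in> carrier (fob G m)" "\<phi> \<in> lin K n (base_space K)"
  shows "Tmap m n m' n' f g (tens K (fob G m) (dual K n) y \<phi>) =
    tens K (fob G m') (dual K n') (farr G m m' f y) (dual_map n' g \<phi>)"
  by (rule tmap(2)[OF lmod_homD(2)[OF G_hom[OF m m' f]] dual_map_hom[OF _ _ lmod_homD(2)[OF g]]])
    (use assms in simp_all)

text \<open>With a tensor read as a map t from \<open>n\<close> to G(m), the induced map is t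
  \<mapsto> G(f) t g.\<close>

lemma contr_Tmap:
  assumes "t \<in> carrier (T m n)" "x \<in> carrier n'"
  shows "contr (fob G m') n' x (Tmap m n m' n' f g t) = farr G m m' f (contr (fob G m) n (g x) t)"
  by (rule contr_tmap[OF assms(1) lmod_homD(2)[OF G_hom[OF m m' f]] dual_map_hom[OF _ _ lmod_homD(2)[OF g]]])
    (use assms lmod_homD(3)[OF g] in simp_all)

lemma Tmap_bimod_hom:
  "farr (Gtilde K G) (m, n) (m', n') (f, g) \<in> bimod_hom K B A (fob (Gtilde K G) (m, n)) (fob (Gtilde K G) (m', n'))"
  unfolding Gtilde_ob Gtilde_arr
proof (rule tr_bimod_hom[OF _ _ Tmap_hom Lact_left_action[OF m n] Ract_right_action[OF m n]])
  note [simp] = contr_Tmap Tmap_closed lmod_homD(3,4)[OF g] lmod_homD(4)[OF G_hom[OF m m' f]]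
    lactD(6)[OF n] lactD(6)[OF n']
  show "Tmap m n m' n' f g (Lact m n b t) = Lact m' n' b (Tmap m n m' n' f g t)"
    if "b \<in> carrier B" "t \<in> carrier (T m n)" for b t
    by (rule T_eqI[OF m' n']) (use that in simp_all)
  show "Tmap m n m' n' f g (Ract m n b t) = Ract m' n' b (Tmap m n m' n' f g t)"
    if "b \<in> carrier A" "t \<in> carrier (T m n)" for b t
    by (rule T_eqI[OF m' n']) (use that in simp_all)
qed simp_all

end

lemma idmap_lmod_hom: "left_module K C M \<Longrightarrow> idmap M \<in> lmod_hom K C M M"
  using left_module_fd[of C M] by (intro lmod_homI) (simp_all add: idmap_lin lactD(6))

lemma compose_lmod_hom:
  assumes "left_module K C L" "f \<in> lmod_hom K C L M" "g \<in> lmod_hom K C M N"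
  shows "compose (carrier L) g f \<in> lmod_hom K C L N"
  by (rule lmod_homI[OF compose_lin[OF _ lmod_homD(1)[OF assms(2)] lmod_homD(1)[OF assms(3)]]])
    (use assms(1) left_module_fd[OF assms(1)] in \<open>simp_all add: compose_eq lactD(6)[OF assms(1)] lmod_homD(3,4)[OF assms(2)] lmod_homD(3,4)[OF assms(3)]\<close>)

text \<open>Since tensors are separated by evaluations, where the first argument acts through
  \<open>G\<close> and the second by moving the point, both functor laws reduce to those of
  \<open>G\<close>.\<close>

lemma Gtilde_functor:
  "is_functor (prod_cat (lmod_cat K A) (opp_cat (lmod_cat K A))) (bimod_cat K B A) (Gtilde K G)"
proof -
  have cat: "is_category (lmod_cat K A :: (('k, 'u, 'a) lmod, 'u \<Rightarrow> 'u) cat)"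
    using G_functor by (simp add: is_functor_def)
  have id: "farr (Gtilde K G) (m, n) (m, n) (idmap m, idmap n) = idmap (fob (Gtilde K G) (m, n))"
    if M: "left_module K A m" "left_module K A n" for m n
  proof -
    note [simp] = M
    have "Tmap m n m n (idmap m) (idmap n) t = t" if t: "t \<in> carrier (T m n)" for t
    proof (rule T_eqI[OF M _ t])
      show "Tmap m n m n (idmap m) (idmap n) t \<in> carrier (T m n)"
        by (rule Tmap_closed[OF M M]) (use t in \<open>simp_all add: idmap_lmod_hom\<close>)
      show "contr (fob G m) n x (Tmap m n m n (idmap m) (idmap n) t) = contr (fob G m) n x t" if "x \<in> carrier n" for x
        using contr_Tmap[OF M M idmap_lmod_hom[OF M(1)] idmap_lmod_hom[OF M(2)] t that] t that by (simp add: G_id)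
    qed
    then show ?thesis
      unfolding Gtilde_arr Gtilde_ob using tr_idmap[of "T m n" "Tmap m n m n (idmap m) (idmap n)" "Lact m n"]
      by (simp add: idmap_def)
  qed
  have comp: "farr (Gtilde K G) (m, n) (m'', n'') (compose (carrier m) f' f, compose (carrier n'') g g') =
      compose (carrier (fob (Gtilde K G) (m, n))) (farr (Gtilde K G) (m', n') (m'', n'') (f', g'))
        (farr (Gtilde K G) (m, n) (m', n') (f, g))"
    if M: "left_module K A m" "left_module K A n" "left_module K A m'" "left_module K A n'"
      "left_module K A m''" "left_module K A n''"
      and f: "f \<in> lmod_hom K A m m'" and f': "f' \<in> lmod_hom K A m' m''"
      and g: "g \<in> lmod_hom K A n' n" and g': "g' \<in> lmod_hom K A n'' n'"
    for m n m' n' m'' n'' f f' g g'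
  proof -
    note [simp] = M
    note cl [simp] = Tmap_closed[OF M(1-4) f g] Tmap_closed[OF M(3-6) f' g']
      Tmap_closed[OF M(1,2,5,6) compose_lmod_hom[OF M(1) f f'] compose_lmod_hom[OF M(6) g' g]]
    have "Tmap m n m'' n'' (compose (carrier m) f' f) (compose (carrier n'') g g') t =
        Tmap m' n' m'' n'' f' g' (Tmap m n m' n' f g t)" if t: "t \<in> carrier (T m n)" for t
    proof (rule T_eqI[OF M(5,6)])
      fix x assume x: "x \<in> carrier n''"
      have "contr (fob G m'') n'' x (Tmap m n m'' n'' (compose (carrier m) f' f) (compose (carrier n'') g g') t) =
          farr G m m'' (compose (carrier m) f' f) (contr (fob G m) n (g (g' x)) t)"
        using contr_Tmap[OF M(1,2,5,6) compose_lmod_hom[OF M(1) f f'] compose_lmod_hom[OF M(6) g' g] t x] x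
        by (simp add: compose_eq)
      also have "\<dots> = contr (fob G m'') n'' x (Tmap m' n' m'' n'' f' g' (Tmap m n m' n' f g t))"
        using t x by (simp add: contr_Tmap[OF M(1-4) f g] contr_Tmap[OF M(3-6) f' g'] lmod_homD(3)[OF g]
          lmod_homD(3)[OF g'] G_comp[OF M(1,3,5) f f'] compose_eq)
      finally show "contr (fob G m'') n'' x (Tmap m n m'' n'' (compose (carrier m) f' f) (compose (carrier n'') g g') t) =
        contr (fob G m'') n'' x (Tmap m' n' m'' n'' f' g' (Tmap m n m' n' f g t))" .
    qed (use t in simp_all)
    then show ?thesis
      unfolding Gtilde_arr Gtilde_ob copy_bimod_simps
      by (subst tr_compose) (auto intro!: tr_cong)
  qed
  show ?thesis
    unfolding is_functor_def
    using prod_cat_category[OF cat opp_cat_category[OF cat]] bimod_cat_category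
    by (auto simp: prod_cat_def opp_cat_def lmod_cat_def bimod_cat_def id comp Gtilde_bimodule Tmap_bimod_hom)
qed

end

context ground_field begin

section \<open>Coevaluation and reassociation\<close>

lemma some_basis_fold: "(SOME S. vectorspace.basis K V S) = some_basis V"
  by (simp add: some_basis_def)

lemma coev_eq:
  assumes "fd_space K V"
  shows "coev K V = finsum (tensor K V (dual K V)) (\<lambda>b. tens K V (dual K V) b (bcoord V b)) (some_basis V)"
  unfolding coev_def some_basis_fold Let_def
  by (rule finsum_cong) (simp_all add: assms coord_eq)

lemma coev_closed [simp]: "fd_space K V \<Longrightarrow> coev K V \<in> carrier (tensor K V (dual K V))"
  unfolding coev_eq by (rule finsum_closed) simp_all

text \<open>The coevaluation is the identity of \<open>V\<close> in disguise. Later uses of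
  \<open>coev\<close> rely on this property and no longer mention the basis.\<close>

lemma contr_coev:
  assumes V [simp]: "fd_space K V" and x: "x \<in> carrier V"
  shows "contr V V x (coev K V) = x"
proof -
  note [simp] = x set_mp[OF some_basis(3)[OF V]]
  have "contr V V x (coev K V) =
      finsum V (\<lambda>b. contr V V x (tens K V (dual K V) b (bcoord V b))) (some_basis V)"
    unfolding coev_eq[OF V] by (rule module_hom_finsum[OF linD(1)[OF contr_lin]]) simp_all
  also have "\<dots> = finsum V (\<lambda>b. bcoord V b x \<odot>\<^bsub>V\<^esub> b) (some_basis V)"
    by (rule finsum_cong) simp_all
  also have "\<dots> = x" by (rule bcoord_expand(1)[OF V x])
  finally show ?thesis .
qed

lemma assoc_inv_hom:
  assumes [simp]: "vectorspace K U" "vectorspace K V" "vectorspace K W"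
  shows "assoc_inv K U V W \<in> lin K (tensor K U (tensor K V W)) (tensor K (tensor K U V) W)"
    and "u \<in> carrier U \<Longrightarrow> v \<in> carrier V \<Longrightarrow> w \<in> carrier W \<Longrightarrow>
      assoc_inv K U V W (tens K U (tensor K V W) u (tens K V W v w)) = tens K (tensor K U V) W (tens K U V u v) w"
proof -
  let ?T = "tensor K (tensor K U V) W"
  let ?\<beta> = "\<lambda>u v w. tens K (tensor K U V) W (tens K U V u v) w"
  have b1: "bilin V W ?T (?\<beta> u)" if "u \<in> carrier U" for u
    by (rule bilinI)
      (use tens_hom_r[of "tensor K U V" W] module_hom_comp[OF tens_hom_r[of U V, OF _ _ that] tens_hom_l[of "tensor K U V" W]]
       in auto)
  note t1 = tlift[OF b1 assms(2,3) tensor_vs]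
  have b2: "bilin U (tensor K V W) ?T (\<lambda>u. tlift K V W ?T (?\<beta> u))"
    by (rule bilinI[OF linD(1)[OF t1(1)] tlift_param_hom[OF b1 module_hom_comp[OF tens_hom_l tens_hom_l]]]) simp_all
  note t2 = tlift[OF b2 assms(1) tensor_vs tensor_vs]
  show "assoc_inv K U V W \<in> lin K (tensor K U (tensor K V W)) ?T"
    unfolding assoc_inv_def Let_def by (rule t2(1))
  show "assoc_inv K U V W (tens K U (tensor K V W) u (tens K V W v w)) = ?\<beta> u v w"
    if "u \<in> carrier U" "v \<in> carrier V" "w \<in> carrier W"
    unfolding assoc_inv_def Let_def using that by (simp add: t2(2) t1(2))
qed

end

context setting begin

section \<open>The end\<close>

lemma A_fd [simp]: "fd_space K A"
  using fd_A by (simp add: fd_algebra_def)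

lemma A_ring: "ring A"
  using fd_A by (simp add: fd_algebra_def)

lemma A_bilin: "c \<in> carrier K \<Longrightarrow> x \<in> carrier A \<Longrightarrow> y \<in> carrier A \<Longrightarrow>
    (c \<odot>\<^bsub>A\<^esub> x) \<otimes>\<^bsub>A\<^esub> y = c \<odot>\<^bsub>A\<^esub> (x \<otimes>\<^bsub>A\<^esub> y)"
  "c \<in> carrier K \<Longrightarrow> x \<in> carrier A \<Longrightarrow> y \<in> carrier A \<Longrightarrow>
    x \<otimes>\<^bsub>A\<^esub> (c \<odot>\<^bsub>A\<^esub> y) = c \<odot>\<^bsub>A\<^esub> (x \<otimes>\<^bsub>A\<^esub> y)"
  using fd_A by (auto simp: fd_algebra_def)

lemma reg_left_action: "left_action K A A (reg_lact A)"
proof -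
  interpret A: ring A by (rule A_ring)
  show ?thesis
    by (intro left_actionI module_homI)
      (simp_all add: reg_lact_def A.r_distr A.l_distr A.m_assoc A_bilin)
qed

lemma reg_right_action: "right_action K A A (reg_ract A)"
proof -
  interpret A: ring A by (rule A_ring)
  show ?thesis
    by (intro right_actionI module_homI)
      (simp_all add: reg_ract_def A.r_distr A.l_distr A.m_assoc A_bilin)
qed

lemma reg_commute:
  "a \<in> carrier A \<Longrightarrow> b \<in> carrier A \<Longrightarrow> x \<in> carrier A \<Longrightarrow>
    reg_lact A a (reg_ract A b x) = reg_ract A b (reg_lact A a x)"
  using ring.ring_simprules(11)[OF A_ring] by (simp add: reg_lact_def reg_ract_def)

text \<open>Commuting with the left action makes each right translation a morphism of left modules,
  to which \<open>G\<close> applies. Linearity of \<open>G\<close> gives the axioms that are linear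
  in the algebra element, functoriality the unit and the product. Both A and A* are
  instances.\<close>

lemma G_bimod_bimodule:
  fixes V :: "('k, 'v, 'z) module_scheme"
  assumes V [simp]: "fd_space K V" and l: "left_action K A V l" and r: "right_action K A V r"
    and lr: "\<And>a b x. a \<in> carrier A \<Longrightarrow> b \<in> carrier A \<Longrightarrow> x \<in> carrier V \<Longrightarrow> l a (r b x) = r b (l a x)"
  shows "bimodule K B A (G_bimod G V l r)"
proof -
  let ?P = "copy_lmod V l :: ('k, 'u, 'a) lmod"
  let ?r = "\<lambda>a. tr (carrier V) (carrier V) (r a) :: 'u \<Rightarrow> 'u"
  note D [simp] = right_actionD[OF r]
  have P [simp]: "left_module K A ?P"
    by (rule copy_left_module[OF V l])
  have hom [simp]: "?r a \<in> lmod_hom K A ?P ?P" if "a \<in> carrier A" for a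
    by (rule tr_lmod_hom[OF V V D(1)[OF that] l]) (use that lr in simp)
  have "right_action K A (fob G ?P) (\<lambda>a. farr G ?P ?P (?r a))"
  proof (rule right_actionI)
    show "farr G ?P ?P (?r a) \<in> module_hom K (fob G ?P) (fob G ?P)" if "a \<in> carrier A" for a
      by (rule lmod_homD(2)[OF G_hom[OF P P hom[OF that]]])
    show "farr G ?P ?P (?r \<one>\<^bsub>A\<^esub>) y = y" if "y \<in> carrier (fob G ?P)" for y
      using that tr_idmap[OF V, of "r \<one>\<^bsub>A\<^esub>" l] by (simp add: G_id)
    show "farr G ?P ?P (?r (c \<odot>\<^bsub>A\<^esub> a)) y = c \<odot>\<^bsub>fob G ?P\<^esub> farr G ?P ?P (?r a) y"
      if "a \<in> carrier A" "y \<in> carrier (fob G ?P)" "c \<in> carrier K" for a y c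
      by (rule G_smult[OF P P hom _ hom]) (use that in \<open>auto elim!: copyE\<close>)
    show "farr G ?P ?P (?r (a \<oplus>\<^bsub>A\<^esub> a')) y = farr G ?P ?P (?r a) y \<oplus>\<^bsub>fob G ?P\<^esub> farr G ?P ?P (?r a') y"
      if "a \<in> carrier A" "a' \<in> carrier A" "y \<in> carrier (fob G ?P)" for a a' y
      by (rule G_add[OF P P hom hom hom]) (use that in \<open>auto elim!: copyE\<close>)
    show "farr G ?P ?P (?r (a \<otimes>\<^bsub>A\<^esub> a')) y = farr G ?P ?P (?r a') (farr G ?P ?P (?r a) y)"
      if "a \<in> carrier A" "a' \<in> carrier A" "y \<in> carrier (fob G ?P)" for a a' y
      by (rule G_comp_apply[OF P P P hom hom hom, symmetric]) (use that in \<open>auto elim!: copyE\<close>)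
  qed
  then show ?thesis
    unfolding G_bimod_def Let_def
    by (rule add_ract_bimodule[OF G_ob[OF P]]) (simp add: lmod_homD(4)[OF G_hom[OF P P hom]])
qed

section \<open>The regular module and its orbit maps\<close>

abbreviation R :: "('k, 'u, 'a) lmod" where "R \<equiv> reg_mod A"
abbreviation eA :: "'a \<Rightarrow> 'u" where "eA \<equiv> enc (carrier A)"

lemma R_module [simp]: "left_module K A R"
  unfolding reg_mod_def by (rule copy_left_module[OF A_fd reg_left_action])

lemma R_E: "r \<in> carrier R \<Longrightarrow> (\<And>a. a \<in> carrier A \<Longrightarrow> r = eA a \<Longrightarrow> P) \<Longrightarrow> P"
  unfolding reg_mod_def by (erule copyE)

lemma eA_closed [simp]: "a \<in> carrier A \<Longrightarrow> eA a \<in> carrier R"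
  unfolding reg_mod_def by simp

lemma eA_ops:
  "a \<in> carrier A \<Longrightarrow> b \<in> carrier A \<Longrightarrow> eA a \<oplus>\<^bsub>R\<^esub> eA b = eA (a \<oplus>\<^bsub>A\<^esub> b)"
  "a \<in> carrier A \<Longrightarrow> c \<odot>\<^bsub>R\<^esub> eA a = eA (c \<odot>\<^bsub>A\<^esub> a)"
  "a \<in> carrier A \<Longrightarrow> lact R b (eA a) = eA (b \<otimes>\<^bsub>A\<^esub> a)"
  by (simp_all add: reg_mod_def reg_lact_def)

definition orb :: "('k, 'u, 'a) lmod \<Rightarrow> 'u \<Rightarrow> 'u \<Rightarrow> 'u" where
  "orb m x = (\<lambda>r\<in>carrier R. lact m (dec (carrier A) r) x)"

lemma orb_eA [simp]: "a \<in> carrier A \<Longrightarrow> orb m x (eA a) = lact m a x"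
  by (simp add: orb_def)

lemma orb_hom:
  assumes m [simp]: "left_module K A m" and x [simp]: "x \<in> carrier m"
  shows "orb m x \<in> lmod_hom K A R m"
proof (intro lmod_homI linI module_homI)
  show "orb m x \<in> extensional (carrier R)" by (simp add: orb_def)
qed (auto elim!: R_E simp: eA_ops lactD[OF m])

abbreviation Gorb :: "('k, 'u, 'a) lmod \<Rightarrow> 'u \<Rightarrow> 'u \<Rightarrow> 'u" where
  "Gorb m x \<equiv> farr G R m (orb m x)"

lemma Gorb_closed [simp]:
  "left_module K A m \<Longrightarrow> x \<in> carrier m \<Longrightarrow> y \<in> carrier (fob G R) \<Longrightarrow> Gorb m x y \<in> carrier (fob G m)"
  using lmod_homD(3)[OF G_hom[OF R_module _ orb_hom]] by blast

text \<open>A module map carries the orbit map at \<open>x\<close> to the orbit map at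
  \<open>f x\<close>. This identity lies behind dinaturality of the end family and behind all
  computations with \<open>Gorb\<close>.\<close>

lemma Gorb_comp:
  assumes "left_module K A m" "left_module K A n" "f \<in> lmod_hom K A m n" "x \<in> carrier m" "y \<in> carrier (fob G R)"
  shows "farr G m n f (Gorb m x y) = Gorb n (f x) y"
  by (rule G_comp_apply[OF R_module assms(1,2) orb_hom assms(3) orb_hom])
    (use assms in \<open>auto elim!: R_E simp: lmod_homD[OF assms(3)]\<close>)

lemma Gorb_act:
  assumes "left_module K A m" "x \<in> carrier m" "a \<in> carrier A" "y \<in> carrier (fob G R)"
  shows "Gorb m x (Gorb R (eA a) y) = Gorb m (lact m a x) y"
  using Gorb_comp[OF R_module assms(1) orb_hom[OF assms(1,2)], of "eA a" y] assms by simp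

lemma Gorb_add:
  assumes "left_module K A m" "x \<in> carrier m" "x' \<in> carrier m" "y \<in> carrier (fob G R)"
  shows "Gorb m (x \<oplus>\<^bsub>m\<^esub> x') y = Gorb m x y \<oplus>\<^bsub>fob G m\<^esub> Gorb m x' y"
  by (rule G_add[OF R_module assms(1) orb_hom orb_hom orb_hom])
    (use assms in \<open>auto elim!: R_E simp: module_homD[OF lactD(1)[OF assms(1)]]\<close>)

lemma Gorb_one:
  assumes "y \<in> carrier (fob G R)"
  shows "Gorb R (eA \<one>\<^bsub>A\<^esub>) y = y"
proof -
  interpret A: ring A by (rule A_ring)
  have "orb R (eA \<one>\<^bsub>A\<^esub>) = idmap R"
    by (rule lmod_hom_eqI[OF orb_hom idmap_lmod_hom]) (auto elim!: R_E simp: eA_ops)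
  then show ?thesis using assms by (simp add: G_id)
qed

lemma Gorb_hom:
  assumes "left_module K A m" "x \<in> carrier m"
  shows "Gorb m x \<in> lmod_hom K B (fob G R) (fob G m)"
  by (rule G_hom[OF R_module assms(1) orb_hom[OF assms]])

lemma G_reg_eq: "G_reg A G = add_ract (fob G R) (\<lambda>a. farr G R R (tr (carrier A) (carrier A) (reg_ract A a)))"
  by (simp add: G_reg_def G_bimod_def reg_mod_def Let_def)

text \<open>Right multiplication sends b to b a, which is the orbit map of the regular module at a.
  The right action on G(A) thereby becomes an instance of \<open>Gorb\<close>.\<close>

lemma ract_orb: "a \<in> carrier A \<Longrightarrow> tr (carrier A) (carrier A) (reg_ract A a) = orb R (eA a)"
  unfolding tr_def orb_def reg_mod_def copy_simps
  by (rule restrict_ext) (auto simp: reg_ract_def reg_lact_def)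

lemma G_reg_simps [simp]:
  "carrier (G_reg A G) = carrier (fob G R)" "lact (G_reg A G) = lact (fob G R)"
  "a \<in> carrier A \<Longrightarrow> ract (G_reg A G) a = Gorb R (eA a)"
  "lin K (G_reg A G) N = lin K (fob G R) N" "lin K N' (G_reg A G) = lin K N' (fob G R)"
  by (simp_all add: G_reg_eq ract_orb)

lemma G_reg_bimodule: "bimodule K B A (G_reg A G)"
  unfolding G_reg_def
  by (rule G_bimod_bimodule[OF A_fd reg_left_action reg_right_action reg_commute])

section \<open>The end family at a fixed module\<close>

context
  fixes m :: "('k, 'u, 'a) lmod"
  assumes m [simp]: "left_module K A m"
begin

abbreviation (input) "D \<equiv> dual K m"
abbreviation (input) "mm \<equiv> tensor K m (dual K m)"
abbreviation (input) "P \<equiv> tensor_mod K m (dual K m)"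
abbreviation (input) emm :: "('u \<times> ('u \<Rightarrow> 'k) \<Rightarrow> 'k) set \<Rightarrow> 'u" where "emm \<equiv> enc (carrier (tensor K m (dual K m)))"

lemma tensor_mod_eq: "P = copy_lmod mm (tact m m)"
  by (simp add: tensor_mod_def tact_def[abs_def])

lemmas act_simps [simp] = tact_closed[OF fd_A m left_module_fd_A[OF m]] contr_tact[OF fd_A m left_module_fd_A[OF m]]
  tact_tens[OF fd_A m left_module_fd_A[OF m]]

lemma P_module [simp]: "left_module K A P"
  unfolding tensor_mod_eq
  by (rule copy_left_module[OF _ tact_left_action[OF fd_A m left_module_fd_A[OF m]]]) simp

lemma P_E: "p \<in> carrier P \<Longrightarrow> (\<And>t. t \<in> carrier mm \<Longrightarrow> p = emm t \<Longrightarrow> Q) \<Longrightarrow> Q"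
  unfolding tensor_mod_eq by (erule copyE)

lemma mm_fd [simp]: "fd_space K mm" by simp

lemma emm_closed [simp]: "t \<in> carrier mm \<Longrightarrow> emm t \<in> carrier P"
  unfolding tensor_mod_eq by simp

lemma emm_ops:
  "t \<in> carrier mm \<Longrightarrow> u \<in> carrier mm \<Longrightarrow> emm t \<oplus>\<^bsub>P\<^esub> emm u = emm (t \<oplus>\<^bsub>mm\<^esub> u)"
  "t \<in> carrier mm \<Longrightarrow> c \<odot>\<^bsub>P\<^esub> emm t = emm (c \<odot>\<^bsub>mm\<^esub> t)"
  "t \<in> carrier mm \<Longrightarrow> lact P b (emm t) = emm (tact m m b t)"
  by (simp_all add: tensor_mod_eq)

text \<open>Checked on pure tensors of m \<otimes> m*, reassociating and then applying the action
  map is just the action on the left factor. The coherence map disappears from here on.\<close>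

lemma rho_id_hom:
  "(\<lambda>p. rho_id K A m p) \<in> module_hom K (tensor K A mm) mm"
  and rho_id_tens: "a \<in> carrier A \<Longrightarrow> t \<in> carrier mm \<Longrightarrow> rho_id K A m (tens K A mm a t) = tact m m a t"
proof -
  have b: "bilin A m m (lact m)"
    by (intro bilinI module_homI) (simp_all add: lactD[OF m] module_homD[OF lactD(1)[OF m]])
  have rho: "rho K A m \<in> lin K (tensor K A m) m"
    "\<And>a x. a \<in> carrier A \<Longrightarrow> x \<in> carrier m \<Longrightarrow> rho K A m (tens K A m a x) = lact m a x"
    unfolding rho_def using tlift[OF b] by auto
  note tm = tmap[OF linD(1)[OF rho(1)] idmap_hom[of D]]
  note ai = assoc_inv_hom[of A m D]
  show hom: "(\<lambda>p. rho_id K A m p) \<in> module_hom K (tensor K A mm) mm"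
    unfolding rho_id_def by (rule module_hom_comp[OF linD(1)[OF ai(1)] linD(1)[OF tm(1)]]) simp_all
  show "rho_id K A m (tens K A mm a t) = tact m m a t" if a: "a \<in> carrier A" and t: "t \<in> carrier mm"
  proof (rule tensor_hom_eqI[of "\<lambda>t. rho_id K A m (tens K A mm a t)" m D mm])
    show "(\<lambda>t. rho_id K A m (tens K A mm a t)) \<in> module_hom K mm mm"
      by (rule module_hom_comp[OF tens_hom_r hom]) (use a in simp_all)
    show "tact m m a \<in> module_hom K mm mm"
      by (rule tact_hom[OF fd_A m _ a]) simp
    show "rho_id K A m (tens K A mm a (tens K m D x \<phi>)) = tact m m a (tens K m D x \<phi>)"
      if "x \<in> carrier m" "\<phi> \<in> carrier D" for x \<phi>
      unfolding rho_id_def using a that by (simp add: ai(2) tm(2) rho(2))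
  qed (use t in simp_all)
qed

lemma rho_hat_eq: "a \<in> carrier A \<Longrightarrow> rho_hat K A m a = tact m m a (coev K m)"
  unfolding rho_hat_def by (rule rho_id_tens) simp_all

text \<open>By \<open>rho_hat_eq\<close> the element a goes to a acting on the coevaluation, which
  is an orbit map of m \<otimes> m*. All facts about \<open>Gorb\<close> thus apply to the end
  family.\<close>

lemma tr_rho_hat: "tr (carrier A) (carrier mm) (rho_hat K A m) = orb P (emm (coev K m))"
  unfolding tr_def orb_def reg_mod_def copy_simps
  by (rule restrict_ext) (auto simp: rho_hat_eq emm_ops)

definition iota :: "('u \<Rightarrow> 'k) \<Rightarrow> 'u \<Rightarrow> 'u" where
  "iota \<phi> = (\<lambda>x\<in>carrier m. emm (tens K m D x \<phi>))"

lemma iota_hom: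
  assumes \<phi>: "\<phi> \<in> lin K m (base_space K)"
  shows "iota \<phi> \<in> lmod_hom K A m P"
proof (intro lmod_homI linI module_homI)
  have h: "(\<lambda>v. tens K m D v \<phi>) \<in> module_hom K m mm"
    by (rule tens_hom_l) (use \<phi> in simp_all)
  note [simp] = module_homD(2,3)[OF h] emm_ops \<phi> lactD(6)[OF m]
  show "iota \<phi> \<in> extensional (carrier m)" by (simp add: iota_def)
qed (use \<phi> in \<open>simp_all add: iota_def emm_ops lactD(6)[OF m] module_homD(2,3)[OF tens_hom_l]\<close>)

text \<open>Evaluation of the right factor on the copy of m \<otimes> m*. As a module map to
  \<open>m\<close> it can be put under \<open>G\<close>, unlike the evaluations \<open>contr\<close>
  on G(m) \<otimes> m*.\<close>

definition pr :: "'u \<Rightarrow> 'u \<Rightarrow> 'u" where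
  "pr x = (\<lambda>p\<in>carrier P. contr m m x (dec (carrier mm) p))"

lemma pr_emm [simp]: "t \<in> carrier mm \<Longrightarrow> pr x (emm t) = contr m m x t"
  by (simp add: pr_def)

lemma pr_hom:
  assumes "x \<in> carrier m"
  shows "pr x \<in> lmod_hom K A P m"
proof (intro lmod_homI linI module_homI)
  show "pr x \<in> extensional (carrier P)" by (simp add: pr_def)
qed (use assms in \<open>auto elim!: P_E simp: emm_ops\<close>)

text \<open>Linearity of \<open>G\<close> makes the formula linear in \<open>\<phi>\<close>, because
  \<open>iota \<phi>\<close> is; linearity in \<open>y\<close> holds since \<open>G\<close> takes
  values in module maps.\<close>

lemma G_tensor:
  "G_tensor K G m \<in> lin K (T m m) (fob G P)"
  "y \<in> carrier (fob G m) \<Longrightarrow> \<phi> \<in> lin K m (base_space K) \<Longrightarrow>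
    G_tensor K G m (tens K (fob G m) D y \<phi>) = farr G m P (iota \<phi>) y"
proof -
  have b: "bilin (fob G m) D (fob G P) (\<lambda>y \<phi>. farr G m P (iota \<phi>) y)"
  proof (rule bilinI)
    fix y assume y: "y \<in> carrier (fob G m)"
    show "(\<lambda>\<phi>. farr G m P (iota \<phi>) y) \<in> module_hom K D (fob G P)"
    proof (rule module_homI)
      show "farr G m P (iota \<phi>) y \<in> carrier (fob G P)" if "\<phi> \<in> carrier D" for \<phi>
        using lmod_homD(3)[OF G_hom[OF m P_module iota_hom] y] that by simp
      show "farr G m P (iota (\<phi> \<oplus>\<^bsub>D\<^esub> \<psi>)) y = farr G m P (iota \<phi>) y \<oplus>\<^bsub>fob G P\<^esub> farr G m P (iota \<psi>) y"
        if "\<phi> \<in> carrier D" "\<psi> \<in> carrier D" for \<phi> \<psi>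
        by (rule G_add[OF m P_module iota_hom iota_hom iota_hom _ y])
          (use that module_homD(2)[OF tens_hom_r[of m D]] in \<open>simp_all add: iota_def emm_ops\<close>)
      show "farr G m P (iota (c \<odot>\<^bsub>D\<^esub> \<phi>)) y = c \<odot>\<^bsub>fob G P\<^esub> farr G m P (iota \<phi>) y"
        if "c \<in> carrier K" "\<phi> \<in> carrier D" for c \<phi>
        by (rule G_smult[OF m P_module iota_hom _ iota_hom _ y])
          (use that module_homD(3)[OF tens_hom_r[of m D]] in \<open>simp_all add: iota_def emm_ops\<close>)
    qed
  next
    fix \<phi> assume "\<phi> \<in> carrier D"
    then show "(\<lambda>y. farr G m P (iota \<phi>) y) \<in> module_hom K (fob G m) (fob G P)"
      using lmod_homD(2)[OF G_hom[OF m P_module iota_hom]] by simp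
  qed
  have eq: "G_tensor K G m = tlift K (fob G m) D (fob G P) (\<lambda>y \<phi>. farr G m P (iota \<phi>) y)"
    by (simp add: G_tensor_def iota_def[abs_def] Let_def)
  show "G_tensor K G m \<in> lin K (T m m) (fob G P)"
    unfolding eq by (rule tlift(1)[OF b]) simp_all
  show "G_tensor K G m (tens K (fob G m) D y \<phi>) = farr G m P (iota \<phi>) y"
    if "y \<in> carrier (fob G m)" "\<phi> \<in> lin K m (base_space K)"
    unfolding eq by (rule tlift(2)[OF b]) (use that in simp_all)
qed

text \<open>On the module side \<open>pr x\<close> after \<open>iota \<phi>\<close> is
  \<open>\<phi> x\<close> times the identity, and \<open>G\<close> preserves scalar multiples. As
  evaluations separate tensors, \<open>G_tensor\<close> is in particular injective.\<close>

lemma G_pr_G_tensor: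
  assumes t: "t \<in> carrier (T m m)" and x: "x \<in> carrier m"
  shows "farr G P m (pr x) (G_tensor K G m t) = contr (fob G m) m x t"
proof (rule tensor_hom_eqI[OF _ _ _ _ t])
  show "(\<lambda>t. farr G P m (pr x) (G_tensor K G m t)) \<in> module_hom K (T m m) (fob G m)"
    by (rule module_hom_comp[OF linD(1)[OF G_tensor(1)] lmod_homD(2)[OF G_hom[OF P_module m pr_hom[OF x]]]])
  show "contr (fob G m) m x \<in> module_hom K (T m m) (fob G m)"
    by (rule linD(1)[OF contr_lin]) (use x in simp_all)
  fix y \<phi> assume y: "y \<in> carrier (fob G m)" and "\<phi> \<in> carrier D"
  then have \<phi>: "\<phi> \<in> lin K m (base_space K)" by simp
  note [simp] = dual_closed[OF \<phi> x]
  let ?h = "compose (carrier m) (pr x) (iota \<phi>)"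
  have h: "?h \<in> lmod_hom K A m m"
    by (rule compose_lmod_hom[OF m iota_hom[OF \<phi>] pr_hom[OF x]])
  have "farr G P m (pr x) (G_tensor K G m (tens K (fob G m) D y \<phi>)) = farr G m m ?h y"
    unfolding G_tensor(2)[OF y \<phi>]
    by (rule G_comp_apply[OF m P_module m iota_hom[OF \<phi>] pr_hom[OF x] h _ y]) (simp add: compose_eq)
  also have "\<dots> = \<phi> x \<odot>\<^bsub>fob G m\<^esub> farr G m m (idmap m) y"
    by (rule G_smult[OF m m idmap_lmod_hom[OF m] _ h _ y]) (use x \<phi> in \<open>simp_all add: compose_eq iota_def\<close>)
  also have "\<dots> = contr (fob G m) m x (tens K (fob G m) D y \<phi>)"
    using x y \<phi> by (simp add: G_id)
  finally show "farr G P m (pr x) (G_tensor K G m (tens K (fob G m) D y \<phi>)) =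
    contr (fob G m) m x (tens K (fob G m) D y \<phi>)" .
qed simp_all

text \<open>The end family uses \<open>inv_into\<close> for \<open>G_tensor\<close>, which is
  meaningful only on its range. The orbit map at x \<otimes> \<phi> is \<open>iota \<phi>\<close>
  after the orbit map at x, so its value is hit by a pure tensor; sums follow because
  \<open>Gorb\<close> is additive in the point.\<close>

lemma Gorb_in_range:
  assumes y: "y \<in> carrier (fob G R)" and t: "t \<in> carrier mm"
  shows "Gorb P (emm t) y \<in> G_tensor K G m ` carrier (T m m)"
  using t fd_space_vs[OF left_module_fd_A[OF m]] dual_vs[OF fd_space_vs[OF left_module_fd_A[OF m]]]
proof (induction rule: tensor_induct)
  case (tens x \<phi>)
  then have \<phi>: "\<phi> \<in> lin K m (base_space K)" by simp
  have "Gorb P (emm (tens K m D x \<phi>)) y = farr G m P (iota \<phi>) (Gorb m x y)"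
    using Gorb_comp[OF m P_module iota_hom[OF \<phi>] tens(1) y] tens by (simp add: iota_def)
  also have "\<dots> = G_tensor K G m (tens K (fob G m) D (Gorb m x y) \<phi>)"
    using G_tensor(2)[OF _ \<phi>] tens y by simp
  finally show ?case by simp
next
  case (add t u)
  then obtain t' u' where tu: "t' \<in> carrier (T m m)" "u' \<in> carrier (T m m)"
    "Gorb P (emm t) y = G_tensor K G m t'" "Gorb P (emm u) y = G_tensor K G m u'"
    by auto
  have "Gorb P (emm (t \<oplus>\<^bsub>mm\<^esub> u)) y = G_tensor K G m (t' \<oplus>\<^bsub>T m m\<^esub> u')"
    using Gorb_add[OF P_module _ _ y, of "emm t" "emm u"] add tu
    by (simp add: emm_ops linD(4)[OF G_tensor(1)])
  then show ?case using tu by simp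
qed

definition tau :: "'u \<Rightarrow> ('u \<times> ('u \<Rightarrow> 'k) \<Rightarrow> 'k) set" where
  "tau y = inv_into (carrier (T m m)) (G_tensor K G m) (Gorb P (emm (coev K m)) y)"

lemma end_family_eq: "end_family K A G m = (\<lambda>y\<in>carrier (fob G R). enc (carrier (T m m)) (tau y))"
  unfolding end_family_def tau_def tr_rho_hat ..

lemma tau_closed [simp]:
  assumes "y \<in> carrier (fob G R)"
  shows "tau y \<in> carrier (T m m)"
  unfolding tau_def by (rule inv_into_into[OF Gorb_in_range[OF assms]]) simp

text \<open>Applying \<open>G\<close> of \<open>pr x\<close> cancels the inverse of
  \<open>G_tensor\<close>. What remains is the orbit map at the evaluation of the coevaluation at
  \<open>x\<close>, which is \<open>x\<close> again.\<close>

lemma contr_tau [simp]: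
  assumes y: "y \<in> carrier (fob G R)" and x: "x \<in> carrier m"
  shows "contr (fob G m) m x (tau y) = Gorb m x y"
proof -
  have "G_tensor K G m (tau y) = Gorb P (emm (coev K m)) y"
    unfolding tau_def by (rule f_inv_into_f[OF Gorb_in_range[OF y]]) simp
  then have "contr (fob G m) m x (tau y) = farr G P m (pr x) (Gorb P (emm (coev K m)) y)"
    using G_pr_G_tensor[OF tau_closed[OF y] x] by simp
  also have "\<dots> = Gorb m x y"
    using Gorb_comp[OF P_module m pr_hom[OF x] _ y, of "emm (coev K m)"] x by (simp add: contr_coev)
  finally show ?thesis .
qed

text \<open>By \<open>contr_tau\<close> every claim is tested on \<open>Gorb m x y\<close>: it is
  left linear in \<open>y\<close>, and the right action on \<open>y\<close> by a replaces x by a x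
  on both sides.\<close>

lemma end_family_hom: "end_family K A G m \<in> bimod_hom K B A (G_reg A G) (fob (Gtilde K G) (m, m))"
  unfolding Gtilde_ob
proof (rule bimod_homI, unfold copy_bimod_simps G_reg_simps)
  let ?C = "copy_lmod (T m m) (Lact m m) :: ('k, 'u, 'b) lmod"
  note [simp] = lactD(6)[OF G_ob[OF R_module]] lactD(6)[OF m]
  have add: "tau (y \<oplus>\<^bsub>fob G R\<^esub> z) = tau y \<oplus>\<^bsub>T m m\<^esub> tau z"
    if "y \<in> carrier (fob G R)" "z \<in> carrier (fob G R)" for y z
    by (rule T_eqI[OF m m]) (use that in \<open>simp_all add: module_homD[OF lmod_homD(2)[OF Gorb_hom[OF m]]]\<close>)
  have smult: "tau (c \<odot>\<^bsub>fob G R\<^esub> y) = c \<odot>\<^bsub>T m m\<^esub> tau y"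
    if "c \<in> carrier K" "y \<in> carrier (fob G R)" for c y
    by (rule T_eqI[OF m m]) (use that in \<open>simp_all add: module_homD[OF lmod_homD(2)[OF Gorb_hom[OF m]]]\<close>)
  have left: "tau (lact (fob G R) b y) = Lact m m b (tau y)"
    if "b \<in> carrier B" "y \<in> carrier (fob G R)" for b y
    by (rule T_eqI[OF m m]) (use that in \<open>simp_all add: lmod_homD(4)[OF Gorb_hom[OF m]]\<close>)
  have right: "tau (Gorb R (eA a) y) = Ract m m a (tau y)"
    if "a \<in> carrier A" "y \<in> carrier (fob G R)" for a y
    by (rule T_eqI[OF m m]) (use that in \<open>simp_all add: Gorb_act\<close>)
  show "end_family K A G m \<in> lin K (fob G R) ?C"
    unfolding end_family_eq by (rule lin_restrict[OF _ module_homI]) (simp_all add: add smult)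
  show "end_family K A G m (lact (fob G R) b y) = lact ?C b (end_family K A G m y)"
    if "b \<in> carrier B" "y \<in> carrier (fob G R)" for b y
    using that by (simp add: end_family_eq left)
  show "end_family K A G m (Gorb R (eA a) y) =
      tr (carrier (T m m)) (carrier (T m m)) (Ract m m a) (end_family K A G m y)"
    if "a \<in> carrier A" "y \<in> carrier (fob G R)" for a y
    using that by (simp add: end_family_eq right)
qed

end

section \<open>Dinaturality and universality of the end family\<close>

lemma end_wedge: "is_wedge (lmod_cat K A) (bimod_cat K B A) (Gtilde K G) (G_reg A G) (end_family K A G)"
  unfolding is_wedge_def
proof (intro conjI ballI)
  show "G_reg A G \<in> Ob (bimod_cat K B A)"
    by (simp add: bimod_cat_def G_reg_bimodule)
  fix c assume "c \<in> Ob (lmod_cat K A :: (('k, 'u, 'a) lmod, 'u \<Rightarrow> 'u) cat)"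
  then have c [simp]: "left_module K A c" by (simp add: lmod_cat_def)
  show "end_family K A G c \<in> Hom (bimod_cat K B A) (G_reg A G) (fob (Gtilde K G) (c, c))"
    by (simp add: bimod_cat_def end_family_hom)
  fix d f assume "d \<in> Ob (lmod_cat K A :: (('k, 'u, 'a) lmod, 'u \<Rightarrow> 'u) cat)" "f \<in> Hom (lmod_cat K A) c d"
  then have d [simp]: "left_module K A d" and f: "f \<in> lmod_hom K A c d" by (simp_all add: lmod_cat_def)
  note ids = idmap_lmod_hom[OF c] idmap_lmod_hom[OF d]
  \<comment> \<open>Evaluated at \<open>x\<close>, the left side is \<open>G\<close> of
    \<open>f\<close> applied to the orbit at \<open>x\<close>, the right side the orbit at
    \<open>f x\<close>; \<open>Gorb_comp\<close> equates them.\<close>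
  have eq: "Tmap c c d c f (idmap c) (tau c y) = Tmap d d d c (idmap d) f (tau d y)"
    if y: "y \<in> carrier (fob G R)" for y
  proof (rule T_eqI[OF d c])
    show "Tmap c c d c f (idmap c) (tau c y) \<in> carrier (T d c)"
      by (rule Tmap_closed[OF c c d c f ids(1)]) (use y in simp)
    show "Tmap d d d c (idmap d) f (tau d y) \<in> carrier (T d c)"
      by (rule Tmap_closed[OF d d d c ids(2) f]) (use y in simp)
    show "contr (fob G d) c x (Tmap c c d c f (idmap c) (tau c y)) =
        contr (fob G d) c x (Tmap d d d c (idmap d) f (tau d y))" if x: "x \<in> carrier c" for x
      using contr_Tmap[OF c c d c f ids(1) tau_closed[OF c y] x] contr_Tmap[OF d d d c ids(2) f tau_closed[OF d y] x]
        x y lmod_homD(3)[OF f x] Gorb_comp[OF c d f x y] by (simp add: G_id)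
  qed
  show "ccomp (bimod_cat K B A) (G_reg A G) (fob (Gtilde K G) (c, c)) (fob (Gtilde K G) (d, c))
        (farr (Gtilde K G) (c, c) (d, c) (f, ident (lmod_cat K A) c)) (end_family K A G c) =
      ccomp (bimod_cat K B A) (G_reg A G) (fob (Gtilde K G) (d, d)) (fob (Gtilde K G) (d, c))
        (farr (Gtilde K G) (d, d) (d, c) (ident (lmod_cat K A) d, f)) (end_family K A G d)"
    unfolding bimod_cat_def lmod_cat_def cat.simps Gtilde_arr compose_def G_reg_simps
    by (rule restrict_ext) (simp add: end_family_eq eq)
qed

lemma end_universal:
  assumes "is_wedge (lmod_cat K A) (bimod_cat K B A) (Gtilde K G) Q j"
  shows "\<exists>!h. h \<in> Hom (bimod_cat K B A) Q (G_reg A G) \<and> (\<forall>c\<in>Ob (lmod_cat K A).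
    ccomp (bimod_cat K B A) Q (G_reg A G) (fob (Gtilde K G) (c, c)) (end_family K A G c) h = j c)"
proof -
  have Q: "bimodule K B A Q"
    and j: "\<And>c. left_module K A c \<Longrightarrow> j c \<in> bimod_hom K B A Q (fob (Gtilde K G) (c, c))"
    and dinat: "\<And>c d f. left_module K A c \<Longrightarrow> left_module K A d \<Longrightarrow> f \<in> lmod_hom K A c d \<Longrightarrow>
      compose (carrier Q) (farr (Gtilde K G) (c, c) (d, c) (f, idmap c)) (j c) =
      compose (carrier Q) (farr (Gtilde K G) (d, d) (d, c) (idmap d, f)) (j d)"
    using assms by (simp_all add: is_wedge_def bimod_cat_def lmod_cat_def)
  have Qvs [simp]: "vectorspace K Q"
    using left_module_fd_B[OF bimodule_left[OF Q]] by simp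
  have Qact: "\<And>b p. b \<in> carrier B \<Longrightarrow> p \<in> carrier Q \<Longrightarrow> lact Q b p \<in> carrier Q"
    "\<And>a p. a \<in> carrier A \<Longrightarrow> p \<in> carrier Q \<Longrightarrow> ract Q a p \<in> carrier Q"
    using lactD(6)[OF bimodule_left[OF Q]] right_actionD(6)[of A Q "ract Q"] Q by (auto simp: bimodule_def)
  \<comment> \<open>The wedge read in the tensor product itself instead of its copy, so that
    evaluations can be applied.\<close>
  define \<sigma> where "\<sigma> c p = dec (carrier (T c c)) (j c p)" for c p
  note jD = bimod_homD[OF j, unfolded Gtilde_ob copy_bimod_simps]
  have \<sigma> [simp]: "\<sigma> c p \<in> carrier (T c c)" "enc (carrier (T c c)) (\<sigma> c p) = j c p"
    if "left_module K A c" "p \<in> carrier Q" for c p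
    using jD(2)[OF that] that by (simp_all add: \<sigma>_def)
  have \<sigma>_hom: "\<sigma> c \<in> module_hom K Q (T c c)" if [simp]: "left_module K A c" for c
    unfolding \<sigma>_def[abs_def] by (rule module_hom_comp[OF linD(1)[OF jD(1)] dec_hom]) simp_all
  have \<sigma>_left: "\<sigma> c (lact Q b p) = Lact c c b (\<sigma> c p)"
    if "left_module K A c" "b \<in> carrier B" "p \<in> carrier Q" for c b p
    unfolding \<sigma>_def[of c "lact Q b p"] using that jD(3)[OF that]
    by (simp flip: \<sigma>(2))
  have \<sigma>_right: "\<sigma> c (ract Q a p) = Ract c c a (\<sigma> c p)"
    if "left_module K A c" "a \<in> carrier A" "p \<in> carrier Q" for c a p
    unfolding \<sigma>_def[of c "ract Q a p"] using that jD(4)[OF that]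
    by (simp flip: \<sigma>(2))
  let ?e = "eA \<one>\<^bsub>A\<^esub>"
  define h where "h = (\<lambda>p\<in>carrier Q. contr (fob G R) R ?e (\<sigma> R p))"
  have h_closed: "h p \<in> carrier (fob G R)" if "p \<in> carrier Q" for p
    using that by (simp add: h_def)
  have key: "Gorb c x (h p) = contr (fob G c) c x (\<sigma> c p)"
    if c [simp]: "left_module K A c" and x [simp]: "x \<in> carrier c" and p [simp]: "p \<in> carrier Q" for c x p
  proof -
    note o = orb_hom[OF c x]
    note ids = idmap_lmod_hom[OF R_module] idmap_lmod_hom[OF c]
    from fun_cong[OF dinat[OF R_module c o], of p]
    have "farr (Gtilde K G) (R, R) (c, R) (orb c x, idmap R) (j R p) =
        farr (Gtilde K G) (c, c) (c, R) (idmap c, orb c x) (j c p)"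
      by (simp add: compose_eq)
    then have "Tmap R R c R (orb c x) (idmap R) (\<sigma> R p) = Tmap c c c R (idmap c) (orb c x) (\<sigma> c p)"
      unfolding Gtilde_arr using Tmap_closed[OF R_module R_module c R_module o ids(1), of "\<sigma> R p"]
        Tmap_closed[OF c c c R_module ids(2) o, of "\<sigma> c p"]
      by (simp add: enc_eq_iff flip: \<sigma>(2))
    \<comment> \<open>At one, the side with \<open>idmap R\<close> gives
      \<open>Gorb c x (h p)\<close>; on the other side the point moves to the image of one under
      \<open>orb c x\<close>, which is \<open>x\<close>.\<close>
    from arg_cong[OF this, of "contr (fob G c) R ?e"]
    show ?thesis
      using contr_Tmap[OF R_module R_module c R_module o ids(1), of "\<sigma> R p" ?e]
        contr_Tmap[OF c c c R_module ids(2) o, of "\<sigma> c p" ?e]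
      by (simp add: G_id lactD(2)[OF c] h_def)
  qed
  show ?thesis
  proof (rule ex1I[of _ h])
    have "h \<in> bimod_hom K B A Q (G_reg A G)"
    proof (rule bimod_homI, unfold G_reg_simps)
      show "h \<in> lin K Q (fob G R)"
        unfolding h_def by (rule lin_restrict[OF Qvs module_homI]) (simp_all add: module_homD(2,3)[OF \<sigma>_hom])
      show "h (lact Q b p) = lact (fob G R) b (h p)" if "b \<in> carrier B" "p \<in> carrier Q" for b p
        using that by (simp add: h_def Qact \<sigma>_left)
      \<comment> \<open>The right action shifts the point of evaluation from one to a, and
        \<open>key\<close> for the regular module at a, that is dinaturality along right
        multiplication by a, expresses the result through \<open>h p\<close>.\<close>
      show "h (ract Q a p) = Gorb R (eA a) (h p)" if "a \<in> carrier A" "p \<in> carrier Q" for a p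
      proof -
        interpret A: ring A by (rule A_ring)
        have "h (ract Q a p) = contr (fob G R) R (eA a) (\<sigma> R p)"
          using that by (simp add: h_def Qact \<sigma>_right eA_ops)
        with that show ?thesis by (simp add: key)
      qed
    qed
    moreover have "compose (carrier Q) (end_family K A G c) h = j c" if c: "left_module K A c" for c
    proof (rule extensionalityI)
      show "j c \<in> extensional (carrier Q)" by (rule linD(2)[OF jD(1)[OF c]])
      fix p assume p: "p \<in> carrier Q"
      have "tau c (h p) = \<sigma> c p"
        by (rule T_eqI[OF c c]) (use c p h_closed in \<open>simp_all add: key\<close>)
      then show "compose (carrier Q) (end_family K A G c) h p = j c p"
        using c p h_closed by (simp add: compose_eq end_family_eq)
    qed simp
    ultimately show "h \<in> Hom (bimod_cat K B A) Q (G_reg A G) \<and> (\<forall>c\<in>Ob (lmod_cat K A).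
        ccomp (bimod_cat K B A) Q (G_reg A G) (fob (Gtilde K G) (c, c)) (end_family K A G c) h = j c)"
      by (simp add: bimod_cat_def lmod_cat_def)
  next
    fix g assume "g \<in> Hom (bimod_cat K B A) Q (G_reg A G) \<and> (\<forall>c\<in>Ob (lmod_cat K A).
        ccomp (bimod_cat K B A) Q (G_reg A G) (fob (Gtilde K G) (c, c)) (end_family K A G c) g = j c)"
    then have g: "g \<in> bimod_hom K B A Q (G_reg A G)" and gj: "compose (carrier Q) (end_family K A G R) g = j R"
      by (simp_all add: bimod_cat_def lmod_cat_def)
    note gl = bimod_homD(1)[OF g, unfolded G_reg_simps]
    show "g = h"
    proof (rule extensionalityI[OF linD(2)[OF gl]])
      show "h \<in> extensional (carrier Q)" by (simp add: h_def)
      fix p assume p: "p \<in> carrier Q"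
      have gp: "g p \<in> carrier (fob G R)" by (rule linD(3)[OF gl p])
      \<comment> \<open>Only the component at the regular module is used: evaluating
        \<open>tau R (g p)\<close> at one returns \<open>g p\<close>.\<close>
      have "\<sigma> R p = tau R (g p)"
        unfolding \<sigma>_def gj[symmetric] using p gp by (simp add: compose_eq end_family_eq)
      then show "g p = h p"
        using p gp by (simp add: h_def Gorb_one)
    qed
  qed
qed

theorem G_reg_is_end:
  "is_end (lmod_cat K A) (bimod_cat K B A) (Gtilde K G) (G_reg A G) (end_family K A G)"
  unfolding is_end_def using Gtilde_functor end_wedge end_universal by blast

end

context ground_field begin

section \<open>The coend\<close>

lemma assoc_hom:
  assumes [simp]: "vectorspace K U" "vectorspace K V" "vectorspace K W"
  shows "assoc K U V W \<in> lin K (tensor K (tensor K U V) W) (tensor K U (tensor K V W))"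
    and "u \<in> carrier U \<Longrightarrow> v \<in> carrier V \<Longrightarrow> w \<in> carrier W \<Longrightarrow>
      assoc K U V W (tens K (tensor K U V) W (tens K U V u v) w) = tens K U (tensor K V W) u (tens K V W v w)"
proof -
  let ?T = "tensor K U (tensor K V W)"
  let ?\<beta> = "\<lambda>w u v. tens K U (tensor K V W) u (tens K V W v w)"
  have b1: "bilin U V ?T (?\<beta> w)" if "w \<in> carrier W" for w
    by (rule bilinI)
      (use tens_hom_l[of U "tensor K V W"] module_hom_comp[OF tens_hom_l[of V W, OF _ _ that] tens_hom_r[of U "tensor K V W"]]
       in auto)
  note t1 = tlift[OF b1 assms(1,2) tensor_vs]
  have b2: "bilin (tensor K U V) W ?T (\<lambda>p w. tlift K U V ?T (?\<beta> w) p)"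
    by (rule bilinI[OF tlift_param_hom[OF b1 module_hom_comp[OF tens_hom_r tens_hom_r]] linD(1)[OF t1(1)]]) simp_all
  note t2 = tlift[OF b2 tensor_vs assms(3) tensor_vs]
  show "assoc K U V W \<in> lin K (tensor K (tensor K U V) W) ?T"
    unfolding assoc_def Let_def by (rule t2(1))
  show "assoc K U V W (tens K (tensor K U V) W (tens K U V u v) w) = ?\<beta> w u v"
    if "u \<in> carrier U" "v \<in> carrier V" "w \<in> carrier W"
    unfolding assoc_def Let_def using that by (simp add: t2(2) t1(2))
qed

lemma runit_hom:
  assumes [simp]: "vectorspace K V"
  shows "runit K V \<in> lin K (tensor K V (base_space K)) V"
    and "v \<in> carrier V \<Longrightarrow> c \<in> carrier K \<Longrightarrow> runit K V (tens K V (base_space K) v c) = c \<odot>\<^bsub>V\<^esub> v"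
proof -
  have b: "bilin V (base_space K) V (\<lambda>v c. c \<odot>\<^bsub>V\<^esub> v)"
    by (intro bilinI module_homI) (simp_all add: vs_distrib vs_smult_assoc vs_smult_lcomm)
  show "runit K V \<in> lin K (tensor K V (base_space K)) V"
    and "v \<in> carrier V \<Longrightarrow> c \<in> carrier K \<Longrightarrow> runit K V (tens K V (base_space K) v c) = c \<odot>\<^bsub>V\<^esub> v"
    unfolding runit_def using tlift[OF b] by auto
qed

lemma ev_hom:
  assumes [simp]: "vectorspace K V"
  shows "ev K V \<in> lin K (tensor K V (dual K V)) (base_space K)"
    and "v \<in> carrier V \<Longrightarrow> \<phi> \<in> lin K V (base_space K) \<Longrightarrow> ev K V (tens K V (dual K V) v \<phi>) = \<phi> v"
proof -
  have b: "bilin V (dual K V) (base_space K) (\<lambda>v \<phi>. \<phi> v)"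
    by (rule bilinI[OF dual_eval_hom]) (use linD(1) in auto)
  show "ev K V \<in> lin K (tensor K V (dual K V)) (base_space K)"
    and "v \<in> carrier V \<Longrightarrow> \<phi> \<in> lin K V (base_space K) \<Longrightarrow> ev K V (tens K V (dual K V) v \<phi>) = \<phi> v"
    unfolding ev_def using tlift[OF b] by auto
qed

text \<open>Coordinates with respect to a basis are functionals, and they determine the
  vector.\<close>

lemma dual_separates:
  assumes V: "fd_space K V" and v: "v \<in> carrier V" "w \<in> carrier V"
    and eq: "\<And>\<phi>. \<phi> \<in> lin K V (base_space K) \<Longrightarrow> \<phi> v = \<phi> w"
  shows "v = w"
proof -
  note [simp] = V set_mp[OF some_basis(3)[OF V]]
  have "finsum V (\<lambda>b. bcoord V b v \<odot>\<^bsub>V\<^esub> b) (some_basis V) = finsum V (\<lambda>b. bcoord V b w \<odot>\<^bsub>V\<^esub> b) (some_basis V)"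
    by (rule finsum_cong) (simp_all add: v eq[OF bcoord_lin[OF V]])
  then show ?thesis
    using bcoord_expand(1)[OF V] v by simp
qed

text \<open>An \<open>inv_into\<close> carries no linearity of its own. It comes from the second
  fact, whose right side is linear in \<open>\<Lambda>\<close>, because functionals separate
  points.\<close>

lemma bidual_inv:
  assumes V: "fd_space K V"
  shows "\<Lambda> \<in> carrier (dual K (dual K V)) \<Longrightarrow> inv_into (carrier V) (bidual_map K V) \<Lambda> \<in> carrier V"
    and "\<Lambda> \<in> carrier (dual K (dual K V)) \<Longrightarrow> \<phi> \<in> carrier (dual K V) \<Longrightarrow>
      \<phi> (inv_into (carrier V) (bidual_map K V) \<Lambda>) = \<Lambda> \<phi>"
    and "inv_into (carrier V) (bidual_map K V) \<in> module_hom K (dual K (dual K V)) V"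
proof -
  let ?i = "inv_into (carrier V) (bidual_map K V)"
  have cl: "?i \<Lambda> \<in> carrier V" if "\<Lambda> \<in> carrier (dual K (dual K V))" for \<Lambda>
    by (rule inv_into_into[OF bidual_surj[OF V]]) (use that in simp)
  have ap: "\<phi> (?i \<Lambda>) = \<Lambda> \<phi>" if \<Lambda>: "\<Lambda> \<in> carrier (dual K (dual K V))" and \<phi>: "\<phi> \<in> carrier (dual K V)" for \<Lambda> \<phi>
  proof -
    have "bidual_map K V (?i \<Lambda>) = \<Lambda>"
      by (rule f_inv_into_f[OF bidual_surj[OF V]]) (use \<Lambda> in simp)
    moreover have "bidual_map K V (?i \<Lambda>) \<phi> = \<phi> (?i \<Lambda>)"
      using cl[OF \<Lambda>] \<phi> by (simp add: bidual_map_def)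
    ultimately show ?thesis by simp
  qed
  show "\<Lambda> \<in> carrier (dual K (dual K V)) \<Longrightarrow> ?i \<Lambda> \<in> carrier V" for \<Lambda> by (rule cl)
  show "\<Lambda> \<in> carrier (dual K (dual K V)) \<Longrightarrow> \<phi> \<in> carrier (dual K V) \<Longrightarrow> \<phi> (?i \<Lambda>) = \<Lambda> \<phi>" for \<Lambda> \<phi>
    by (rule ap)
  note vsV = fd_space_vs[OF V]
  show "?i \<in> module_hom K (dual K (dual K V)) V"
  proof (rule module_homI[OF cl])
    fix x y assume x: "x \<in> carrier (dual K (dual K V))" and y: "y \<in> carrier (dual K (dual K V))"
    show "?i (x \<oplus>\<^bsub>dual K (dual K V)\<^esub> y) = ?i x \<oplus>\<^bsub>V\<^esub> ?i y"
    proof (rule dual_separates[OF V])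
      fix \<phi> assume \<phi>: "\<phi> \<in> lin K V (base_space K)"
      then show "\<phi> (?i (x \<oplus>\<^bsub>dual K (dual K V)\<^esub> y)) = \<phi> (?i x \<oplus>\<^bsub>V\<^esub> ?i y)"
        using ap[OF vs_closed(2)[OF dual_vs[OF dual_vs[OF vsV]] x y], of \<phi>] ap[OF x, of \<phi>] ap[OF y, of \<phi>]
          linD(4)[OF \<phi> cl[OF x] cl[OF y]] by simp
    qed (use vsV x y cl in \<open>auto intro!: vs_closed cl\<close>)
  next
    fix c x assume c: "c \<in> carrier K" and x: "x \<in> carrier (dual K (dual K V))"
    show "?i (c \<odot>\<^bsub>dual K (dual K V)\<^esub> x) = c \<odot>\<^bsub>V\<^esub> ?i x"
    proof (rule dual_separates[OF V])
      fix \<phi> assume \<phi>: "\<phi> \<in> lin K V (base_space K)"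
      then show "\<phi> (?i (c \<odot>\<^bsub>dual K (dual K V)\<^esub> x)) = \<phi> (c \<odot>\<^bsub>V\<^esub> ?i x)"
        using ap[OF vs_closed(3)[OF dual_vs[OF dual_vs[OF vsV]] c x], of \<phi>] ap[OF x, of \<phi>]
          linD(5)[OF \<phi> c cl[OF x]] by simp
    qed (use vsV c x cl in \<open>auto intro!: vs_closed cl\<close>)
  qed
qed

lemma coev_dual_closed:
  assumes V [simp]: "fd_space K V"
  shows "coev_dual K V \<in> carrier (tensor K (dual K V) V)"
  unfolding coev_dual_def
  by (rule linD(3)[OF tmap(1)[OF idmap_hom bidual_inv(3)[OF V]]]) simp_all

text \<open>This gives \<open>\<rho>~\<^sub>m\<close> on pure tensors without expanding the coevaluation in a basis.\<close>

lemma coev_dual_contr: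
  assumes V [simp]: "fd_space K V" and \<psi>: "\<psi> \<in> lin K V (base_space K)"
    and F: "F \<in> module_hom K (tensor K (dual K V) V) (dual K V)"
    and Ft: "\<And>\<phi> v. \<phi> \<in> lin K V (base_space K) \<Longrightarrow> v \<in> carrier V \<Longrightarrow>
      F (tens K (dual K V) V \<phi> v) = \<psi> v \<odot>\<^bsub>dual K V\<^esub> \<phi>"
  shows "F (coev_dual K V) = \<psi>"
proof -
  let ?D = "dual K V"
  let ?i = "inv_into (carrier V) (bidual_map K V)"
  let ?t = "tmap K ?D (dual K ?D) ?D V (idmap ?D) ?i"
  have \<psi>D: "\<psi> \<in> carrier ?D" using \<psi> by simp
  note tm = tmap[OF idmap_hom bidual_inv(3)[OF V], of ?D]
  \<comment> \<open>On a pure tensor both sides are \<open>\<Lambda> \<psi>\<close> times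
    \<open>\<phi>\<close>. So \<open>F\<close> after the change from the bidual is contraction at
    \<open>\<psi>\<close>, now a point of the dual space, and \<open>contr_coev\<close> for that
    space applies.\<close>
  have "F (?t (coev K ?D)) = contr ?D ?D \<psi> (coev K ?D)"
  proof (rule tensor_hom_eqI[of "\<lambda>t. F (?t t)" ?D "dual K ?D" ?D])
    show "(\<lambda>t. F (?t t)) \<in> module_hom K (tensor K ?D (dual K ?D)) ?D"
      by (rule module_hom_comp[OF linD(1)[OF tm(1)] F]) simp_all
    show "contr ?D ?D \<psi> \<in> module_hom K (tensor K ?D (dual K ?D)) ?D"
      by (rule linD(1)[OF contr_lin]) (use \<psi> in simp_all)
    fix \<phi> \<Lambda> assume \<phi>: "\<phi> \<in> carrier ?D" and \<Lambda>: "\<Lambda> \<in> carrier (dual K ?D)"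
    have "?t (tens K ?D (dual K ?D) \<phi> \<Lambda>) = tens K ?D V \<phi> (?i \<Lambda>)"
      using tm(2)[OF _ _ _ _ _ \<phi> \<Lambda>] \<phi> by simp
    also have "F \<dots> = \<Lambda> \<psi> \<odot>\<^bsub>?D\<^esub> \<phi>"
      using \<phi> Ft[OF _ bidual_inv(1)[OF V \<Lambda>], of \<phi>] bidual_inv(2)[OF V \<Lambda> \<psi>D] by simp
    also have "\<dots> = contr ?D ?D \<psi> (tens K ?D (dual K ?D) \<phi> \<Lambda>)"
      by (rule contr_tens[symmetric]) (use \<phi> \<Lambda> \<psi> in simp_all)
    finally show "F (?t (tens K ?D (dual K ?D) \<phi> \<Lambda>)) = contr ?D ?D \<psi> (tens K ?D (dual K ?D) \<phi> \<Lambda>)" .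
  qed (simp_all add: coev_closed[OF dual_fd[OF V]])
  also have "\<dots> = \<psi>"
    by (rule contr_coev[OF dual_fd[OF V] \<psi>D])
  finally show ?thesis
    by (simp add: coev_dual_def)
qed

end

context setting begin

text \<open>The coend concerns maps out of G(m) \<otimes> n*, which are compared on pure tensors;
  this is the counterpart of \<open>contr_Ract\<close> for that purpose.\<close>

lemma Ract_tens:
  assumes m: "left_module K A m" and n: "left_module K A n" and a: "a \<in> carrier A"
    and y: "y \<in> carrier (fob G m)" and \<phi>: "\<phi> \<in> lin K n (base_space K)"
  shows "Ract m n a (tens K (fob G m) (dual K n) y \<phi>) = tens K (fob G m) (dual K n) y (dual_map n (lact n a) \<phi>)"
  unfolding Ract_def using assms
  by (subst tmap(2)[OF idmap_hom dual_map_hom[OF _ _ lactD(1)[OF n a]]]) simp_all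

section \<open>The coregular bimodule\<close>

abbreviation DA where "DA \<equiv> dual K A"
abbreviation Cr :: "('k, 'u, 'a) lmod" where "Cr \<equiv> coreg_mod K A"

text \<open>Opaque names for the copy of A*: simplification would otherwise rewrite the carrier of
  the dual under \<open>enc\<close> and \<open>dec\<close>, hiding that it is a carrier.\<close>

definition eD :: "('a \<Rightarrow> 'k) \<Rightarrow> 'u" where "eD = enc (carrier DA)"
definition dD :: "'u \<Rightarrow> 'a \<Rightarrow> 'k" where "dD = dec (carrier DA)"

lemma DA_fd: "fd_space K DA"
  by simp

text \<open>Transposition reverses the order of composition, which exchanges the two kinds of
  action; the axioms are checked pointwise on \<open>V\<close>.\<close>

lemma dual_left_action:
  assumes V [simp]: "vectorspace K V" and r: "right_action K C V r"
    and C: "fd_algebra K C"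
  shows "left_action K C (dual K V) (\<lambda>a. dual_map V (r a))"
proof (rule left_actionI)
  note [simp] = fd_algebra_closed[OF C] right_actionD[OF r] dual_map_closed[OF V right_actionD(1)[OF r]]
  note eqI = lin_eqI[of _ V "base_space K"]
  show "dual_map V (r a) \<in> module_hom K (dual K V) (dual K V)" if "a \<in> carrier C" for a
    by (rule dual_map_hom) (use that in simp_all)
  show "dual_map V (r \<one>\<^bsub>C\<^esub>) \<phi> = \<phi>" if "\<phi> \<in> carrier (dual K V)" for \<phi>
    by (rule eqI) (use that in simp_all)
  show "dual_map V (r (c \<odot>\<^bsub>C\<^esub> a)) \<phi> = c \<odot>\<^bsub>dual K V\<^esub> dual_map V (r a) \<phi>"
    if "a \<in> carrier C" "\<phi> \<in> carrier (dual K V)" "c \<in> carrier K" for a \<phi> c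
    by (rule eqI) (use that linD(5)[of \<phi> V "base_space K" c] in simp_all)
  show "dual_map V (r (a \<oplus>\<^bsub>C\<^esub> a')) \<phi> = dual_map V (r a) \<phi> \<oplus>\<^bsub>dual K V\<^esub> dual_map V (r a') \<phi>"
    if "a \<in> carrier C" "a' \<in> carrier C" "\<phi> \<in> carrier (dual K V)" for a a' \<phi>
    by (rule eqI) (use that linD(4)[of \<phi> V "base_space K"] in simp_all)
  show "dual_map V (r (a \<otimes>\<^bsub>C\<^esub> a')) \<phi> = dual_map V (r a) (dual_map V (r a') \<phi>)"
    if "a \<in> carrier C" "a' \<in> carrier C" "\<phi> \<in> carrier (dual K V)" for a a' \<phi>
    by (rule eqI) (use that in simp_all)
qed

lemma dual_right_action:
  assumes V [simp]: "vectorspace K V" and r: "left_action K C V r"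
    and C: "fd_algebra K C"
  shows "right_action K C (dual K V) (\<lambda>a. dual_map V (r a))"
proof (rule right_actionI)
  note [simp] = fd_algebra_closed[OF C] left_actionD[OF r] dual_map_closed[OF V left_actionD(1)[OF r]]
  note eqI = lin_eqI[of _ V "base_space K"]
  show "dual_map V (r a) \<in> module_hom K (dual K V) (dual K V)" if "a \<in> carrier C" for a
    by (rule dual_map_hom) (use that in simp_all)
  show "dual_map V (r \<one>\<^bsub>C\<^esub>) \<phi> = \<phi>" if "\<phi> \<in> carrier (dual K V)" for \<phi>
    by (rule eqI) (use that in simp_all)
  show "dual_map V (r (c \<odot>\<^bsub>C\<^esub> a)) \<phi> = c \<odot>\<^bsub>dual K V\<^esub> dual_map V (r a) \<phi>"
    if "a \<in> carrier C" "\<phi> \<in> carrier (dual K V)" "c \<in> carrier K" for a \<phi> c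
    by (rule eqI) (use that linD(5)[of \<phi> V "base_space K" c] in simp_all)
  show "dual_map V (r (a \<oplus>\<^bsub>C\<^esub> a')) \<phi> = dual_map V (r a) \<phi> \<oplus>\<^bsub>dual K V\<^esub> dual_map V (r a') \<phi>"
    if "a \<in> carrier C" "a' \<in> carrier C" "\<phi> \<in> carrier (dual K V)" for a a' \<phi>
    by (rule eqI) (use that linD(4)[of \<phi> V "base_space K"] in simp_all)
  show "dual_map V (r (a \<otimes>\<^bsub>C\<^esub> a')) \<phi> = dual_map V (r a') (dual_map V (r a) \<phi>)"
    if "a \<in> carrier C" "a' \<in> carrier C" "\<phi> \<in> carrier (dual K V)" for a a' \<phi>
    by (rule eqI) (use that in simp_all)
qed

lemma coreg_left_action: "left_action K A DA (coreg_lact A)"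
  unfolding coreg_lact_def[abs_def] by (rule dual_left_action[OF _ reg_right_action fd_A]) simp

lemma coreg_right_action: "right_action K A DA (coreg_ract A)"
  unfolding coreg_ract_def[abs_def] by (rule dual_right_action[OF _ reg_left_action fd_A]) simp

lemma coreg_closed [simp]:
  assumes "a \<in> carrier A" "\<phi> \<in> lin K A (base_space K)"
  shows "coreg_lact A a \<phi> \<in> lin K A (base_space K)" "coreg_ract A a \<phi> \<in> lin K A (base_space K)"
  using left_actionD(6)[OF coreg_left_action] right_actionD(6)[OF coreg_right_action] assms by auto

lemma coreg_apply:
  assumes "b \<in> carrier A"
  shows "coreg_lact A a \<phi> b = \<phi> (b \<otimes>\<^bsub>A\<^esub> a)" "coreg_ract A a \<phi> b = \<phi> (a \<otimes>\<^bsub>A\<^esub> b)"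
  using assms by (simp_all add: coreg_lact_def coreg_ract_def reg_lact_def reg_ract_def)

lemma coreg_commute:
  assumes "b \<in> carrier A" "a \<in> carrier A" "\<phi> \<in> carrier DA"
  shows "coreg_lact A b (coreg_ract A a \<phi>) = coreg_ract A a (coreg_lact A b \<phi>)"
proof (rule lin_eqI[of _ A "base_space K"])
  interpret A: ring A by (rule A_ring)
  show "coreg_lact A b (coreg_ract A a \<phi>) x = coreg_ract A a (coreg_lact A b \<phi>) x" if "x \<in> carrier A" for x
    using that assms by (simp add: coreg_apply A.m_assoc)
qed (use assms in simp_all)

lemma Cr_module [simp]: "left_module K A Cr"
  unfolding coreg_mod_def by (rule copy_left_module[OF DA_fd coreg_left_action])

lemma Cr_E: "s \<in> carrier Cr \<Longrightarrow> (\<And>\<phi>. \<phi> \<in> lin K A (base_space K) \<Longrightarrow> s = eD \<phi> \<Longrightarrow> Q) \<Longrightarrow> Q"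
  unfolding coreg_mod_def eD_def by (erule copyE) simp

lemma eD_closed [simp]: "\<phi> \<in> lin K A (base_space K) \<Longrightarrow> eD \<phi> \<in> carrier Cr"
  unfolding coreg_mod_def eD_def by (rule enc_copy) simp

lemma dD_eD [simp]: "\<phi> \<in> lin K A (base_space K) \<Longrightarrow> dD (eD \<phi>) = \<phi>"
  unfolding dD_def eD_def by (rule dec_enc'[OF DA_fd]) simp

lemma eD_ops:
  assumes "\<phi> \<in> lin K A (base_space K)"
  shows "\<psi> \<in> lin K A (base_space K) \<Longrightarrow> eD \<phi> \<oplus>\<^bsub>Cr\<^esub> eD \<psi> = eD (\<phi> \<oplus>\<^bsub>DA\<^esub> \<psi>)"
    "c \<odot>\<^bsub>Cr\<^esub> eD \<phi> = eD (c \<odot>\<^bsub>DA\<^esub> \<phi>)" "lact Cr a (eD \<phi>) = eD (coreg_lact A a \<phi>)"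
  unfolding coreg_mod_def eD_def by (rule copy_ops[OF DA_fd]; use assms in simp)+

definition rD :: "'a \<Rightarrow> 'u \<Rightarrow> 'u" where
  "rD a = tr (carrier DA) (carrier DA) (coreg_ract A a)"

lemma rD_eD [simp]: "\<phi> \<in> lin K A (base_space K) \<Longrightarrow> rD a (eD \<phi>) = eD (coreg_ract A a \<phi>)"
  unfolding rD_def eD_def by (rule tr_enc[OF DA_fd]) simp

lemma rD_hom:
  assumes a: "a \<in> carrier A"
  shows "rD a \<in> lmod_hom K A Cr Cr"
  unfolding rD_def coreg_mod_def
  by (rule tr_lmod_hom[OF DA_fd DA_fd right_actionD(1)[OF coreg_right_action a] coreg_left_action])
    (use a in \<open>simp add: coreg_commute\<close>)

lemma G_coreg_eq: "G_coreg K A G = add_ract (fob G Cr) (\<lambda>a. farr G Cr Cr (rD a))"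
  by (simp only: G_coreg_def G_bimod_def coreg_mod_def rD_def Let_def)

lemma G_coreg_simps [simp]:
  "carrier (G_coreg K A G) = carrier (fob G Cr)" "lact (G_coreg K A G) = lact (fob G Cr)"
  "ract (G_coreg K A G) a = farr G Cr Cr (rD a)"
  "lin K (G_coreg K A G) N = lin K (fob G Cr) N" "lin K N' (G_coreg K A G) = lin K N' (fob G Cr)"
  by (simp_all add: G_coreg_eq)

lemma G_coreg_bimodule: "bimodule K B A (G_coreg K A G)"
  unfolding G_coreg_def
  by (rule G_bimod_bimodule[OF DA_fd coreg_left_action coreg_right_action coreg_commute])

text \<open>The matrix coefficient of \<open>m\<close> belonging to \<open>\<phi>\<close> and
  \<open>x\<close>.\<close>

definition mc :: "('k, 'u, 'a) lmod \<Rightarrow> ('u \<Rightarrow> 'k) \<Rightarrow> 'u \<Rightarrow> 'a \<Rightarrow> 'k" where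
  "mc m \<phi> x = (\<lambda>a\<in>carrier A. \<phi> (lact m a x))"

definition cg :: "('k, 'u, 'a) lmod \<Rightarrow> ('u \<Rightarrow> 'k) \<Rightarrow> 'u \<Rightarrow> 'u" where
  "cg m \<phi> = (\<lambda>x\<in>carrier m. eD (mc m \<phi> x))"

lemma mc_apply [simp]: "a \<in> carrier A \<Longrightarrow> mc m \<phi> x a = \<phi> (lact m a x)"
  by (simp add: mc_def)

lemma cg_apply [simp]: "x \<in> carrier m \<Longrightarrow> cg m \<phi> x = eD (mc m \<phi> x)"
  by (simp add: cg_def)

section \<open>The coend family at a fixed module\<close>

context
  fixes m :: "('k, 'u, 'a) lmod"
  assumes m [simp]: "left_module K A m"
begin

lemma mc_lin [simp]:
  assumes \<phi>: "\<phi> \<in> lin K m (base_space K)" and x: "x \<in> carrier m"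
  shows "mc m \<phi> x \<in> lin K A (base_space K)"
  unfolding mc_def
  by (rule lin_restrict[OF _ module_homI])
    (use x in \<open>simp_all add: lactD[OF m] linD(4,5)[OF \<phi>] dual_closed[OF \<phi>]\<close>)

lemma cg_hom:
  assumes \<phi>: "\<phi> \<in> lin K m (base_space K)"
  shows "cg m \<phi> \<in> lmod_hom K A m Cr"
proof (intro lmod_homI linI module_homI)
  note [simp] = \<phi> lactD(6)[OF m] module_homD(2,3)[OF lactD(1)[OF m]] linD(4,5)[OF \<phi>]
  note eqI = lin_eqI[of _ A "base_space K"]
  show "cg m \<phi> \<in> extensional (carrier m)" by (simp add: cg_def)
  show "cg m \<phi> x \<in> carrier Cr" if "x \<in> carrier m" for x
    using that by simp
  show "cg m \<phi> (x \<oplus>\<^bsub>m\<^esub> y) = cg m \<phi> x \<oplus>\<^bsub>Cr\<^esub> cg m \<phi> y" if "x \<in> carrier m" "y \<in> carrier m" for x y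
  proof -
    have "mc m \<phi> (x \<oplus>\<^bsub>m\<^esub> y) = mc m \<phi> x \<oplus>\<^bsub>DA\<^esub> mc m \<phi> y"
      by (rule eqI) (use that in simp_all)
    then show ?thesis using that by (simp add: eD_ops)
  qed
  show "cg m \<phi> (c \<odot>\<^bsub>m\<^esub> x) = c \<odot>\<^bsub>Cr\<^esub> cg m \<phi> x" if "c \<in> carrier K" "x \<in> carrier m" for c x
  proof -
    have "mc m \<phi> (c \<odot>\<^bsub>m\<^esub> x) = c \<odot>\<^bsub>DA\<^esub> mc m \<phi> x"
      by (rule eqI) (use that in simp_all)
    then show ?thesis using that by (simp add: eD_ops)
  qed
  show "cg m \<phi> (lact m b x) = lact Cr b (cg m \<phi> x)" if "b \<in> carrier A" "x \<in> carrier m" for b x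
  proof -
    have "mc m \<phi> (lact m b x) = coreg_lact A b (mc m \<phi> x)"
      by (rule eqI) (use that in \<open>simp_all add: coreg_apply lactD(5)[OF m]\<close>)
    then show ?thesis using that by (simp add: eD_ops)
  qed
qed

text \<open>With a pure tensor of m \<otimes> m* held fixed, the maps after the coevaluation send
  \<psi> \<otimes> a to \<phi>(a x) \<psi>. Fed with the coevaluation of A*, such a map returns the
  functional a \<mapsto> \<phi>(a x), by \<open>coev_dual_contr\<close>.\<close>

lemma rho_tilde_hom: "rho_tilde K A m \<in> module_hom K (mm m) DA"
  and rho_tilde_tens: "x \<in> carrier m \<Longrightarrow> \<phi> \<in> lin K m (base_space K) \<Longrightarrow>
    rho_tilde K A m (tens K m (dual K m) x \<phi>) = mc m \<phi> x"
proof -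
  have evr: "(\<lambda>p. ev K m (rho_id K A m p)) \<in> module_hom K (tensor K A (mm m)) (base_space K)"
    by (rule module_hom_comp[OF rho_id_hom[OF m] linD(1)[OF ev_hom(1)]]) simp
  note ta = assoc_hom[of DA A "mm m"]
  note tm = tmap[OF idmap_hom[of DA] evr]
  note ru = runit_hom[of DA]
  \<comment> \<open>Everything in \<open>rho_tilde\<close> after the coevaluation has been inserted,
    as a function of the whole tensor, so that it can be viewed as linear in either
    argument.\<close>
  let ?S = "\<lambda>q. runit K DA (tmap K DA (tensor K A (mm m)) DA (base_space K) (idmap DA)
    (\<lambda>p. ev K m (rho_id K A m p)) (assoc K DA A (mm m) q))"
  have S: "?S \<in> module_hom K (tensor K (tensor K DA A) (mm m)) DA"
    by (rule module_hom_comp[OF module_hom_comp[OF linD(1)[OF ta(1)] linD(1)[OF tm(1)]] linD(1)[OF ru(1)]])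
      simp_all
  have rt: "rho_tilde K A m = (\<lambda>t. ?S (tens K (tensor K DA A) (mm m) (coev_dual K A) t))"
    by (simp add: rho_tilde_def Let_def fun_eq_iff)
  show "rho_tilde K A m \<in> module_hom K (mm m) DA"
    unfolding rt
    by (rule module_hom_comp[OF tens_hom_r S]) (simp_all add: coev_dual_closed)
  show "rho_tilde K A m (tens K m (dual K m) x \<phi>) = mc m \<phi> x"
    if x: "x \<in> carrier m" and \<phi>: "\<phi> \<in> lin K m (base_space K)"
    unfolding rt
  proof (rule coev_dual_contr[OF A_fd mc_lin[OF \<phi> x]])
    let ?t = "tens K m (dual K m) x \<phi>"
    show "(\<lambda>q. ?S (tens K (tensor K DA A) (mm m) q ?t)) \<in> module_hom K (tensor K DA A) DA"
      by (rule module_hom_comp[OF tens_hom_l S]) simp_all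
    fix \<psi> a assume \<psi>: "\<psi> \<in> lin K A (base_space K)" and a: "a \<in> carrier A"
    have "ev K m (rho_id K A m (tens K A (mm m) a ?t)) = \<phi> (lact m a x)"
      using x \<phi> a lactD(6)[OF m a x] rho_id_tens[OF m a, of ?t] act_simps(3)[OF m x \<phi> a]
      by (simp add: ev_hom(2))
    then show "?S (tens K (tensor K DA A) (mm m) (tens K DA A \<psi> a) ?t) = mc m \<phi> x a \<odot>\<^bsub>DA\<^esub> \<psi>"
      using x \<phi> a \<psi> lactD(6)[OF m a x] by (simp add: ta(2) tm(2) ru(2) dual_closed[OF \<phi>])
  qed
qed

text \<open>Both sides send x \<otimes> \<phi> to the functional a \<mapsto> \<phi>(a b x). Only
  with this may \<open>G\<close> be applied to \<open>rho_tilde\<close>.\<close>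

lemma tr_rho_tilde_hom:
  "tr (carrier (mm m)) (carrier DA) (rho_tilde K A m) \<in> lmod_hom K A (P m) Cr"
  unfolding tensor_mod_eq[OF m] coreg_mod_def
proof (rule tr_lmod_hom[OF _ DA_fd rho_tilde_hom tact_left_action[OF fd_A m left_module_fd_A[OF m]]])
  show "fd_space K (mm m)" by simp
  fix b t assume b: "b \<in> carrier A" and t: "t \<in> carrier (mm m)"
  show "rho_tilde K A m (tact m m b t) = coreg_lact A b (rho_tilde K A m t)"
  proof (rule tensor_hom_eqI[OF module_hom_comp[OF tact_hom[OF fd_A m _ b] rho_tilde_hom]
        module_hom_comp[OF rho_tilde_hom left_actionD(1)[OF coreg_left_action b]] _ _ t])
    fix x \<phi> assume x: "x \<in> carrier m" and "\<phi> \<in> carrier (dual K m)"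
    then have \<phi>: "\<phi> \<in> lin K m (base_space K)" by simp
    have "mc m \<phi> (lact m b x) = coreg_lact A b (mc m \<phi> x)"
      by (rule lin_eqI[of _ A "base_space K"])
        (use b x \<phi> in \<open>simp_all add: coreg_apply lactD(5,6)[OF m]\<close>)
    then show "rho_tilde K A m (tact m m b (tens K m (dual K m) x \<phi>)) =
        coreg_lact A b (rho_tilde K A m (tens K m (dual K m) x \<phi>))"
      using b x \<phi> lactD(6)[OF m b x] by (simp add: act_simps[OF m] rho_tilde_tens)
  qed simp_all
qed

definition kap :: "('u \<times> ('u \<Rightarrow> 'k) \<Rightarrow> 'k) set \<Rightarrow> 'u" where
  "kap t = farr G (P m) Cr (tr (carrier (mm m)) (carrier DA) (rho_tilde K A m)) (G_tensor K G m t)"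

lemma kap_hom: "kap \<in> module_hom K (T m m) (fob G Cr)"
  unfolding kap_def[abs_def]
  by (rule module_hom_comp[OF linD(1)[OF G_tensor(1)[OF m]]
      lmod_homD(2)[OF G_hom[OF P_module[OF m] Cr_module tr_rho_tilde_hom]]])

text \<open>On the module side \<open>rho_tilde\<close> after \<open>iota \<phi>\<close> is
  \<open>cg m \<phi>\<close>, so functoriality of \<open>G\<close> removes both m \<otimes> m* and
  \<open>G_tensor\<close> from the formula.\<close>

lemma kap_tens [simp]:
  assumes y: "y \<in> carrier (fob G m)" and \<phi>: "\<phi> \<in> lin K m (base_space K)"
  shows "kap (tens K (fob G m) (dual K m) y \<phi>) = farr G m Cr (cg m \<phi>) y"
  unfolding kap_def G_tensor(2)[OF m y \<phi>]
proof (rule G_comp_apply[OF m P_module[OF m] Cr_module iota_hom[OF m \<phi>] tr_rho_tilde_hom cg_hom[OF \<phi>] _ y])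
  fix x assume x: "x \<in> carrier m"
  have "tr (carrier (mm m)) (carrier DA) (rho_tilde K A m) (iota m \<phi> x) = eD (rho_tilde K A m (tens K m (dual K m) x \<phi>))"
    using x unfolding iota_def[OF m] eD_def by (simp only: restrict_apply' tr_enc[OF mm_fd[OF m] tens_closed])
  then show "tr (carrier (mm m)) (carrier DA) (rho_tilde K A m) (iota m \<phi> x) = cg m \<phi> x"
    using x \<phi> by (simp add: rho_tilde_tens)
qed

lemma coend_family_eq:
  "coend_family K A G m = (\<lambda>y\<in>carrier (copy_lmod (T m m) (Lact m m) :: ('k, 'u, 'b) lmod). kap (dec (carrier (T m m)) y))"
  unfolding coend_family_def kap_def Gtilde_ob copy_bimod_simps ..

lemma coend_family_enc [simp]: "t \<in> carrier (T m m) \<Longrightarrow> coend_family K A G m (enc (carrier (T m m)) t) = kap t"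
  by (simp add: coend_family_eq)

lemma coend_family_hom: "coend_family K A G m \<in> bimod_hom K B A (fob (Gtilde K G) (m, m)) (G_coreg K A G)"
  unfolding Gtilde_ob
proof (rule bimod_homI, unfold copy_bimod_simps G_coreg_simps)
  let ?C = "copy_lmod (T m m) (Lact m m) :: ('k, 'u, 'b) lmod"
  note k = module_homD[OF kap_hom]
  have eq: "F t = F' t" if "F \<in> module_hom K (T m m) (fob G Cr)" "F' \<in> module_hom K (T m m) (fob G Cr)" "t \<in> carrier (T m m)"
    "\<And>y \<phi>. y \<in> carrier (fob G m) \<Longrightarrow> \<phi> \<in> lin K m (base_space K) \<Longrightarrow>
      F (tens K (fob G m) (dual K m) y \<phi>) = F' (tens K (fob G m) (dual K m) y \<phi>)" for F F' t
    by (rule tensor_hom_eqI[OF that(1,2) _ _ that(3)]) (simp_all add: that(4))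
  have left: "kap (Lact m m b t) = lact (fob G Cr) b (kap t)" if b: "b \<in> carrier B" and t: "t \<in> carrier (T m m)" for b t
  proof (rule eq[OF module_hom_comp[OF tact_hom[OF fd_B G_ob[OF m] _ b] kap_hom] module_hom_comp[OF kap_hom lactD(1)[OF G_ob[OF Cr_module] b]] t])
    fix y \<phi> assume "y \<in> carrier (fob G m)" "\<phi> \<in> lin K m (base_space K)"
    then show "kap (Lact m m b (tens K (fob G m) (dual K m) y \<phi>)) = lact (fob G Cr) b (kap (tens K (fob G m) (dual K m) y \<phi>))"
      using b lactD(6)[OF G_ob[OF m] b]
      by (simp add: tact_tens[OF fd_B G_ob[OF m]] lmod_homD(4)[OF G_hom[OF m Cr_module cg_hom]])
  qed simp
  have right: "kap (Ract m m a t) = farr G Cr Cr (rD a) (kap t)" if a: "a \<in> carrier A" and t: "t \<in> carrier (T m m)" for a t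
  proof (rule eq[OF module_hom_comp[OF Ract_hom[OF m m a] kap_hom]
        module_hom_comp[OF kap_hom lmod_homD(2)[OF G_hom[OF Cr_module Cr_module rD_hom[OF a]]]] t])
    fix y \<phi> assume y: "y \<in> carrier (fob G m)" and \<phi>: "\<phi> \<in> lin K m (base_space K)"
    have d: "dual_map m (lact m a) \<phi> \<in> lin K m (base_space K)"
      by (rule dual_map_closed[OF _ lactD(1)[OF m a] \<phi>]) simp
    \<comment> \<open>Right translation by a of the matrix coefficient is b \<mapsto> \<phi>(a b x),
      the matrix coefficient of the functional \<phi> acted on by a.\<close>
    have "farr G Cr Cr (rD a) (farr G m Cr (cg m \<phi>) y) = farr G m Cr (cg m (dual_map m (lact m a) \<phi>)) y"
    proof (rule G_comp_apply[OF m Cr_module Cr_module cg_hom[OF \<phi>] rD_hom[OF a] cg_hom[OF d] _ y])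
      fix x assume x: "x \<in> carrier m"
      have "coreg_ract A a (mc m \<phi> x) = mc m (dual_map m (lact m a) \<phi>) x"
        by (rule lin_eqI[of _ A "base_space K"])
          (use a x \<phi> d in \<open>simp_all add: coreg_apply lactD(5,6)[OF m]\<close>)
      then show "rD a (cg m \<phi> x) = cg m (dual_map m (lact m a) \<phi>) x"
        using x \<phi> by simp
    qed
    then show "kap (Ract m m a (tens K (fob G m) (dual K m) y \<phi>)) = farr G Cr Cr (rD a) (kap (tens K (fob G m) (dual K m) y \<phi>))"
      using y \<phi> d by (simp add: Ract_tens[OF m m a])
  qed
  show "coend_family K A G m \<in> lin K ?C (fob G Cr)"
    unfolding coend_family_eq
    by (rule lin_restrict[OF _ module_homI]) (auto elim!: copyE simp: k)
  show "coend_family K A G m (lact ?C b y) = lact (fob G Cr) b (coend_family K A G m y)"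
    if "b \<in> carrier B" "y \<in> carrier ?C" for b y
    using that(2) by (rule copyE) (use that(1) in \<open>simp add: left\<close>)
  show "coend_family K A G m (tr (carrier (T m m)) (carrier (T m m)) (Ract m m a) y) =
      farr G Cr Cr (rD a) (coend_family K A G m y)"
    if "a \<in> carrier A" "y \<in> carrier ?C" for a y
    using that(2) by (rule copyE) (use that(1) in \<open>simp add: right\<close>)
qed

end

section \<open>Dinaturality and universality of the coend family\<close>

lemma restrict_copy_eqI:
  fixes V :: "('k, 'v, 'z) module_scheme"
  assumes "\<And>t. t \<in> carrier V \<Longrightarrow> f (enc (carrier V) t) = g (enc (carrier V) t)"
  shows "(\<lambda>y\<in>carrier (copy_lmod V l :: ('k, 'u, 'c) lmod). f y) = (\<lambda>y\<in>carrier (copy_lmod V l :: ('k, 'u, 'c) lmod). g y)"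
  by (rule restrict_ext) (auto elim!: copyE simp: assms)

lemma coend_cowedge: "is_cowedge (lmod_cat K A) (bimod_cat K B A) (Gtilde K G) (G_coreg K A G) (coend_family K A G)"
  unfolding is_cowedge_def
proof (intro conjI ballI)
  show "G_coreg K A G \<in> Ob (bimod_cat K B A)"
    by (simp add: bimod_cat_def G_coreg_bimodule)
  fix c assume "c \<in> Ob (lmod_cat K A :: (('k, 'u, 'a) lmod, 'u \<Rightarrow> 'u) cat)"
  then have c [simp]: "left_module K A c" by (simp add: lmod_cat_def)
  show "coend_family K A G c \<in> Hom (bimod_cat K B A) (fob (Gtilde K G) (c, c)) (G_coreg K A G)"
    by (simp add: bimod_cat_def coend_family_hom)
  fix d f assume "d \<in> Ob (lmod_cat K A :: (('k, 'u, 'a) lmod, 'u \<Rightarrow> 'u) cat)" "f \<in> Hom (lmod_cat K A) c d"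
  then have d [simp]: "left_module K A d" and f: "f \<in> lmod_hom K A c d" by (simp_all add: lmod_cat_def)
  note ids = idmap_lmod_hom[OF c] idmap_lmod_hom[OF d]
  note cl = Tmap_closed[OF c d c c ids(1) f] Tmap_closed[OF c d d d f ids(2)]
  have eq: "kap c (Tmap c d c c (idmap c) f t) = kap d (Tmap c d d d f (idmap d) t)"
    if t: "t \<in> carrier (T c d)" for t
  proof (rule tensor_hom_eqI[OF module_hom_comp[OF Tmap_hom[OF c d c c ids(1) f] kap_hom[OF c]]
        module_hom_comp[OF Tmap_hom[OF c d d d f ids(2)] kap_hom[OF d]] _ _ t])
    fix y \<phi> assume y: "y \<in> carrier (fob G c)" and "\<phi> \<in> carrier (dual K d)"
    then have \<phi>: "\<phi> \<in> lin K d (base_space K)" by simp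
    have fp: "dual_map c f \<phi> \<in> lin K c (base_space K)" "dual_map d (idmap d) \<phi> = \<phi>"
      using dual_map_closed[OF _ lmod_homD(2)[OF f] \<phi>] linD(2)[OF \<phi>]
      by (auto simp: dual_map_def fun_eq_iff extensional_def)
    have fy: "farr G c d f y \<in> carrier (fob G d)"
      by (rule lmod_homD(3)[OF G_hom[OF c d f] y])
    \<comment> \<open>Since \<open>f\<close> commutes with the action, \<phi>(a f(x)) = \<phi>(f(a
      x)): the map for \<open>\<phi>\<close> after \<open>f\<close> is the map for the pullback of
      \<open>\<phi>\<close> along \<open>f\<close>.\<close>
    have "farr G d Cr (cg d \<phi>) (farr G c d f y) = farr G c Cr (cg c (dual_map c f \<phi>)) y"
    proof (rule G_comp_apply[OF c d Cr_module f cg_hom[OF d \<phi>] cg_hom[OF c fp(1)] _ y])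
      fix x assume x: "x \<in> carrier c"
      have "mc d \<phi> (f x) = mc c (dual_map c f \<phi>) x"
        by (rule lin_eqI[of _ A "base_space K"])
          (use x \<phi> fp lmod_homD(3)[OF f] in \<open>simp_all add: lmod_homD(4)[OF f] lactD(6)[OF c]\<close>)
      then show "cg d \<phi> (f x) = cg c (dual_map c f \<phi>) x"
        using x lmod_homD(3)[OF f x] by simp
    qed
    then show "kap c (Tmap c d c c (idmap c) f (tens K (fob G c) (dual K d) y \<phi>)) =
        kap d (Tmap c d d d f (idmap d) (tens K (fob G c) (dual K d) y \<phi>))"
      using Tmap_tens[OF c d c c ids(1) f y \<phi>] Tmap_tens[OF c d d d f ids(2) y \<phi>] y \<phi> fp fy
      by (simp add: G_id)
  qed simp_all
  show "ccomp (bimod_cat K B A) (fob (Gtilde K G) (c, d)) (fob (Gtilde K G) (c, c)) (G_coreg K A G) (coend_family K A G c)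
        (farr (Gtilde K G) (c, d) (c, c) (ident (lmod_cat K A) c, f)) =
      ccomp (bimod_cat K B A) (fob (Gtilde K G) (c, d)) (fob (Gtilde K G) (d, d)) (G_coreg K A G) (coend_family K A G d)
        (farr (Gtilde K G) (c, d) (d, d) (f, ident (lmod_cat K A) d))"
    unfolding bimod_cat_def lmod_cat_def cat.simps Gtilde_arr compose_def Gtilde_ob copy_bimod_simps
    by (rule restrict_copy_eqI) (simp add: eq cl)
qed

definition ev1 :: "'u \<Rightarrow> 'k" where
  "ev1 = (\<lambda>s\<in>carrier Cr. dD s \<one>\<^bsub>A\<^esub>)"

lemma ev1_eD [simp]: "\<phi> \<in> lin K A (base_space K) \<Longrightarrow> ev1 (eD \<phi>) = \<phi> \<one>\<^bsub>A\<^esub>"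
  by (simp add: ev1_def)

lemma ev1_lin [simp]: "ev1 \<in> lin K Cr (base_space K)"
proof (rule linI[OF module_homI])
  show "ev1 \<in> extensional (carrier Cr)" by (simp add: ev1_def)
qed (auto elim!: Cr_E simp: eD_ops intro: dual_closed[OF _ A_closed(1)])

text \<open>The coregular left action translates the argument by right multiplication, so evaluating
  a s at one gives s(1 a) = s(a).\<close>

lemma cg_ev1: "cg Cr ev1 = idmap Cr"
proof (rule lmod_hom_eqI[OF cg_hom[OF Cr_module ev1_lin] idmap_lmod_hom[OF Cr_module]])
  interpret A: ring A by (rule A_ring)
  fix s assume "s \<in> carrier Cr"
  then obtain \<phi> where \<phi>: "\<phi> \<in> lin K A (base_space K)" and s: "s = eD \<phi>" by (rule Cr_E)
  have "mc Cr ev1 s = \<phi>"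
    by (rule lin_eqI[of _ A "base_space K"]) (use \<phi> s in \<open>simp_all add: eD_ops coreg_apply\<close>)
  then show "cg Cr ev1 s = idmap Cr s"
    using \<phi> s by simp
qed

lemma dual_map_cg_ev1:
  assumes m: "left_module K A m" and \<phi>: "\<phi> \<in> lin K m (base_space K)"
  shows "dual_map m (cg m \<phi>) ev1 = \<phi>"
proof (rule lin_eqI[of _ m "base_space K"])
  show "dual_map m (cg m \<phi>) ev1 \<in> lin K m (base_space K)"
    by (rule dual_map_closed[OF _ lmod_homD(2)[OF cg_hom[OF m \<phi>]]]) (use m in simp_all)
qed (use m \<phi> in \<open>simp_all add: lactD(2)[OF m]\<close>)

text \<open>Evaluated at one, left and right translation of a functional s by a both give s(a). This
  converts the right action on A* into the transposed left action that defines the right action on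
  the tensor factor.\<close>

lemma dual_map_rD_ev1:
  assumes a: "a \<in> carrier A"
  shows "dual_map Cr (rD a) ev1 = dual_map Cr (lact Cr a) ev1"
proof -
  interpret A: ring A by (rule A_ring)
  show ?thesis
    unfolding dual_map_def
    by (rule restrict_ext) (auto elim!: Cr_E simp: a eD_ops coreg_apply)
qed

lemma coend_universal:
  assumes "is_cowedge (lmod_cat K A) (bimod_cat K B A) (Gtilde K G) Q j"
  shows "\<exists>!h. h \<in> Hom (bimod_cat K B A) (G_coreg K A G) Q \<and> (\<forall>c\<in>Ob (lmod_cat K A).
    ccomp (bimod_cat K B A) (fob (Gtilde K G) (c, c)) (G_coreg K A G) Q h (coend_family K A G c) = j c)"
proof -
  have Q: "bimodule K B A Q"
    and j: "\<And>c. left_module K A c \<Longrightarrow> j c \<in> bimod_hom K B A (fob (Gtilde K G) (c, c)) Q"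
    and dinat: "\<And>c d f. left_module K A c \<Longrightarrow> left_module K A d \<Longrightarrow> f \<in> lmod_hom K A c d \<Longrightarrow>
      compose (carrier (fob (Gtilde K G) (c, d))) (j c) (farr (Gtilde K G) (c, d) (c, c) (idmap c, f)) =
      compose (carrier (fob (Gtilde K G) (c, d))) (j d) (farr (Gtilde K G) (c, d) (d, d) (f, idmap d))"
    using assms by (simp_all add: is_cowedge_def bimod_cat_def lmod_cat_def)
  \<comment> \<open>The cowedge read on the tensor product itself instead of its copy, so that it
    can be compared on pure tensors.\<close>
  define J where "J c t = j c (enc (carrier (T c c)) t)" for c t
  note jD = bimod_homD[OF j, unfolded Gtilde_ob copy_bimod_simps]
  have J_hom: "J c \<in> module_hom K (T c c) Q" if c [simp]: "left_module K A c" for c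
    unfolding J_def[abs_def]
  proof (rule module_hom_comp[OF _ linD(1)[OF jD(1)[OF c]]])
    show "enc (carrier (T c c)) \<in> module_hom K (T c c) (copy_lmod (T c c) (Lact c c) :: ('k, 'u, 'b) lmod)"
      by (rule module_homI) simp_all
  qed
  have J_left: "J c (Lact c c b t) = lact Q b (J c t)"
    if [simp]: "left_module K A c" and "b \<in> carrier B" "t \<in> carrier (T c c)" for c b t
    using jD(3)[OF that(1,2), of "enc (carrier (T c c)) t"] that by (simp add: J_def)
  have J_right: "J c (Ract c c a t) = ract Q a (J c t)"
    if [simp]: "left_module K A c" and "a \<in> carrier A" "t \<in> carrier (T c c)" for c a t
    using jD(4)[OF that(1,2), of "enc (carrier (T c c)) t"] that by (simp add: J_def)
  \<comment> \<open>Dinaturality along \<open>f\<close>, applied to y \<otimes> \<phi> in G(c)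
    \<otimes> d*: \<open>f\<close> may be moved across the tensor sign, from the functional to the
    vector.\<close>
  have key: "J c (tens K (fob G c) (dual K c) y (dual_map c f \<phi>)) =
      J d (tens K (fob G d) (dual K d) (farr G c d f y) \<phi>)"
    if c [simp]: "left_module K A c" and d [simp]: "left_module K A d" and f: "f \<in> lmod_hom K A c d"
      and y: "y \<in> carrier (fob G c)" and \<phi>: "\<phi> \<in> lin K d (base_space K)" for c d f y \<phi>
  proof -
    note ids = idmap_lmod_hom[OF c] idmap_lmod_hom[OF d]
    let ?t = "tens K (fob G c) (dual K d) y \<phi>"
    have "dual_map d (idmap d) \<phi> = \<phi>"
      using linD(2)[OF \<phi>] by (auto simp: dual_map_def fun_eq_iff extensional_def)
    moreover from fun_cong[OF dinat[OF c d f], of "enc (carrier (T c d)) ?t"]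
    have "J c (Tmap c d c c (idmap c) f ?t) = J d (Tmap c d d d f (idmap d) ?t)"
      unfolding Gtilde_arr Gtilde_ob copy_bimod_simps by (simp add: compose_eq J_def)
    ultimately show ?thesis
      using y unfolding Tmap_tens[OF c d c c ids(1) f y \<phi>] Tmap_tens[OF c d d d f ids(2) y \<phi>]
      by (simp add: G_id)
  qed
  let ?t = "\<lambda>y. tens K (fob G Cr) (dual K Cr) y ev1"
  define h where "h = (\<lambda>y\<in>carrier (fob G Cr). J Cr (?t y))"
  have h: "h \<in> bimod_hom K B A (G_coreg K A G) Q"
  proof (rule bimod_homI, unfold G_coreg_simps)
    have "(\<lambda>y. J Cr (?t y)) \<in> module_hom K (fob G Cr) Q"
      by (rule module_hom_comp[OF tens_hom_l J_hom]) simp_all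
    then show "h \<in> lin K (fob G Cr) Q"
      unfolding h_def by (rule lin_restrict[rotated]) simp
    show "h (lact (fob G Cr) b y) = lact Q b (h y)" if b: "b \<in> carrier B" and y: "y \<in> carrier (fob G Cr)" for b y
      using J_left[OF Cr_module b, of "?t y"] tact_tens[OF fd_B G_ob[OF Cr_module] left_module_fd_A[OF Cr_module] y ev1_lin b]
        lactD(6)[OF G_ob[OF Cr_module] b y] y by (simp add: h_def)
    \<comment> \<open>By \<open>key\<close> the translation \<open>rD a\<close> moves from y to
      \<open>ev1\<close>, there it may be replaced by the left action of a, and that is the right
      action on y \<otimes> \<open>ev1\<close>.\<close>
    show "h (farr G Cr Cr (rD a) y) = ract Q a (h y)" if a: "a \<in> carrier A" and y: "y \<in> carrier (fob G Cr)" for a y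
      using J_right[OF Cr_module a, of "?t y"] Ract_tens[OF Cr_module Cr_module a y ev1_lin]
        key[OF Cr_module Cr_module rD_hom[OF a] y ev1_lin] dual_map_rD_ev1[OF a]
        lmod_homD(3)[OF G_hom[OF Cr_module Cr_module rD_hom[OF a]] y] y by (simp add: h_def)
  qed
  note hl = bimod_homD(1)[OF h, unfolded G_coreg_simps]
  \<comment> \<open>On y \<otimes> \<phi> this is \<open>key\<close> along
    \<open>cg c \<phi>\<close> with the functional \<open>ev1\<close>, whose pullback is
    \<open>\<phi>\<close>.\<close>
  have hk: "h (kap c t) = J c t" if c [simp]: "left_module K A c" and t: "t \<in> carrier (T c c)" for c t
  proof (rule tensor_hom_eqI[OF module_hom_comp[OF kap_hom[OF c] linD(1)[OF hl]] J_hom[OF c] _ _ t])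
    fix y \<phi> assume y: "y \<in> carrier (fob G c)" and "\<phi> \<in> carrier (dual K c)"
    then have \<phi>: "\<phi> \<in> lin K c (base_space K)" by simp
    show "h (kap c (tens K (fob G c) (dual K c) y \<phi>)) = J c (tens K (fob G c) (dual K c) y \<phi>)"
      using key[OF c Cr_module cg_hom[OF c \<phi>] y ev1_lin] dual_map_cg_ev1[OF c \<phi>]
        lmod_homD(3)[OF G_hom[OF c Cr_module cg_hom[OF c \<phi>]] y] y \<phi> by (simp add: h_def)
  qed simp_all
  show ?thesis
  proof (rule ex1I[of _ h])
    have "compose (carrier (fob (Gtilde K G) (c, c))) h (coend_family K A G c) = j c" if c: "left_module K A c" for c
      unfolding Gtilde_ob copy_bimod_simps
    proof (rule extensionalityI[OF _ linD(2)[OF jD(1)[OF c]]])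
      fix y assume y: "y \<in> carrier (copy_lmod (T c c) (Lact c c) :: ('k, 'u, 'b) lmod)"
      then obtain t where t: "t \<in> carrier (T c c)" "y = enc (carrier (T c c)) t" by (rule copyE)
      show "compose (carrier (copy_lmod (T c c) (Lact c c) :: ('k, 'u, 'b) lmod)) h (coend_family K A G c) y = j c y"
        using y t c hk[OF c t(1)] by (simp add: compose_eq J_def)
    qed simp
    then show "h \<in> Hom (bimod_cat K B A) (G_coreg K A G) Q \<and> (\<forall>c\<in>Ob (lmod_cat K A).
        ccomp (bimod_cat K B A) (fob (Gtilde K G) (c, c)) (G_coreg K A G) Q h (coend_family K A G c) = j c)"
      using h by (simp add: bimod_cat_def lmod_cat_def)
  next
    fix g assume "g \<in> Hom (bimod_cat K B A) (G_coreg K A G) Q \<and> (\<forall>c\<in>Ob (lmod_cat K A).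
        ccomp (bimod_cat K B A) (fob (Gtilde K G) (c, c)) (G_coreg K A G) Q g (coend_family K A G c) = j c)"
    then have g: "g \<in> bimod_hom K B A (G_coreg K A G) Q"
      and gj: "compose (carrier (fob (Gtilde K G) (Cr, Cr))) g (coend_family K A G Cr) = j Cr"
      by (simp_all add: bimod_cat_def lmod_cat_def)
    note gl = bimod_homD(1)[OF g, unfolded G_coreg_simps]
    show "g = h"
    proof (rule lin_eqI[OF gl hl])
      fix y assume y: "y \<in> carrier (fob G Cr)"
      \<comment> \<open>The family at A* is onto: y is the image of y \<otimes> \<open>ev1\<close>,
        as \<open>cg Cr ev1\<close> is the identity. The component at A* therefore determines
        \<open>g\<close>.\<close>
      have "h y = compose (carrier (fob (Gtilde K G) (Cr, Cr))) g (coend_family K A G Cr) (enc (carrier (T Cr Cr)) (?t y))"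
        using y by (simp add: h_def J_def gj)
      also have "\<dots> = g (kap Cr (?t y))"
        unfolding Gtilde_ob copy_bimod_simps by (simp add: compose_eq)
      also have "\<dots> = g y"
        unfolding kap_tens[OF Cr_module y ev1_lin] cg_ev1 using y by (simp add: G_id)
      finally show "g y = h y" by simp
    qed
  qed
qed

theorem G_coreg_is_coend:
  "is_coend (lmod_cat K A) (bimod_cat K B A) (Gtilde K G) (G_coreg K A G) (coend_family K A G)"
  unfolding is_coend_def using Gtilde_functor coend_cowedge coend_universal by blast

end

theorem proposition2p8:
  fixes K :: "'k ring"
    and A :: "('k, 'a) module"
    and B :: "('k, 'b) module"
    and G :: "(('k, 'u, 'a) lmod, 'u \<Rightarrow> 'u, ('k, 'u, 'b) lmod, 'u \<Rightarrow> 'u) fctr"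
  assumes "algebraically_closed K"
    and "fd_algebra K A"
    and "fd_algebra K B"
    and "carrier K \<lesssim> (UNIV :: 'u set)"
    and "linear_functor K A B G"
  shows "is_end (lmod_cat K A) (bimod_cat K B A) (Gtilde K G) (G_reg A G) (end_family K A G)
    \<and> is_coend (lmod_cat K A) (bimod_cat K B A) (Gtilde K G) (G_coreg K A G) (coend_family K A G)"
proof -
  interpret setting K A B G
    using assms by (simp add: setting_def ground_field_def setting_axioms_def algebraically_closed.axioms(1))
  show ?thesis
    using G_reg_is_end G_coreg_is_coend by blast
qed

end
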